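(* If there is an embedding $F:\mathsf{Comp}\to\mathbb N$, then equality between computable partial functions is decidable: for all $f,g:\mathsf{Comp}$, $(f=g)+\neg(f=g)$. In particular, for every computable $f$, either $f$ equals the constant function $\lambda x.\eta(0)$ or it does not.
   Context: Type theory: Martin-Löf type theory with universe $\mathcal U$, function extensionality, proposition extensionality and propositional truncations. $\mathcal L(Y):=\sum_{P:\mathcal U}\operatorname{isProp}(P)\times(P\to Y)$, $\eta(y)=(1,-,\lambda u.y)$. Recursive machine: a pair $m=(i,s)$ of unary primitive recursive functions, $s$ read as $\mathbb N\to\mathbb N+\mathbb N$ via $\mathrm{inl}(n)=2n$, $\mathrm{inr}(n)=2n+1$; $\operatorname{run}_k(m,x):=s'^k(\mathrm{inl}(i(x)))$ where $s'(\mathrm{inl}\,x)=s(x)$, $s'(\mathrm{inr}\,y)=\mathrm{inr}\,y$; $\operatorname{eval}(m)(x)$ has extent $\sum_y\lVert\sum_k\operatorname{run}_k(m,x)=\mathrm{inr}\,y\rVert$ and value the first projection. $\mathsf{isComputable}(f):=\lVert\sum_m f=\operatorname{eval}(m)\rVert$ and $\mathsf{Comp}:=\sum_{f:\mathbb N\to\mathcal L(\mathbb N)}\mathsf{isComputable}(f)$. An embedding is a map whose fibers are propositions. *)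

theory Defs
  imports Main
begin

text \<open>
  The theorem is a statement of constructive type theory: read directly in HOL, the disjunction
  \<open>(f = g) + \<not> (f = g)\<close> would be an instance of excluded middle. The type theory is
  therefore represented as an object language, and a theorem of type theory is a closed type for
  which a closed term is derivable.
\<close>

section \<open>Raw syntax\<close>

text \<open>
  De Bruijn indices; types and terms share one syntactic category. Binding structure:
  \<open>Pi A B\<close>, \<open>Lam A t\<close> and \<open>Sig A B\<close> bind one variable in the second argument;
  \<open>Case C l r s\<close> one in each of \<open>C\<close>, \<open>l\<close>, \<open>r\<close>; \<open>Efq C t\<close> and \<open>UnitRec C c t\<close> one in
  \<open>C\<close>; \<open>NatRec C z s n\<close> one in \<open>C\<close> and two in \<open>s\<close> (index 0 is the recursive
  value, index 1 the predecessor); \<open>J C d p\<close> two in \<open>C\<close> (index 0 is the identification,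
  index 1 its end point).
\<close>

datatype tm =
    Var nat
  | Univ
  | Pi tm tm | Lam tm tm | App tm tm
  | Sig tm tm | Pr tm tm | P1 tm | P2 tm
  | Plus tm tm | In1 tm | In2 tm | Case tm tm tm tm
  | Empty | Efq tm tm
  | Unit | Star | UnitRec tm tm tm
  | Nat | Zero | Succ tm | NatRec tm tm tm tm
  | Eq tm tm tm | Refl tm | J tm tm tm
  | Trunc tm | TrIn tm | TrEq tm tm | TrRec tm tm tm tm
  | FunExt tm tm tm
  | PropExt tm tm tm tm tm tm

fun upr :: "(nat \<Rightarrow> nat) \<Rightarrow> nat \<Rightarrow> nat" where
  "upr r 0 = 0"
| "upr r (Suc n) = Suc (r n)"

primrec ren :: "(nat \<Rightarrow> nat) \<Rightarrow> tm \<Rightarrow> tm" where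
  "ren r (Var n) = Var (r n)"
| "ren r Univ = Univ"
| "ren r (Pi A B) = Pi (ren r A) (ren (upr r) B)"
| "ren r (Lam A t) = Lam (ren r A) (ren (upr r) t)"
| "ren r (App t u) = App (ren r t) (ren r u)"
| "ren r (Sig A B) = Sig (ren r A) (ren (upr r) B)"
| "ren r (Pr t u) = Pr (ren r t) (ren r u)"
| "ren r (P1 t) = P1 (ren r t)"
| "ren r (P2 t) = P2 (ren r t)"
| "ren r (Plus A B) = Plus (ren r A) (ren r B)"
| "ren r (In1 t) = In1 (ren r t)"
| "ren r (In2 t) = In2 (ren r t)"
| "ren r (Case C t u s) =
     Case (ren (upr r) C) (ren (upr r) t) (ren (upr r) u) (ren r s)"
| "ren r Empty = Empty"
| "ren r (Efq C t) = Efq (ren (upr r) C) (ren r t)"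
| "ren r Unit = Unit"
| "ren r Star = Star"
| "ren r (UnitRec C c t) = UnitRec (ren (upr r) C) (ren r c) (ren r t)"
| "ren r Nat = Nat"
| "ren r Zero = Zero"
| "ren r (Succ t) = Succ (ren r t)"
| "ren r (NatRec C z s n) =
     NatRec (ren (upr r) C) (ren r z) (ren (upr (upr r)) s) (ren r n)"
| "ren r (Eq A t u) = Eq (ren r A) (ren r t) (ren r u)"
| "ren r (Refl t) = Refl (ren r t)"
| "ren r (J C d p) = J (ren (upr (upr r)) C) (ren r d) (ren r p)"
| "ren r (Trunc A) = Trunc (ren r A)"
| "ren r (TrIn t) = TrIn (ren r t)"
| "ren r (TrEq t u) = TrEq (ren r t) (ren r u)"
| "ren r (TrRec B h f t) = TrRec (ren r B) (ren r h) (ren r f) (ren r t)"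
| "ren r (FunExt f g h) = FunExt (ren r f) (ren r g) (ren r h)"
| "ren r (PropExt P Q hP hQ f g) =
     PropExt (ren r P) (ren r Q) (ren r hP) (ren r hQ) (ren r f) (ren r g)"

abbreviation wk :: "tm \<Rightarrow> tm" where "wk \<equiv> ren Suc"

fun scons :: "tm \<Rightarrow> (nat \<Rightarrow> tm) \<Rightarrow> nat \<Rightarrow> tm" (infixr "\<rhd>" 65) where
  "(a \<rhd> \<sigma>) 0 = a"
| "(a \<rhd> \<sigma>) (Suc n) = \<sigma> n"

definition ups :: "(nat \<Rightarrow> tm) \<Rightarrow> nat \<Rightarrow> tm" where
  "ups \<sigma> = Var 0 \<rhd> (\<lambda>n. wk (\<sigma> n))"

primrec sub :: "(nat \<Rightarrow> tm) \<Rightarrow> tm \<Rightarrow> tm" where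
  "sub \<sigma> (Var n) = \<sigma> n"
| "sub \<sigma> Univ = Univ"
| "sub \<sigma> (Pi A B) = Pi (sub \<sigma> A) (sub (ups \<sigma>) B)"
| "sub \<sigma> (Lam A t) = Lam (sub \<sigma> A) (sub (ups \<sigma>) t)"
| "sub \<sigma> (App t u) = App (sub \<sigma> t) (sub \<sigma> u)"
| "sub \<sigma> (Sig A B) = Sig (sub \<sigma> A) (sub (ups \<sigma>) B)"
| "sub \<sigma> (Pr t u) = Pr (sub \<sigma> t) (sub \<sigma> u)"
| "sub \<sigma> (P1 t) = P1 (sub \<sigma> t)"
| "sub \<sigma> (P2 t) = P2 (sub \<sigma> t)"
| "sub \<sigma> (Plus A B) = Plus (sub \<sigma> A) (sub \<sigma> B)"
| "sub \<sigma> (In1 t) = In1 (sub \<sigma> t)"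
| "sub \<sigma> (In2 t) = In2 (sub \<sigma> t)"
| "sub \<sigma> (Case C t u s) =
     Case (sub (ups \<sigma>) C) (sub (ups \<sigma>) t) (sub (ups \<sigma>) u) (sub \<sigma> s)"
| "sub \<sigma> Empty = Empty"
| "sub \<sigma> (Efq C t) = Efq (sub (ups \<sigma>) C) (sub \<sigma> t)"
| "sub \<sigma> Unit = Unit"
| "sub \<sigma> Star = Star"
| "sub \<sigma> (UnitRec C c t) = UnitRec (sub (ups \<sigma>) C) (sub \<sigma> c) (sub \<sigma> t)"
| "sub \<sigma> Nat = Nat"
| "sub \<sigma> Zero = Zero"
| "sub \<sigma> (Succ t) = Succ (sub \<sigma> t)"
| "sub \<sigma> (NatRec C z s n) =
     NatRec (sub (ups \<sigma>) C) (sub \<sigma> z) (sub (ups (ups \<sigma>)) s) (sub \<sigma> n)"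
| "sub \<sigma> (Eq A t u) = Eq (sub \<sigma> A) (sub \<sigma> t) (sub \<sigma> u)"
| "sub \<sigma> (Refl t) = Refl (sub \<sigma> t)"
| "sub \<sigma> (J C d p) = J (sub (ups (ups \<sigma>)) C) (sub \<sigma> d) (sub \<sigma> p)"
| "sub \<sigma> (Trunc A) = Trunc (sub \<sigma> A)"
| "sub \<sigma> (TrIn t) = TrIn (sub \<sigma> t)"
| "sub \<sigma> (TrEq t u) = TrEq (sub \<sigma> t) (sub \<sigma> u)"
| "sub \<sigma> (TrRec B h f t) = TrRec (sub \<sigma> B) (sub \<sigma> h) (sub \<sigma> f) (sub \<sigma> t)"
| "sub \<sigma> (FunExt f g h) = FunExt (sub \<sigma> f) (sub \<sigma> g) (sub \<sigma> h)"
| "sub \<sigma> (PropExt P Q hP hQ f g) =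
     PropExt (sub \<sigma> P) (sub \<sigma> Q) (sub \<sigma> hP) (sub \<sigma> hQ) (sub \<sigma> f) (sub \<sigma> g)"

abbreviation inst :: "tm \<Rightarrow> tm \<Rightarrow> tm" where
  "inst B a \<equiv> sub (a \<rhd> Var) B"

abbreviation inst2 :: "tm \<Rightarrow> tm \<Rightarrow> tm \<Rightarrow> tm" where
  "inst2 C b p \<equiv> sub (p \<rhd> b \<rhd> Var) C"

definition Arr :: "tm \<Rightarrow> tm \<Rightarrow> tm" where
  "Arr A B = Pi A (wk B)"

definition IsProp :: "tm \<Rightarrow> tm" where
  "IsProp A = Pi A (Pi (wk A) (Eq (wk (wk A)) (Var 1) (Var 0)))"

text \<open>The end point and the identification in the motive of \<open>J\<close>, over context \<open>\<Gamma>\<close>.\<close>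

definition JCtx :: "tm \<Rightarrow> tm \<Rightarrow> tm list \<Rightarrow> tm list" where
  "JCtx A a \<Gamma> = Eq (wk A) (wk a) (Var 0) # A # \<Gamma>"

section \<open>Judgements\<close>

text \<open>
  Intensional Martin-Loef type theory with dependent products (with eta), dependent sums (with
  projections and eta), binary sums, empty, unit and natural numbers types, identity types with
  based path induction, one universe in the style of Russell, closed under all these type formers,
  propositional truncation of arbitrary types, function extensionality for arbitrary types and
  proposition extensionality for the propositions of the universe. Contexts list the most recent
  declaration first. Truncation has no judgemental computation rule (the corresponding
  identification is derivable, because the target is a proposition).
\<close>

inductive
      ctx :: "tm list \<Rightarrow> bool"
  and isty :: "tm list \<Rightarrow> tm \<Rightarrow> bool"  ("(_ \<turnstile> _ type)" [50, 50] 50)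
  and tyeq :: "tm list \<Rightarrow> tm \<Rightarrow> tm \<Rightarrow> bool"  ("(_ \<turnstile> _ \<doteq> _ type)" [50, 50, 50] 50)
  and hasty :: "tm list \<Rightarrow> tm \<Rightarrow> tm \<Rightarrow> bool"  ("(_ \<turnstile> _ \<Ztypecolon> _)" [50, 50, 50] 50)
  and tmeq :: "tm list \<Rightarrow> tm \<Rightarrow> tm \<Rightarrow> tm \<Rightarrow> bool"  ("(_ \<turnstile> _ \<doteq> _ \<Ztypecolon> _)" [50, 50, 50, 50] 50)
where
  ctx_nil: "ctx []"
| ctx_cons: "ctx \<Gamma> \<Longrightarrow> \<Gamma> \<turnstile> A type \<Longrightarrow> ctx (A # \<Gamma>)"

| ty_Univ: "ctx \<Gamma> \<Longrightarrow> \<Gamma> \<turnstile> Univ type"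
| ty_El: "\<Gamma> \<turnstile> A \<Ztypecolon> Univ \<Longrightarrow> \<Gamma> \<turnstile> A type"
| ty_Pi: "\<Gamma> \<turnstile> A type \<Longrightarrow> A # \<Gamma> \<turnstile> B type \<Longrightarrow> \<Gamma> \<turnstile> Pi A B type"
| ty_Sig: "\<Gamma> \<turnstile> A type \<Longrightarrow> A # \<Gamma> \<turnstile> B type \<Longrightarrow> \<Gamma> \<turnstile> Sig A B type"
| ty_Plus: "\<Gamma> \<turnstile> A type \<Longrightarrow> \<Gamma> \<turnstile> B type \<Longrightarrow> \<Gamma> \<turnstile> Plus A B type"
| ty_Eq: "\<Gamma> \<turnstile> A type \<Longrightarrow> \<Gamma> \<turnstile> t \<Ztypecolon> A \<Longrightarrow> \<Gamma> \<turnstile> u \<Ztypecolon> A \<Longrightarrow> \<Gamma> \<turnstile> Eq A t u type"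
| ty_Trunc: "\<Gamma> \<turnstile> A type \<Longrightarrow> \<Gamma> \<turnstile> Trunc A type"

| tyeq_refl: "\<Gamma> \<turnstile> A type \<Longrightarrow> \<Gamma> \<turnstile> A \<doteq> A type"
| tyeq_sym: "\<Gamma> \<turnstile> A \<doteq> B type \<Longrightarrow> \<Gamma> \<turnstile> B \<doteq> A type"
| tyeq_trans: "\<Gamma> \<turnstile> A \<doteq> B type \<Longrightarrow> \<Gamma> \<turnstile> B \<doteq> C type \<Longrightarrow> \<Gamma> \<turnstile> A \<doteq> C type"
| tyeq_El: "\<Gamma> \<turnstile> A \<doteq> B \<Ztypecolon> Univ \<Longrightarrow> \<Gamma> \<turnstile> A \<doteq> B type"
| tyeq_Pi: "\<Gamma> \<turnstile> A type \<Longrightarrow> \<Gamma> \<turnstile> A \<doteq> A' type \<Longrightarrow> A # \<Gamma> \<turnstile> B \<doteq> B' type \<Longrightarrow>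
    \<Gamma> \<turnstile> Pi A B \<doteq> Pi A' B' type"
| tyeq_Sig: "\<Gamma> \<turnstile> A type \<Longrightarrow> \<Gamma> \<turnstile> A \<doteq> A' type \<Longrightarrow> A # \<Gamma> \<turnstile> B \<doteq> B' type \<Longrightarrow>
    \<Gamma> \<turnstile> Sig A B \<doteq> Sig A' B' type"
| tyeq_Plus: "\<Gamma> \<turnstile> A \<doteq> A' type \<Longrightarrow> \<Gamma> \<turnstile> B \<doteq> B' type \<Longrightarrow> \<Gamma> \<turnstile> Plus A B \<doteq> Plus A' B' type"
| tyeq_Eq: "\<Gamma> \<turnstile> A \<doteq> A' type \<Longrightarrow> \<Gamma> \<turnstile> t \<doteq> t' \<Ztypecolon> A \<Longrightarrow> \<Gamma> \<turnstile> u \<doteq> u' \<Ztypecolon> A \<Longrightarrow>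
    \<Gamma> \<turnstile> Eq A t u \<doteq> Eq A' t' u' type"
| tyeq_Trunc: "\<Gamma> \<turnstile> A \<doteq> A' type \<Longrightarrow> \<Gamma> \<turnstile> Trunc A \<doteq> Trunc A' type"

| tm_Var: "ctx \<Gamma> \<Longrightarrow> n < length \<Gamma> \<Longrightarrow> \<Gamma> \<turnstile> Var n \<Ztypecolon> ren (\<lambda>i. i + Suc n) (\<Gamma> ! n)"
| tm_conv: "\<Gamma> \<turnstile> t \<Ztypecolon> A \<Longrightarrow> \<Gamma> \<turnstile> A \<doteq> B type \<Longrightarrow> \<Gamma> \<turnstile> t \<Ztypecolon> B"

| tm_Pi: "\<Gamma> \<turnstile> A \<Ztypecolon> Univ \<Longrightarrow> A # \<Gamma> \<turnstile> B \<Ztypecolon> Univ \<Longrightarrow> \<Gamma> \<turnstile> Pi A B \<Ztypecolon> Univ"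
| tm_Sig: "\<Gamma> \<turnstile> A \<Ztypecolon> Univ \<Longrightarrow> A # \<Gamma> \<turnstile> B \<Ztypecolon> Univ \<Longrightarrow> \<Gamma> \<turnstile> Sig A B \<Ztypecolon> Univ"
| tm_Plus: "\<Gamma> \<turnstile> A \<Ztypecolon> Univ \<Longrightarrow> \<Gamma> \<turnstile> B \<Ztypecolon> Univ \<Longrightarrow> \<Gamma> \<turnstile> Plus A B \<Ztypecolon> Univ"
| tm_Eq: "\<Gamma> \<turnstile> A \<Ztypecolon> Univ \<Longrightarrow> \<Gamma> \<turnstile> t \<Ztypecolon> A \<Longrightarrow> \<Gamma> \<turnstile> u \<Ztypecolon> A \<Longrightarrow> \<Gamma> \<turnstile> Eq A t u \<Ztypecolon> Univ"
| tm_Trunc: "\<Gamma> \<turnstile> A \<Ztypecolon> Univ \<Longrightarrow> \<Gamma> \<turnstile> Trunc A \<Ztypecolon> Univ"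
| tm_Empty: "ctx \<Gamma> \<Longrightarrow> \<Gamma> \<turnstile> Empty \<Ztypecolon> Univ"
| tm_Unit: "ctx \<Gamma> \<Longrightarrow> \<Gamma> \<turnstile> Unit \<Ztypecolon> Univ"
| tm_Nat: "ctx \<Gamma> \<Longrightarrow> \<Gamma> \<turnstile> Nat \<Ztypecolon> Univ"

| tm_Lam: "\<Gamma> \<turnstile> A type \<Longrightarrow> A # \<Gamma> \<turnstile> t \<Ztypecolon> B \<Longrightarrow> \<Gamma> \<turnstile> Lam A t \<Ztypecolon> Pi A B"
| tm_App: "\<Gamma> \<turnstile> f \<Ztypecolon> Pi A B \<Longrightarrow> \<Gamma> \<turnstile> a \<Ztypecolon> A \<Longrightarrow> \<Gamma> \<turnstile> App f a \<Ztypecolon> inst B a"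
| tm_Pr: "\<Gamma> \<turnstile> A type \<Longrightarrow> A # \<Gamma> \<turnstile> B type \<Longrightarrow> \<Gamma> \<turnstile> a \<Ztypecolon> A \<Longrightarrow> \<Gamma> \<turnstile> b \<Ztypecolon> inst B a \<Longrightarrow>
    \<Gamma> \<turnstile> Pr a b \<Ztypecolon> Sig A B"
| tm_P1: "\<Gamma> \<turnstile> p \<Ztypecolon> Sig A B \<Longrightarrow> \<Gamma> \<turnstile> P1 p \<Ztypecolon> A"
| tm_P2: "\<Gamma> \<turnstile> p \<Ztypecolon> Sig A B \<Longrightarrow> \<Gamma> \<turnstile> P2 p \<Ztypecolon> inst B (P1 p)"
| tm_In1: "\<Gamma> \<turnstile> B type \<Longrightarrow> \<Gamma> \<turnstile> a \<Ztypecolon> A \<Longrightarrow> \<Gamma> \<turnstile> In1 a \<Ztypecolon> Plus A B"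
| tm_In2: "\<Gamma> \<turnstile> A type \<Longrightarrow> \<Gamma> \<turnstile> b \<Ztypecolon> B \<Longrightarrow> \<Gamma> \<turnstile> In2 b \<Ztypecolon> Plus A B"
| tm_Case: "Plus A B # \<Gamma> \<turnstile> C type \<Longrightarrow>
    A # \<Gamma> \<turnstile> l \<Ztypecolon> sub (In1 (Var 0) \<rhd> (\<lambda>n. Var (Suc n))) C \<Longrightarrow>
    B # \<Gamma> \<turnstile> r \<Ztypecolon> sub (In2 (Var 0) \<rhd> (\<lambda>n. Var (Suc n))) C \<Longrightarrow>
    \<Gamma> \<turnstile> s \<Ztypecolon> Plus A B \<Longrightarrow>
    \<Gamma> \<turnstile> Case C l r s \<Ztypecolon> inst C s"
| tm_Efq: "Empty # \<Gamma> \<turnstile> C type \<Longrightarrow> \<Gamma> \<turnstile> t \<Ztypecolon> Empty \<Longrightarrow> \<Gamma> \<turnstile> Efq C t \<Ztypecolon> inst C t"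
| tm_Star: "ctx \<Gamma> \<Longrightarrow> \<Gamma> \<turnstile> Star \<Ztypecolon> Unit"
| tm_UnitRec: "Unit # \<Gamma> \<turnstile> C type \<Longrightarrow> \<Gamma> \<turnstile> c \<Ztypecolon> inst C Star \<Longrightarrow> \<Gamma> \<turnstile> t \<Ztypecolon> Unit \<Longrightarrow>
    \<Gamma> \<turnstile> UnitRec C c t \<Ztypecolon> inst C t"
| tm_Zero: "ctx \<Gamma> \<Longrightarrow> \<Gamma> \<turnstile> Zero \<Ztypecolon> Nat"
| tm_Succ: "\<Gamma> \<turnstile> n \<Ztypecolon> Nat \<Longrightarrow> \<Gamma> \<turnstile> Succ n \<Ztypecolon> Nat"
| tm_NatRec: "Nat # \<Gamma> \<turnstile> C type \<Longrightarrow> \<Gamma> \<turnstile> z \<Ztypecolon> inst C Zero \<Longrightarrow>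
    C # Nat # \<Gamma> \<turnstile> s \<Ztypecolon> sub (Succ (Var 1) \<rhd> (\<lambda>n. Var (Suc (Suc n)))) C \<Longrightarrow>
    \<Gamma> \<turnstile> n \<Ztypecolon> Nat \<Longrightarrow>
    \<Gamma> \<turnstile> NatRec C z s n \<Ztypecolon> inst C n"
| tm_Refl: "\<Gamma> \<turnstile> a \<Ztypecolon> A \<Longrightarrow> \<Gamma> \<turnstile> Refl a \<Ztypecolon> Eq A a a"
| tm_J: "\<Gamma> \<turnstile> a \<Ztypecolon> A \<Longrightarrow> JCtx A a \<Gamma> \<turnstile> C type \<Longrightarrow> \<Gamma> \<turnstile> d \<Ztypecolon> inst2 C a (Refl a) \<Longrightarrow>
    \<Gamma> \<turnstile> b \<Ztypecolon> A \<Longrightarrow> \<Gamma> \<turnstile> p \<Ztypecolon> Eq A a b \<Longrightarrow>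
    \<Gamma> \<turnstile> J C d p \<Ztypecolon> inst2 C b p"
| tm_TrIn: "\<Gamma> \<turnstile> a \<Ztypecolon> A \<Longrightarrow> \<Gamma> \<turnstile> TrIn a \<Ztypecolon> Trunc A"
| tm_TrEq: "\<Gamma> \<turnstile> t \<Ztypecolon> Trunc A \<Longrightarrow> \<Gamma> \<turnstile> u \<Ztypecolon> Trunc A \<Longrightarrow> \<Gamma> \<turnstile> TrEq t u \<Ztypecolon> Eq (Trunc A) t u"
| tm_TrRec: "\<Gamma> \<turnstile> B type \<Longrightarrow> \<Gamma> \<turnstile> h \<Ztypecolon> IsProp B \<Longrightarrow> \<Gamma> \<turnstile> f \<Ztypecolon> Arr A B \<Longrightarrow> \<Gamma> \<turnstile> t \<Ztypecolon> Trunc A \<Longrightarrow>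
    \<Gamma> \<turnstile> TrRec B h f t \<Ztypecolon> B"
| tm_FunExt: "\<Gamma> \<turnstile> f \<Ztypecolon> Pi A B \<Longrightarrow> \<Gamma> \<turnstile> g \<Ztypecolon> Pi A B \<Longrightarrow>
    \<Gamma> \<turnstile> h \<Ztypecolon> Pi A (Eq B (App (wk f) (Var 0)) (App (wk g) (Var 0))) \<Longrightarrow>
    \<Gamma> \<turnstile> FunExt f g h \<Ztypecolon> Eq (Pi A B) f g"
| tm_PropExt: "\<Gamma> \<turnstile> P \<Ztypecolon> Univ \<Longrightarrow> \<Gamma> \<turnstile> Q \<Ztypecolon> Univ \<Longrightarrow> \<Gamma> \<turnstile> hP \<Ztypecolon> IsProp P \<Longrightarrow> \<Gamma> \<turnstile> hQ \<Ztypecolon> IsProp Q \<Longrightarrow>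
    \<Gamma> \<turnstile> f \<Ztypecolon> Arr P Q \<Longrightarrow> \<Gamma> \<turnstile> g \<Ztypecolon> Arr Q P \<Longrightarrow>
    \<Gamma> \<turnstile> PropExt P Q hP hQ f g \<Ztypecolon> Eq Univ P Q"

| tmeq_refl: "\<Gamma> \<turnstile> t \<Ztypecolon> A \<Longrightarrow> \<Gamma> \<turnstile> t \<doteq> t \<Ztypecolon> A"
| tmeq_sym: "\<Gamma> \<turnstile> t \<doteq> u \<Ztypecolon> A \<Longrightarrow> \<Gamma> \<turnstile> u \<doteq> t \<Ztypecolon> A"
| tmeq_trans: "\<Gamma> \<turnstile> t \<doteq> u \<Ztypecolon> A \<Longrightarrow> \<Gamma> \<turnstile> u \<doteq> v \<Ztypecolon> A \<Longrightarrow> \<Gamma> \<turnstile> t \<doteq> v \<Ztypecolon> A"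
| tmeq_conv: "\<Gamma> \<turnstile> t \<doteq> u \<Ztypecolon> A \<Longrightarrow> \<Gamma> \<turnstile> A \<doteq> B type \<Longrightarrow> \<Gamma> \<turnstile> t \<doteq> u \<Ztypecolon> B"

| beta_Pi: "\<Gamma> \<turnstile> A type \<Longrightarrow> A # \<Gamma> \<turnstile> t \<Ztypecolon> B \<Longrightarrow> \<Gamma> \<turnstile> a \<Ztypecolon> A \<Longrightarrow>
    \<Gamma> \<turnstile> App (Lam A t) a \<doteq> inst t a \<Ztypecolon> inst B a"
| eta_Pi: "\<Gamma> \<turnstile> f \<Ztypecolon> Pi A B \<Longrightarrow> \<Gamma> \<turnstile> f \<doteq> Lam A (App (wk f) (Var 0)) \<Ztypecolon> Pi A B"
| beta_P1: "\<Gamma> \<turnstile> A type \<Longrightarrow> A # \<Gamma> \<turnstile> B type \<Longrightarrow> \<Gamma> \<turnstile> a \<Ztypecolon> A \<Longrightarrow> \<Gamma> \<turnstile> b \<Ztypecolon> inst B a \<Longrightarrow>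
    \<Gamma> \<turnstile> P1 (Pr a b) \<doteq> a \<Ztypecolon> A"
| beta_P2: "\<Gamma> \<turnstile> A type \<Longrightarrow> A # \<Gamma> \<turnstile> B type \<Longrightarrow> \<Gamma> \<turnstile> a \<Ztypecolon> A \<Longrightarrow> \<Gamma> \<turnstile> b \<Ztypecolon> inst B a \<Longrightarrow>
    \<Gamma> \<turnstile> P2 (Pr a b) \<doteq> b \<Ztypecolon> inst B a"
| eta_Sig: "\<Gamma> \<turnstile> p \<Ztypecolon> Sig A B \<Longrightarrow> \<Gamma> \<turnstile> p \<doteq> Pr (P1 p) (P2 p) \<Ztypecolon> Sig A B"
| beta_In1: "Plus A B # \<Gamma> \<turnstile> C type \<Longrightarrow>
    A # \<Gamma> \<turnstile> l \<Ztypecolon> sub (In1 (Var 0) \<rhd> (\<lambda>n. Var (Suc n))) C \<Longrightarrow>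
    B # \<Gamma> \<turnstile> r \<Ztypecolon> sub (In2 (Var 0) \<rhd> (\<lambda>n. Var (Suc n))) C \<Longrightarrow>
    \<Gamma> \<turnstile> a \<Ztypecolon> A \<Longrightarrow>
    \<Gamma> \<turnstile> Case C l r (In1 a) \<doteq> inst l a \<Ztypecolon> inst C (In1 a)"
| beta_In2: "Plus A B # \<Gamma> \<turnstile> C type \<Longrightarrow>
    A # \<Gamma> \<turnstile> l \<Ztypecolon> sub (In1 (Var 0) \<rhd> (\<lambda>n. Var (Suc n))) C \<Longrightarrow>
    B # \<Gamma> \<turnstile> r \<Ztypecolon> sub (In2 (Var 0) \<rhd> (\<lambda>n. Var (Suc n))) C \<Longrightarrow>
    \<Gamma> \<turnstile> b \<Ztypecolon> B \<Longrightarrow>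
    \<Gamma> \<turnstile> Case C l r (In2 b) \<doteq> inst r b \<Ztypecolon> inst C (In2 b)"
| beta_Star: "Unit # \<Gamma> \<turnstile> C type \<Longrightarrow> \<Gamma> \<turnstile> c \<Ztypecolon> inst C Star \<Longrightarrow>
    \<Gamma> \<turnstile> UnitRec C c Star \<doteq> c \<Ztypecolon> inst C Star"
| beta_Zero: "Nat # \<Gamma> \<turnstile> C type \<Longrightarrow> \<Gamma> \<turnstile> z \<Ztypecolon> inst C Zero \<Longrightarrow>
    C # Nat # \<Gamma> \<turnstile> s \<Ztypecolon> sub (Succ (Var 1) \<rhd> (\<lambda>n. Var (Suc (Suc n)))) C \<Longrightarrow>
    \<Gamma> \<turnstile> NatRec C z s Zero \<doteq> z \<Ztypecolon> inst C Zero"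
| beta_Succ: "Nat # \<Gamma> \<turnstile> C type \<Longrightarrow> \<Gamma> \<turnstile> z \<Ztypecolon> inst C Zero \<Longrightarrow>
    C # Nat # \<Gamma> \<turnstile> s \<Ztypecolon> sub (Succ (Var 1) \<rhd> (\<lambda>n. Var (Suc (Suc n)))) C \<Longrightarrow>
    \<Gamma> \<turnstile> n \<Ztypecolon> Nat \<Longrightarrow>
    \<Gamma> \<turnstile> NatRec C z s (Succ n) \<doteq> inst2 s n (NatRec C z s n) \<Ztypecolon> inst C (Succ n)"
| beta_Refl: "\<Gamma> \<turnstile> a \<Ztypecolon> A \<Longrightarrow> JCtx A a \<Gamma> \<turnstile> C type \<Longrightarrow> \<Gamma> \<turnstile> d \<Ztypecolon> inst2 C a (Refl a) \<Longrightarrow>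
    \<Gamma> \<turnstile> J C d (Refl a) \<doteq> d \<Ztypecolon> inst2 C a (Refl a)"

| cong_Pi: "\<Gamma> \<turnstile> A \<Ztypecolon> Univ \<Longrightarrow> \<Gamma> \<turnstile> A \<doteq> A' \<Ztypecolon> Univ \<Longrightarrow> A # \<Gamma> \<turnstile> B \<doteq> B' \<Ztypecolon> Univ \<Longrightarrow>
    \<Gamma> \<turnstile> Pi A B \<doteq> Pi A' B' \<Ztypecolon> Univ"
| cong_Sig: "\<Gamma> \<turnstile> A \<Ztypecolon> Univ \<Longrightarrow> \<Gamma> \<turnstile> A \<doteq> A' \<Ztypecolon> Univ \<Longrightarrow> A # \<Gamma> \<turnstile> B \<doteq> B' \<Ztypecolon> Univ \<Longrightarrow>
    \<Gamma> \<turnstile> Sig A B \<doteq> Sig A' B' \<Ztypecolon> Univ"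
| cong_Plus: "\<Gamma> \<turnstile> A \<doteq> A' \<Ztypecolon> Univ \<Longrightarrow> \<Gamma> \<turnstile> B \<doteq> B' \<Ztypecolon> Univ \<Longrightarrow> \<Gamma> \<turnstile> Plus A B \<doteq> Plus A' B' \<Ztypecolon> Univ"
| cong_Eq: "\<Gamma> \<turnstile> A \<doteq> A' \<Ztypecolon> Univ \<Longrightarrow> \<Gamma> \<turnstile> t \<doteq> t' \<Ztypecolon> A \<Longrightarrow> \<Gamma> \<turnstile> u \<doteq> u' \<Ztypecolon> A \<Longrightarrow>
    \<Gamma> \<turnstile> Eq A t u \<doteq> Eq A' t' u' \<Ztypecolon> Univ"
| cong_Trunc: "\<Gamma> \<turnstile> A \<doteq> A' \<Ztypecolon> Univ \<Longrightarrow> \<Gamma> \<turnstile> Trunc A \<doteq> Trunc A' \<Ztypecolon> Univ"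
| cong_Lam: "\<Gamma> \<turnstile> A type \<Longrightarrow> \<Gamma> \<turnstile> A \<doteq> A' type \<Longrightarrow> A # \<Gamma> \<turnstile> t \<doteq> t' \<Ztypecolon> B \<Longrightarrow>
    \<Gamma> \<turnstile> Lam A t \<doteq> Lam A' t' \<Ztypecolon> Pi A B"
| cong_App: "\<Gamma> \<turnstile> f \<doteq> f' \<Ztypecolon> Pi A B \<Longrightarrow> \<Gamma> \<turnstile> a \<doteq> a' \<Ztypecolon> A \<Longrightarrow> \<Gamma> \<turnstile> App f a \<doteq> App f' a' \<Ztypecolon> inst B a"
| cong_Pr: "\<Gamma> \<turnstile> A type \<Longrightarrow> A # \<Gamma> \<turnstile> B type \<Longrightarrow> \<Gamma> \<turnstile> a \<doteq> a' \<Ztypecolon> A \<Longrightarrow> \<Gamma> \<turnstile> b \<doteq> b' \<Ztypecolon> inst B a \<Longrightarrow>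
    \<Gamma> \<turnstile> Pr a b \<doteq> Pr a' b' \<Ztypecolon> Sig A B"
| cong_P1: "\<Gamma> \<turnstile> p \<doteq> p' \<Ztypecolon> Sig A B \<Longrightarrow> \<Gamma> \<turnstile> P1 p \<doteq> P1 p' \<Ztypecolon> A"
| cong_P2: "\<Gamma> \<turnstile> p \<doteq> p' \<Ztypecolon> Sig A B \<Longrightarrow> \<Gamma> \<turnstile> P2 p \<doteq> P2 p' \<Ztypecolon> inst B (P1 p)"
| cong_In1: "\<Gamma> \<turnstile> B type \<Longrightarrow> \<Gamma> \<turnstile> a \<doteq> a' \<Ztypecolon> A \<Longrightarrow> \<Gamma> \<turnstile> In1 a \<doteq> In1 a' \<Ztypecolon> Plus A B"
| cong_In2: "\<Gamma> \<turnstile> A type \<Longrightarrow> \<Gamma> \<turnstile> b \<doteq> b' \<Ztypecolon> B \<Longrightarrow> \<Gamma> \<turnstile> In2 b \<doteq> In2 b' \<Ztypecolon> Plus A B"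
| cong_Case: "Plus A B # \<Gamma> \<turnstile> C \<doteq> C' type \<Longrightarrow>
    A # \<Gamma> \<turnstile> l \<doteq> l' \<Ztypecolon> sub (In1 (Var 0) \<rhd> (\<lambda>n. Var (Suc n))) C \<Longrightarrow>
    B # \<Gamma> \<turnstile> r \<doteq> r' \<Ztypecolon> sub (In2 (Var 0) \<rhd> (\<lambda>n. Var (Suc n))) C \<Longrightarrow>
    \<Gamma> \<turnstile> s \<doteq> s' \<Ztypecolon> Plus A B \<Longrightarrow>
    \<Gamma> \<turnstile> Case C l r s \<doteq> Case C' l' r' s' \<Ztypecolon> inst C s"
| cong_Efq: "Empty # \<Gamma> \<turnstile> C \<doteq> C' type \<Longrightarrow> \<Gamma> \<turnstile> t \<doteq> t' \<Ztypecolon> Empty \<Longrightarrow>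
    \<Gamma> \<turnstile> Efq C t \<doteq> Efq C' t' \<Ztypecolon> inst C t"
| cong_UnitRec: "Unit # \<Gamma> \<turnstile> C \<doteq> C' type \<Longrightarrow> \<Gamma> \<turnstile> c \<doteq> c' \<Ztypecolon> inst C Star \<Longrightarrow> \<Gamma> \<turnstile> t \<doteq> t' \<Ztypecolon> Unit \<Longrightarrow>
    \<Gamma> \<turnstile> UnitRec C c t \<doteq> UnitRec C' c' t' \<Ztypecolon> inst C t"
| cong_Succ: "\<Gamma> \<turnstile> n \<doteq> n' \<Ztypecolon> Nat \<Longrightarrow> \<Gamma> \<turnstile> Succ n \<doteq> Succ n' \<Ztypecolon> Nat"
| cong_NatRec: "Nat # \<Gamma> \<turnstile> C type \<Longrightarrow> Nat # \<Gamma> \<turnstile> C \<doteq> C' type \<Longrightarrow> \<Gamma> \<turnstile> z \<doteq> z' \<Ztypecolon> inst C Zero \<Longrightarrow>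
    C # Nat # \<Gamma> \<turnstile> s \<doteq> s' \<Ztypecolon> sub (Succ (Var 1) \<rhd> (\<lambda>n. Var (Suc (Suc n)))) C \<Longrightarrow>
    \<Gamma> \<turnstile> n \<doteq> n' \<Ztypecolon> Nat \<Longrightarrow>
    \<Gamma> \<turnstile> NatRec C z s n \<doteq> NatRec C' z' s' n' \<Ztypecolon> inst C n"
| cong_Refl: "\<Gamma> \<turnstile> a \<doteq> a' \<Ztypecolon> A \<Longrightarrow> \<Gamma> \<turnstile> Refl a \<doteq> Refl a' \<Ztypecolon> Eq A a a"
| cong_J: "\<Gamma> \<turnstile> a \<Ztypecolon> A \<Longrightarrow> JCtx A a \<Gamma> \<turnstile> C \<doteq> C' type \<Longrightarrow> \<Gamma> \<turnstile> d \<doteq> d' \<Ztypecolon> inst2 C a (Refl a) \<Longrightarrow>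
    \<Gamma> \<turnstile> b \<Ztypecolon> A \<Longrightarrow> \<Gamma> \<turnstile> p \<doteq> p' \<Ztypecolon> Eq A a b \<Longrightarrow>
    \<Gamma> \<turnstile> J C d p \<doteq> J C' d' p' \<Ztypecolon> inst2 C b p"
| cong_TrIn: "\<Gamma> \<turnstile> a \<doteq> a' \<Ztypecolon> A \<Longrightarrow> \<Gamma> \<turnstile> TrIn a \<doteq> TrIn a' \<Ztypecolon> Trunc A"
| cong_TrEq: "\<Gamma> \<turnstile> t \<doteq> t' \<Ztypecolon> Trunc A \<Longrightarrow> \<Gamma> \<turnstile> u \<doteq> u' \<Ztypecolon> Trunc A \<Longrightarrow>
    \<Gamma> \<turnstile> TrEq t u \<doteq> TrEq t' u' \<Ztypecolon> Eq (Trunc A) t u"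
| cong_TrRec: "\<Gamma> \<turnstile> B \<doteq> B' type \<Longrightarrow> \<Gamma> \<turnstile> h \<doteq> h' \<Ztypecolon> IsProp B \<Longrightarrow> \<Gamma> \<turnstile> f \<doteq> f' \<Ztypecolon> Arr A B \<Longrightarrow>
    \<Gamma> \<turnstile> t \<doteq> t' \<Ztypecolon> Trunc A \<Longrightarrow>
    \<Gamma> \<turnstile> TrRec B h f t \<doteq> TrRec B' h' f' t' \<Ztypecolon> B"
| cong_FunExt: "\<Gamma> \<turnstile> f \<doteq> f' \<Ztypecolon> Pi A B \<Longrightarrow> \<Gamma> \<turnstile> g \<doteq> g' \<Ztypecolon> Pi A B \<Longrightarrow>
    \<Gamma> \<turnstile> h \<doteq> h' \<Ztypecolon> Pi A (Eq B (App (wk f) (Var 0)) (App (wk g) (Var 0))) \<Longrightarrow>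
    \<Gamma> \<turnstile> FunExt f g h \<doteq> FunExt f' g' h' \<Ztypecolon> Eq (Pi A B) f g"
| cong_PropExt: "\<Gamma> \<turnstile> P \<doteq> P' \<Ztypecolon> Univ \<Longrightarrow> \<Gamma> \<turnstile> Q \<doteq> Q' \<Ztypecolon> Univ \<Longrightarrow>
    \<Gamma> \<turnstile> hP \<doteq> hP' \<Ztypecolon> IsProp P \<Longrightarrow> \<Gamma> \<turnstile> hQ \<doteq> hQ' \<Ztypecolon> IsProp Q \<Longrightarrow>
    \<Gamma> \<turnstile> f \<doteq> f' \<Ztypecolon> Arr P Q \<Longrightarrow> \<Gamma> \<turnstile> g \<doteq> g' \<Ztypecolon> Arr Q P \<Longrightarrow>
    \<Gamma> \<turnstile> PropExt P Q hP hQ f g \<doteq> PropExt P' Q' hP' hQ' f' g' \<Ztypecolon> Eq Univ P Q"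

section \<open>Writing object terms with binders of the meta-language\<close>

text \<open>
  An expression maps the number \<open>d\<close> of enclosing binders to the raw term denoted at that depth.
  A variable bound at depth \<open>d\<close> has index \<open>e - Suc d\<close> when used at depth \<open>e\<close>, so
  that weakening is implicit and no capture can occur. A closed expression \<open>t\<close> denotes the raw
  term \<open>t 0\<close>.
\<close>

type_synonym expr = "nat \<Rightarrow> tm"

definition bind :: "(expr \<Rightarrow> expr) \<Rightarrow> expr" where
  "bind f = (\<lambda>d. f (\<lambda>e. Var (e - Suc d)) (Suc d))"

text \<open>Only for raw terms without free variables.\<close>

definition closed :: "tm \<Rightarrow> expr" where
  "closed t = (\<lambda>d. t)"

definition univ :: expr where "univ = (\<lambda>d. Univ)"
definition pi :: "expr \<Rightarrow> (expr \<Rightarrow> expr) \<Rightarrow> expr" where "pi A B = (\<lambda>d. Pi (A d) (bind B d))"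
definition arr :: "expr \<Rightarrow> expr \<Rightarrow> expr" (infixr "\<rightarrow>\<^sub>t" 50) where "A \<rightarrow>\<^sub>t B = (\<lambda>d. Arr (A d) (B d))"
definition lam :: "expr \<Rightarrow> (expr \<Rightarrow> expr) \<Rightarrow> expr" where "lam A t = (\<lambda>d. Lam (A d) (bind t d))"
definition app :: "expr \<Rightarrow> expr \<Rightarrow> expr" (infixl "\<cdot>" 90) where "f \<cdot> a = (\<lambda>d. App (f d) (a d))"
definition sig :: "expr \<Rightarrow> (expr \<Rightarrow> expr) \<Rightarrow> expr" where "sig A B = (\<lambda>d. Sig (A d) (bind B d))"
definition times :: "expr \<Rightarrow> expr \<Rightarrow> expr" (infixr "\<times>\<^sub>t" 70) where "A \<times>\<^sub>t B = sig A (\<lambda>_. B)"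
definition pair :: "expr \<Rightarrow> expr \<Rightarrow> expr" where "pair a b = (\<lambda>d. Pr (a d) (b d))"
definition pr1 :: "expr \<Rightarrow> expr" where "pr1 p = (\<lambda>d. P1 (p d))"
definition pr2 :: "expr \<Rightarrow> expr" where "pr2 p = (\<lambda>d. P2 (p d))"
definition plus :: "expr \<Rightarrow> expr \<Rightarrow> expr" (infixr "+\<^sub>t" 65) where "A +\<^sub>t B = (\<lambda>d. Plus (A d) (B d))"
definition inl :: "expr \<Rightarrow> expr" where "inl a = (\<lambda>d. In1 (a d))"
definition inr :: "expr \<Rightarrow> expr" where "inr b = (\<lambda>d. In2 (b d))"
definition cases :: "(expr \<Rightarrow> expr) \<Rightarrow> (expr \<Rightarrow> expr) \<Rightarrow> (expr \<Rightarrow> expr) \<Rightarrow> expr \<Rightarrow> expr" where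
  "cases C l r s = (\<lambda>d. Case (bind C d) (bind l d) (bind r d) (s d))"
definition empty :: expr where "empty = (\<lambda>d. Empty)"
definition unit :: expr where "unit = (\<lambda>d. Unit)"
definition star :: expr where "star = (\<lambda>d. Star)"
definition unitrec :: "(expr \<Rightarrow> expr) \<Rightarrow> expr \<Rightarrow> expr \<Rightarrow> expr" where
  "unitrec C c t = (\<lambda>d. UnitRec (bind C d) (c d) (t d))"
definition nat\<^sub>t :: expr where "nat\<^sub>t = (\<lambda>d. Nat)"
definition zero :: expr where "zero = (\<lambda>d. Zero)"
definition succ :: "expr \<Rightarrow> expr" where "succ n = (\<lambda>d. Succ (n d))"
definition natrec :: "(expr \<Rightarrow> expr) \<Rightarrow> expr \<Rightarrow> (expr \<Rightarrow> expr \<Rightarrow> expr) \<Rightarrow> expr \<Rightarrow> expr" where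
  "natrec C z s n = (\<lambda>d. NatRec (bind C d) (z d) (bind (\<lambda>k. bind (s k)) d) (n d))"
definition eq :: "expr \<Rightarrow> expr \<Rightarrow> expr \<Rightarrow> expr" where "eq A t u = (\<lambda>d. Eq (A d) (t d) (u d))"
definition rfl :: "expr \<Rightarrow> expr" where "rfl t = (\<lambda>d. Refl (t d))"
definition trunc :: "expr \<Rightarrow> expr" where "trunc A = (\<lambda>d. Trunc (A d))"
definition isProp :: "expr \<Rightarrow> expr" where "isProp A = (\<lambda>d. IsProp (A d))"

definition neg :: "expr \<Rightarrow> expr" where
  "neg A = (A \<rightarrow>\<^sub>t empty)"

definition decidable :: "expr \<Rightarrow> expr" where
  "decidable A = A +\<^sub>t neg A"

definition fiber :: "expr \<Rightarrow> expr \<Rightarrow> expr \<Rightarrow> expr \<Rightarrow> expr" where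
  "fiber A B f b = sig A (\<lambda>a. eq B (f \<cdot> a) b)"

definition isEmbedding :: "expr \<Rightarrow> expr \<Rightarrow> expr \<Rightarrow> expr" where
  "isEmbedding A B f = pi B (\<lambda>b. isProp (fiber A B f b))"

section \<open>Partial elements\<close>

definition lift :: "expr \<Rightarrow> expr" where
  "lift Y = sig univ (\<lambda>P. isProp P \<times>\<^sub>t (P \<rightarrow>\<^sub>t Y))"

definition unit_isProp :: expr where
  "unit_isProp = lam unit (\<lambda>a. lam unit (\<lambda>b.
     unitrec (\<lambda>a'. eq unit a' b) (unitrec (\<lambda>b'. eq unit star b') (rfl star) b) a))"

definition eta :: "expr \<Rightarrow> expr" where
  "eta y = pair unit (pair unit_isProp (lam unit (\<lambda>u. y)))"

section \<open>Primitive recursive functions\<close>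

text \<open>Argument tuples of length \<open>n\<close> are functions on \<open>fin n\<close>, where \<open>fin (n + 1) = 1 + fin n\<close>.\<close>

definition fin :: "expr \<Rightarrow> expr" where
  "fin n = natrec (\<lambda>_. univ) empty (\<lambda>_ X. unit +\<^sub>t X) n"

definition vec :: "expr \<Rightarrow> expr" where
  "vec n = (fin n \<rightarrow>\<^sub>t nat\<^sub>t)"

definition head :: "expr \<Rightarrow> expr" where
  "head v = v \<cdot> inl star"

definition tail :: "expr \<Rightarrow> expr \<Rightarrow> expr" where
  "tail n v = lam (fin n) (\<lambda>i. v \<cdot> inr i)"

definition vcons :: "expr \<Rightarrow> expr \<Rightarrow> expr \<Rightarrow> expr" where
  "vcons n a v = lam (fin (succ n)) (cases (\<lambda>_. nat\<^sub>t) (\<lambda>_. a) (\<lambda>i. v \<cdot> i))"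

text \<open>Functions on natural numbers of any finite arity, as pairs of arity and function.\<close>

definition nfun :: expr where
  "nfun = sig nat\<^sub>t (\<lambda>n. vec n \<rightarrow>\<^sub>t nat\<^sub>t)"

text \<open>
  \<open>primrec_stage d \<phi>\<close>: the function \<open>\<phi>\<close> is obtained from the zero functions, the
  successor and the projections by at most \<open>d\<close> nested applications of composition and
  primitive recursion. The inductively defined class of primitive recursive functions is the union
  of the stages.
\<close>

definition pr_initial :: "expr \<Rightarrow> expr" where
  "pr_initial \<phi> =
     sig nat\<^sub>t (\<lambda>n. eq nfun \<phi> (pair n (lam (vec n) (\<lambda>v. zero))))
     +\<^sub>t eq nfun \<phi> (pair (succ zero) (lam (vec (succ zero)) (\<lambda>v. succ (head v))))
     +\<^sub>t sig nat\<^sub>t (\<lambda>n. sig (fin n) (\<lambda>i. eq nfun \<phi> (pair n (lam (vec n) (\<lambda>v. v \<cdot> i)))))"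

definition pr_comp :: "expr \<Rightarrow> expr \<Rightarrow> expr" where
  "pr_comp R \<phi> =
     sig nat\<^sub>t (\<lambda>n. sig nat\<^sub>t (\<lambda>m.
     sig (vec m \<rightarrow>\<^sub>t nat\<^sub>t) (\<lambda>g. sig (fin m \<rightarrow>\<^sub>t vec n \<rightarrow>\<^sub>t nat\<^sub>t) (\<lambda>h.
       R \<cdot> pair m g
       \<times>\<^sub>t pi (fin m) (\<lambda>j. R \<cdot> pair n (h \<cdot> j))
       \<times>\<^sub>t eq nfun \<phi> (pair n (lam (vec n) (\<lambda>v. g \<cdot> lam (fin m) (\<lambda>j. h \<cdot> j \<cdot> v))))))))"

definition pr_rec :: "expr \<Rightarrow> expr \<Rightarrow> expr" where
  "pr_rec R \<phi> =
     sig nat\<^sub>t (\<lambda>n. sig (vec n \<rightarrow>\<^sub>t nat\<^sub>t) (\<lambda>g. sig (vec (succ (succ n)) \<rightarrow>\<^sub>t nat\<^sub>t) (\<lambda>h.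
       R \<cdot> pair n g
       \<times>\<^sub>t R \<cdot> pair (succ (succ n)) h
       \<times>\<^sub>t eq nfun \<phi> (pair (succ n) (lam (vec (succ n)) (\<lambda>v.
            natrec (\<lambda>_. nat\<^sub>t) (g \<cdot> tail n v)
              (\<lambda>y r. h \<cdot> vcons (succ n) y (vcons n r (tail n v)))
              (head v)))))))"

definition primrec_stage :: "expr \<Rightarrow> expr \<Rightarrow> expr" where
  "primrec_stage d \<phi> =
     natrec (\<lambda>_. nfun \<rightarrow>\<^sub>t univ)
       (lam nfun (\<lambda>\<psi>. pr_initial \<psi>))
       (\<lambda>_ R. lam nfun (\<lambda>\<psi>. R \<cdot> \<psi> +\<^sub>t pr_comp R \<psi> +\<^sub>t pr_rec R \<psi>))
       d \<cdot> \<phi>"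

text \<open>Unary functions are regarded as functions on tuples of length one.\<close>

definition isPrimRec :: "expr \<Rightarrow> expr" where
  "isPrimRec f = trunc (sig nat\<^sub>t (\<lambda>d.
     primrec_stage d (pair (succ zero) (lam (vec (succ zero)) (\<lambda>v. f \<cdot> head v)))))"

section \<open>Recursive machines and computable partial functions\<close>

definition machine :: expr where
  "machine = sig (nat\<^sub>t \<rightarrow>\<^sub>t nat\<^sub>t) isPrimRec \<times>\<^sub>t sig (nat\<^sub>t \<rightarrow>\<^sub>t nat\<^sub>t) isPrimRec"

definition init :: "expr \<Rightarrow> expr" where
  "init m = pr1 (pr1 m)"

definition step :: "expr \<Rightarrow> expr" where
  "step m = pr1 (pr2 m)"

text \<open>The inverse of the bijection \<open>inl n \<mapsto> 2 n\<close>, \<open>inr n \<mapsto> 2 n + 1\<close>.\<close>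

definition decode :: "expr \<Rightarrow> expr" where
  "decode n = natrec (\<lambda>_. nat\<^sub>t +\<^sub>t nat\<^sub>t) (inl zero)
     (\<lambda>_ r. cases (\<lambda>_. nat\<^sub>t +\<^sub>t nat\<^sub>t) (\<lambda>k. inr k) (\<lambda>k. inl (succ k)) r) n"

definition step' :: "expr \<Rightarrow> expr \<Rightarrow> expr" where
  "step' m z = cases (\<lambda>_. nat\<^sub>t +\<^sub>t nat\<^sub>t) (\<lambda>x. decode (step m \<cdot> x)) (\<lambda>y. inr y) z"

definition run :: "expr \<Rightarrow> expr \<Rightarrow> expr \<Rightarrow> expr" where
  "run k m x = natrec (\<lambda>_. nat\<^sub>t +\<^sub>t nat\<^sub>t) (inl (init m \<cdot> x)) (\<lambda>_ z. step' m z) k"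

definition eval_extent :: "expr \<Rightarrow> expr \<Rightarrow> expr" where
  "eval_extent m x =
     sig nat\<^sub>t (\<lambda>y. trunc (sig nat\<^sub>t (\<lambda>k. eq (nat\<^sub>t +\<^sub>t nat\<^sub>t) (run k m x) (inr y))))"

text \<open>
  An element of \<open>lift nat\<^sub>t\<close> carries a proof that its extent is a proposition. For \<open>eval\<close>
  this proof is a parameter \<open>q\<close>, a term of type \<open>eval_isProp\<close>.
\<close>

definition eval_isProp :: expr where
  "eval_isProp = pi machine (\<lambda>m. pi nat\<^sub>t (\<lambda>x. isProp (eval_extent m x)))"

definition eval :: "expr \<Rightarrow> expr \<Rightarrow> expr" where
  "eval q m = lam nat\<^sub>t (\<lambda>x.
     pair (eval_extent m x) (pair (q \<cdot> m \<cdot> x) (lam (eval_extent m x) (\<lambda>e. pr1 e))))"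

definition isComputable :: "expr \<Rightarrow> expr \<Rightarrow> expr" where
  "isComputable q f = trunc (sig machine (\<lambda>m. eq (nat\<^sub>t \<rightarrow>\<^sub>t lift nat\<^sub>t) f (eval q m)))"

definition Comp :: "expr \<Rightarrow> expr" where
  "Comp q = sig (nat\<^sub>t \<rightarrow>\<^sub>t lift nat\<^sub>t) (isComputable q)"

definition embedding_implies_decidable :: "expr \<Rightarrow> expr" where
  "embedding_implies_decidable q =
     (sig (Comp q \<rightarrow>\<^sub>t nat\<^sub>t) (\<lambda>F. isEmbedding (Comp q) nat\<^sub>t F)
      \<rightarrow>\<^sub>t pi (Comp q) (\<lambda>f. pi (Comp q) (\<lambda>g. decidable (eq (Comp q) f g)))
         \<times>\<^sub>t pi (Comp q) (\<lambda>f. decidable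
             (eq (nat\<^sub>t \<rightarrow>\<^sub>t lift nat\<^sub>t) (pr1 f) (lam nat\<^sub>t (\<lambda>x. eta zero)))))"

end

theory Submission
  imports Defs
begin

text \<open>
  An embedding \<open>F\<close> of the computable functions into the natural numbers reflects equality, because the fibre
  over \<open>F g\<close> is a proposition; so equality of computable functions inherits decidability from the natural numbers.
  For the second claim, the constant function at \<open>\<eta> 0\<close> is computed by the machine with initialisation \<open>0\<close> and
  the successor as step function, and equality of computable functions is equality of the underlying partial functions,
  computability being truncated. That the extent of \<open>eval\<close> is a proposition holds because halted states are fixed
  by the step function and any two numbers of steps commute, so that two results of a run agree.

  The derivations are obtained by reflection: proof terms are run through a type checker, written as a function
  of HOL and proved sound for the judgements, by simplification with its defining equations. Terms mentioning
  primitive recursive functions are too large for this; the lemmas are therefore stated for arbitrary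
  initialisation and step functions and instantiated at machines by hand.
\<close>

section \<open>Renaming, weakening and scoping\<close>

text \<open>The obstacle is the metatheory. Justifying a reduction step would ordinarily call on a
  substitution lemma for all judgements, and comparing types on injectivity of the type formers.
  Re-checking takes their place: whenever the checker contracts a redex or instantiates a dependent
  type, it runs on the resulting raw term again, and types are compared by their computed normal
  forms. The object-level argument turns on truncation levels. Truncated evidence can be used only
  for propositions, so uniqueness of outputs rests on the naturals being a set, by Hedberg's
  theorem. Comparing a halting computation with \<open>eta zero\<close> takes proposition
  extensionality for the extents, and the set property of \<open>unit\<close> for the proofs that an
  extent is a proposition. Since the claim concerns every closed \<open>q\<close>, which is opaque
  to the checker, decidability is derived for an arbitrary map from a small type and then
  specialised.\<close>

lemma upr_comp: "upr r (upr s n) = upr (\<lambda>n. r (s n)) n"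
  by (cases n) auto

lemma ups_upr: "ups \<sigma> (upr r n) = ups (\<lambda>n. \<sigma> (r n)) n"
  by (cases n) (auto simp: ups_def)

lemma ren_ren: "ren r (ren s t) = ren (\<lambda>n. r (s n)) t"
  by (induction t arbitrary: r s) (auto simp: upr_comp)

lemma sub_ren: "sub \<sigma> (ren r t) = sub (\<lambda>n. \<sigma> (r n)) t"
  by (induction t arbitrary: r \<sigma>) (auto simp: ups_upr)

lemma ren_ups: "ren (upr r) (ups \<sigma> n) = ups (\<lambda>n. ren r (\<sigma> n)) n"
  by (cases n) (auto simp: ups_def ren_ren)

lemma ren_sub: "ren r (sub \<sigma> t) = sub (\<lambda>n. ren r (\<sigma> n)) t"
  by (induction t arbitrary: r \<sigma>) (auto simp: ren_ups)

lemma ups_Var: "ups Var = Var"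
  by (rule ext, case_tac x) (auto simp: ups_def)

lemma sub_Var: "sub Var t = t"
  by (induction t) (auto simp: ups_Var)

lemma inst_wk: "inst (wk t) a = t"
  by (simp add: sub_ren sub_Var)

lemma ren_inst: "ren r (inst B a) = inst (ren (upr r) B) (ren r a)"
  unfolding ren_sub sub_ren by (rule arg_cong[where f="\<lambda>s. sub s B"], rule ext, case_tac n) auto

lemma ren_inst2: "ren r (inst2 C b p) = inst2 (ren (upr (upr r)) C) (ren r b) (ren r p)"
  unfolding ren_sub sub_ren
  by (rule arg_cong[where f="\<lambda>s. sub s C"], rule ext, case_tac n; simp; case_tac nat; simp)

lemma ren_branch:
  "ren (upr r) (sub (t \<rhd> (\<lambda>n. Var (Suc n))) C) = sub (ren (upr r) t \<rhd> (\<lambda>n. Var (Suc n))) (ren (upr r) C)"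
  unfolding ren_sub sub_ren by (rule arg_cong[where f="\<lambda>s. sub s C"], rule ext, case_tac n) auto

lemma ren_step:
  "ren (upr (upr r)) (sub (t \<rhd> (\<lambda>n. Var (Suc (Suc n)))) C) =
   sub (ren (upr (upr r)) t \<rhd> (\<lambda>n. Var (Suc (Suc n)))) (ren (upr r) C)"
  unfolding ren_sub sub_ren by (rule arg_cong[where f="\<lambda>s. sub s C"], rule ext, case_tac n) auto

lemma ren_upr_wk: "ren (upr r) (wk t) = wk (ren r t)"
  by (simp add: ren_ren)

lemma ren_Arr: "ren r (Arr A B) = Arr (ren r A) (ren r B)"
  by (simp add: Arr_def ren_upr_wk)

lemma ren_IsProp: "ren r (IsProp A) = IsProp (ren r A)"
  by (simp add: IsProp_def ren_upr_wk)

text \<open>A general renaming rather than the shift \<open>Suc\<close>, because passing under a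
  binder turns \<open>r\<close> into \<open>upr r\<close>. Well-formedness of the target is
  included, since the axioms for constants and variables demand it.\<close>

definition wkn :: "(nat \<Rightarrow> nat) \<Rightarrow> tm list \<Rightarrow> tm list \<Rightarrow> bool" where
  "wkn r \<Gamma> \<Delta> \<longleftrightarrow> ctx \<Delta> \<and> (\<forall>n<length \<Gamma>. r n < length \<Delta> \<and>
     ren r (ren (\<lambda>i. i + Suc n) (\<Gamma> ! n)) = ren (\<lambda>i. i + Suc (r n)) (\<Delta> ! r n))"

text \<open>
  Some rules, such as the one for \<open>Case\<close>, extend the context by types that are not premises of their own.
  The induction for weakening therefore also carries the weakening of every entry of the context.
\<close>

fun wkctx :: "tm list \<Rightarrow> bool" where
  "wkctx [] = True"
| "wkctx (A # \<Gamma>) = (wkctx \<Gamma> \<and> (\<forall>r \<Delta>. wkn r \<Gamma> \<Delta> \<longrightarrow> \<Delta> \<turnstile> ren r A type))"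

declare wkctx.simps(2) [simp del]

lemma wkn_ctx: "wkn r \<Gamma> \<Delta> \<Longrightarrow> ctx \<Delta>"
  by (simp add: wkn_def)

lemma wkn_Cons: "wkctx (A # \<Gamma>) \<Longrightarrow> wkn r \<Gamma> \<Delta> \<Longrightarrow> wkn (upr r) (A # \<Gamma>) (ren r A # \<Delta>)"
proof -
  assume w: "wkctx (A # \<Gamma>)" and r: "wkn r \<Gamma> \<Delta>"
  have "ren (\<lambda>i. upr r (Suc (i + Suc n))) (\<Gamma> ! n) = ren (\<lambda>i. Suc (i + Suc (r n))) (\<Delta> ! r n)"
    if "n < length \<Gamma>" for n
  proof -
    have "ren Suc (ren r (ren (\<lambda>i. i + Suc n) (\<Gamma> ! n))) = ren Suc (ren (\<lambda>i. i + Suc (r n)) (\<Delta> ! r n))"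
      using r that by (simp add: wkn_def)
    then show ?thesis by (simp add: ren_ren)
  qed
  then show ?thesis using w r
    by (auto simp: wkn_def wkctx.simps ren_ren nth_Cons less_Suc_eq_0_disj intro: ctx_cons)
qed

lemma wkn_Cons':
  "wkctx (A # \<Gamma>) \<Longrightarrow> wkn r \<Gamma> \<Delta> \<Longrightarrow> A' = ren r A \<Longrightarrow> wkn (upr r) (A # \<Gamma>) (A' # \<Delta>)"
  by (simp add: wkn_Cons)

lemma wkn_JCtx:
  "wkctx (JCtx A a \<Gamma>) \<Longrightarrow> wkn r \<Gamma> \<Delta> \<Longrightarrow>
   wkn (upr (upr r)) (JCtx A a \<Gamma>) (JCtx (ren r A) (ren r a) \<Delta>)"
  unfolding JCtx_def by (intro wkn_Cons') (auto simp: wkctx.simps ren_upr_wk)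

lemmas ren_comm = ren_inst ren_inst2 ren_branch ren_step ren_upr_wk ren_Arr ren_IsProp
lemmas wkn_intros = wkn_Cons wkn_JCtx
  wkn_Cons[of Nat, simplified] wkn_Cons[of Unit, simplified] wkn_Cons[of Empty, simplified]
  wkn_Cons[of "Plus A B" for A B, simplified]

text \<open>In a branch the motive appears under a substitution for its scrutinee. The induction
  hypothesis has the renaming outside and the typing rule wants it inside; \<open>ren_branch\<close>
  exchanges the two.\<close>

lemma wk_branch:
  "\<forall>r \<Delta>. wkn r (A # \<Gamma>) \<Delta> \<longrightarrow> \<Delta> \<turnstile> ren r t \<Ztypecolon> ren r (sub (x \<rhd> (\<lambda>n. Var (Suc n))) C) \<Longrightarrow>
   wkctx (A # \<Gamma>) \<Longrightarrow> wkn r \<Gamma> \<Delta> \<Longrightarrow>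
   ren r A # \<Delta> \<turnstile> ren (upr r) t \<Ztypecolon> sub (ren (upr r) x \<rhd> (\<lambda>n. Var (Suc n))) (ren (upr r) C)"
  "\<forall>r \<Delta>. wkn r (A # \<Gamma>) \<Delta> \<longrightarrow> \<Delta> \<turnstile> ren r t \<doteq> ren r u \<Ztypecolon> ren r (sub (x \<rhd> (\<lambda>n. Var (Suc n))) C) \<Longrightarrow>
   wkctx (A # \<Gamma>) \<Longrightarrow> wkn r \<Gamma> \<Delta> \<Longrightarrow>
   ren r A # \<Delta> \<turnstile> ren (upr r) t \<doteq> ren (upr r) u \<Ztypecolon> sub (ren (upr r) x \<rhd> (\<lambda>n. Var (Suc n))) (ren (upr r) C)"
  by (metis ren_branch wkn_Cons)+

lemma wk_step:
  "\<forall>r \<Delta>. wkn r (C # Nat # \<Gamma>) \<Delta> \<longrightarrow> \<Delta> \<turnstile> ren r t \<Ztypecolon> ren r (sub (x \<rhd> (\<lambda>n. Var (Suc (Suc n)))) C) \<Longrightarrow>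
   wkctx (C # Nat # \<Gamma>) \<Longrightarrow> wkn r \<Gamma> \<Delta> \<Longrightarrow>
   ren (upr r) C # Nat # \<Delta> \<turnstile> ren (upr (upr r)) t \<Ztypecolon>
     sub (ren (upr (upr r)) x \<rhd> (\<lambda>n. Var (Suc (Suc n)))) (ren (upr r) C)"
  "\<forall>r \<Delta>. wkn r (C # Nat # \<Gamma>) \<Delta> \<longrightarrow>
     \<Delta> \<turnstile> ren r t \<doteq> ren r u \<Ztypecolon> ren r (sub (x \<rhd> (\<lambda>n. Var (Suc (Suc n)))) C) \<Longrightarrow>
   wkctx (C # Nat # \<Gamma>) \<Longrightarrow> wkn r \<Gamma> \<Delta> \<Longrightarrow>
   ren (upr r) C # Nat # \<Delta> \<turnstile> ren (upr (upr r)) t \<doteq> ren (upr (upr r)) u \<Ztypecolon>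
     sub (ren (upr (upr r)) x \<rhd> (\<lambda>n. Var (Suc (Suc n)))) (ren (upr r) C)"
  by (metis ren_step wkn_Cons wkctx.simps(2) ren.simps(19))+

lemma weaken:
  "ctx \<Gamma> \<Longrightarrow> wkctx \<Gamma>"
  "\<Gamma> \<turnstile> A type \<Longrightarrow> wkctx \<Gamma> \<and> (\<forall>r \<Delta>. wkn r \<Gamma> \<Delta> \<longrightarrow> \<Delta> \<turnstile> ren r A type)"
  "\<Gamma> \<turnstile> A \<doteq> B type \<Longrightarrow> wkctx \<Gamma> \<and> (\<forall>r \<Delta>. wkn r \<Gamma> \<Delta> \<longrightarrow> \<Delta> \<turnstile> ren r A \<doteq> ren r B type)"
  "\<Gamma> \<turnstile> t \<Ztypecolon> A \<Longrightarrow> wkctx \<Gamma> \<and> (\<forall>r \<Delta>. wkn r \<Gamma> \<Delta> \<longrightarrow> \<Delta> \<turnstile> ren r t \<Ztypecolon> ren r A)"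
  "\<Gamma> \<turnstile> t \<doteq> u \<Ztypecolon> A \<Longrightarrow> wkctx \<Gamma> \<and> (\<forall>r \<Delta>. wkn r \<Gamma> \<Delta> \<longrightarrow> \<Delta> \<turnstile> ren r t \<doteq> ren r u \<Ztypecolon> ren r A)"
proof (induction rule: ctx_isty_tyeq_hasty_tmeq.inducts)
  case ctx_nil then show ?case
    by ((auto simp: ren_comm dest: wkn_ctx intro!: ctx_isty_tyeq_hasty_tmeq.ctx_nil)?; blast intro: wkn_intros)
next
  case ctx_cons then show ?case
    by (simp add: wkctx.simps)
next
  case ty_Univ then show ?case
    by ((auto simp: ren_comm dest: wkn_ctx intro!: ctx_isty_tyeq_hasty_tmeq.ty_Univ)?; blast intro: wkn_intros)
next
  case ty_El then show ?case
    by (auto intro: ctx_isty_tyeq_hasty_tmeq.ty_El)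
next
  case ty_Pi then show ?case
    by ((auto simp: ren_comm dest: wkn_ctx intro!: ctx_isty_tyeq_hasty_tmeq.ty_Pi)?; blast intro: wkn_intros)
next
  case ty_Sig then show ?case
    by ((auto simp: ren_comm dest: wkn_ctx intro!: ctx_isty_tyeq_hasty_tmeq.ty_Sig)?; blast intro: wkn_intros)
next
  case ty_Plus then show ?case
    by ((auto simp: ren_comm dest: wkn_ctx intro!: ctx_isty_tyeq_hasty_tmeq.ty_Plus)?; blast intro: wkn_intros)
next
  case ty_Eq then show ?case
    by ((auto simp: ren_comm dest: wkn_ctx intro!: ctx_isty_tyeq_hasty_tmeq.ty_Eq)?; blast intro: wkn_intros)
next
  case ty_Trunc then show ?case
    by ((auto simp: ren_comm dest: wkn_ctx intro!: ctx_isty_tyeq_hasty_tmeq.ty_Trunc)?; blast intro: wkn_intros)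
next
  case tyeq_refl then show ?case
    by ((auto simp: ren_comm dest: wkn_ctx intro!: ctx_isty_tyeq_hasty_tmeq.tyeq_refl)?; blast intro: wkn_intros)
next
  case tyeq_sym then show ?case
    by (blast intro: ctx_isty_tyeq_hasty_tmeq.tyeq_sym)
next
  case tyeq_trans then show ?case
    by (blast intro: ctx_isty_tyeq_hasty_tmeq.tyeq_trans)
next
  case tyeq_El then show ?case
    by (auto intro: ctx_isty_tyeq_hasty_tmeq.tyeq_El)
next
  case tyeq_Pi then show ?case
    by ((auto simp: ren_comm dest: wkn_ctx intro!: ctx_isty_tyeq_hasty_tmeq.tyeq_Pi)?; blast intro: wkn_intros)
next
  case tyeq_Sig then show ?case
    by ((auto simp: ren_comm dest: wkn_ctx intro!: ctx_isty_tyeq_hasty_tmeq.tyeq_Sig)?; blast intro: wkn_intros)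
next
  case tyeq_Plus then show ?case
    by ((auto simp: ren_comm dest: wkn_ctx intro!: ctx_isty_tyeq_hasty_tmeq.tyeq_Plus)?; blast intro: wkn_intros)
next
  case tyeq_Eq then show ?case
    by ((auto simp: ren_comm dest: wkn_ctx intro!: ctx_isty_tyeq_hasty_tmeq.tyeq_Eq)?; blast intro: wkn_intros)
next
  case tyeq_Trunc then show ?case
    by ((auto simp: ren_comm dest: wkn_ctx intro!: ctx_isty_tyeq_hasty_tmeq.tyeq_Trunc)?; blast intro: wkn_intros)
next
  case tm_Var then show ?case
    by (auto simp: wkn_def intro!: ctx_isty_tyeq_hasty_tmeq.tm_Var simp del: add_Suc_right)
next
  case tm_conv then show ?case
    by (blast intro: ctx_isty_tyeq_hasty_tmeq.tm_conv)
next
  case tm_Pi then show ?case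
    by ((auto simp: ren_comm dest: wkn_ctx intro!: ctx_isty_tyeq_hasty_tmeq.tm_Pi)?; blast intro: wkn_intros)
next
  case tm_Sig then show ?case
    by ((auto simp: ren_comm dest: wkn_ctx intro!: ctx_isty_tyeq_hasty_tmeq.tm_Sig)?; blast intro: wkn_intros)
next
  case tm_Plus then show ?case
    by ((auto simp: ren_comm dest: wkn_ctx intro!: ctx_isty_tyeq_hasty_tmeq.tm_Plus)?; blast intro: wkn_intros)
next
  case tm_Eq then show ?case
    by ((auto simp: ren_comm dest: wkn_ctx intro!: ctx_isty_tyeq_hasty_tmeq.tm_Eq)?; blast intro: wkn_intros)
next
  case tm_Trunc then show ?case
    by ((auto simp: ren_comm dest: wkn_ctx intro!: ctx_isty_tyeq_hasty_tmeq.tm_Trunc)?; blast intro: wkn_intros)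
next
  case tm_Empty then show ?case
    by ((auto simp: ren_comm dest: wkn_ctx intro!: ctx_isty_tyeq_hasty_tmeq.tm_Empty)?; blast intro: wkn_intros)
next
  case tm_Unit then show ?case
    by ((auto simp: ren_comm dest: wkn_ctx intro!: ctx_isty_tyeq_hasty_tmeq.tm_Unit)?; blast intro: wkn_intros)
next
  case tm_Nat then show ?case
    by ((auto simp: ren_comm dest: wkn_ctx intro!: ctx_isty_tyeq_hasty_tmeq.tm_Nat)?; blast intro: wkn_intros)
next
  case tm_Lam then show ?case
    by ((auto simp: ren_comm dest: wkn_ctx intro!: ctx_isty_tyeq_hasty_tmeq.tm_Lam)?; blast intro: wkn_intros)
next
  case tm_App then show ?case
    by ((auto simp: ren_comm dest: wkn_ctx intro!: ctx_isty_tyeq_hasty_tmeq.tm_App)?; blast intro: wkn_intros)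
next
  case tm_Pr then show ?case
    by ((auto simp: ren_comm dest: wkn_ctx intro!: ctx_isty_tyeq_hasty_tmeq.tm_Pr)?; blast intro: wkn_intros)
next
  case tm_P1 then show ?case
    by ((auto simp: ren_comm dest: wkn_ctx intro!: ctx_isty_tyeq_hasty_tmeq.tm_P1)?; blast intro: wkn_intros)
next
  case tm_P2 then show ?case
    by ((auto simp: ren_comm dest: wkn_ctx intro!: ctx_isty_tyeq_hasty_tmeq.tm_P2)?; blast intro: wkn_intros)
next
  case tm_In1 then show ?case
    by ((auto simp: ren_comm dest: wkn_ctx intro!: ctx_isty_tyeq_hasty_tmeq.tm_In1)?; blast intro: wkn_intros)
next
  case tm_In2 then show ?case
    by ((auto simp: ren_comm dest: wkn_ctx intro!: ctx_isty_tyeq_hasty_tmeq.tm_In2)?; blast intro: wkn_intros)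
next
  case tm_Case then show ?case
    by ((auto simp: ren_comm dest: wk_branch wk_step intro!: ctx_isty_tyeq_hasty_tmeq.tm_Case)?; blast intro: wkn_intros)
next
  case tm_Efq then show ?case
    by ((auto simp: ren_comm dest: wkn_ctx intro!: ctx_isty_tyeq_hasty_tmeq.tm_Efq)?; blast intro: wkn_intros)
next
  case tm_Star then show ?case
    by ((auto simp: ren_comm dest: wkn_ctx intro!: ctx_isty_tyeq_hasty_tmeq.tm_Star)?; blast intro: wkn_intros)
next
  case tm_UnitRec then show ?case
    by ((auto simp: ren_comm dest: wkn_ctx intro!: ctx_isty_tyeq_hasty_tmeq.tm_UnitRec)?; blast intro: wkn_intros)
next
  case tm_Zero then show ?case
    by ((auto simp: ren_comm dest: wkn_ctx intro!: ctx_isty_tyeq_hasty_tmeq.tm_Zero)?; blast intro: wkn_intros)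
next
  case tm_Succ then show ?case
    by ((auto simp: ren_comm dest: wkn_ctx intro!: ctx_isty_tyeq_hasty_tmeq.tm_Succ)?; blast intro: wkn_intros)
next
  case tm_NatRec then show ?case
    by ((auto simp: ren_comm dest: wk_branch wk_step intro!: ctx_isty_tyeq_hasty_tmeq.tm_NatRec)?; blast intro: wkn_intros)
next
  case tm_Refl then show ?case
    by ((auto simp: ren_comm dest: wkn_ctx intro!: ctx_isty_tyeq_hasty_tmeq.tm_Refl)?; blast intro: wkn_intros)
next
  case tm_J then show ?case
    by ((auto simp: ren_comm dest: wkn_ctx intro!: ctx_isty_tyeq_hasty_tmeq.tm_J)?; blast intro: wkn_intros)
next
  case tm_TrIn then show ?case
    by ((auto simp: ren_comm dest: wkn_ctx intro!: ctx_isty_tyeq_hasty_tmeq.tm_TrIn)?; blast intro: wkn_intros)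
next
  case tm_TrEq then show ?case
    by ((auto simp: ren_comm dest: wkn_ctx intro!: ctx_isty_tyeq_hasty_tmeq.tm_TrEq)?; blast intro: wkn_intros)
next
  case tm_TrRec then show ?case
    by ((auto simp: ren_comm dest: wkn_ctx intro!: ctx_isty_tyeq_hasty_tmeq.tm_TrRec)?; blast intro: wkn_intros)
next
  case tm_FunExt then show ?case
    by ((auto simp: ren_comm dest: wkn_ctx intro!: ctx_isty_tyeq_hasty_tmeq.tm_FunExt)?; blast intro: wkn_intros)
next
  case tm_PropExt then show ?case
    by ((auto simp: ren_comm dest: wkn_ctx intro!: ctx_isty_tyeq_hasty_tmeq.tm_PropExt)?; blast intro: wkn_intros)
next
  case tmeq_refl then show ?case
    by ((auto simp: ren_comm dest: wkn_ctx intro!: ctx_isty_tyeq_hasty_tmeq.tmeq_refl)?; blast intro: wkn_intros)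
next
  case tmeq_sym then show ?case
    by (blast intro: ctx_isty_tyeq_hasty_tmeq.tmeq_sym)
next
  case tmeq_trans then show ?case
    by (blast intro: ctx_isty_tyeq_hasty_tmeq.tmeq_trans)
next
  case tmeq_conv then show ?case
    by (blast intro: ctx_isty_tyeq_hasty_tmeq.tmeq_conv)
next
  case beta_Pi then show ?case
    by ((auto simp: ren_comm dest: wkn_ctx intro!: ctx_isty_tyeq_hasty_tmeq.beta_Pi)?; blast intro: wkn_intros)
next
  case eta_Pi then show ?case
    by ((auto simp: ren_comm dest: wkn_ctx intro!: ctx_isty_tyeq_hasty_tmeq.eta_Pi)?; blast intro: wkn_intros)
next
  case beta_P1 then show ?case
    by ((auto simp: ren_comm dest: wkn_ctx intro!: ctx_isty_tyeq_hasty_tmeq.beta_P1)?; blast intro: wkn_intros)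
next
  case beta_P2 then show ?case
    by ((auto simp: ren_comm dest: wkn_ctx intro!: ctx_isty_tyeq_hasty_tmeq.beta_P2)?; blast intro: wkn_intros)
next
  case eta_Sig then show ?case
    by ((auto simp: ren_comm dest: wkn_ctx intro!: ctx_isty_tyeq_hasty_tmeq.eta_Sig)?; blast intro: wkn_intros)
next
  case beta_In1 then show ?case
    by ((auto simp: ren_comm dest: wk_branch wk_step intro!: ctx_isty_tyeq_hasty_tmeq.beta_In1)?; blast intro: wkn_intros)
next
  case beta_In2 then show ?case
    by ((auto simp: ren_comm dest: wk_branch wk_step intro!: ctx_isty_tyeq_hasty_tmeq.beta_In2)?; blast intro: wkn_intros)
next
  case beta_Star then show ?case
    by ((auto simp: ren_comm dest: wkn_ctx intro!: ctx_isty_tyeq_hasty_tmeq.beta_Star)?; blast intro: wkn_intros)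
next
  case beta_Zero then show ?case
    by ((auto simp: ren_comm dest: wk_branch wk_step intro!: ctx_isty_tyeq_hasty_tmeq.beta_Zero)?; blast intro: wkn_intros)
next
  case beta_Succ then show ?case
    by ((auto simp: ren_comm dest: wk_branch wk_step intro!: ctx_isty_tyeq_hasty_tmeq.beta_Succ)?; blast intro: wkn_intros)
next
  case beta_Refl then show ?case
    by ((auto simp: ren_comm dest: wkn_ctx intro!: ctx_isty_tyeq_hasty_tmeq.beta_Refl)?; blast intro: wkn_intros)
next
  case cong_Pi then show ?case
    by ((auto simp: ren_comm dest: wkn_ctx intro!: ctx_isty_tyeq_hasty_tmeq.cong_Pi)?; blast intro: wkn_intros)
next
  case cong_Sig then show ?case
    by ((auto simp: ren_comm dest: wkn_ctx intro!: ctx_isty_tyeq_hasty_tmeq.cong_Sig)?; blast intro: wkn_intros)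
next
  case cong_Plus then show ?case
    by ((auto simp: ren_comm dest: wkn_ctx intro!: ctx_isty_tyeq_hasty_tmeq.cong_Plus)?; blast intro: wkn_intros)
next
  case cong_Eq then show ?case
    by ((auto simp: ren_comm dest: wkn_ctx intro!: ctx_isty_tyeq_hasty_tmeq.cong_Eq)?; blast intro: wkn_intros)
next
  case cong_Trunc then show ?case
    by ((auto simp: ren_comm dest: wkn_ctx intro!: ctx_isty_tyeq_hasty_tmeq.cong_Trunc)?; blast intro: wkn_intros)
next
  case cong_Lam then show ?case
    by ((auto simp: ren_comm dest: wkn_ctx intro!: ctx_isty_tyeq_hasty_tmeq.cong_Lam)?; blast intro: wkn_intros)
next
  case cong_App then show ?case
    by ((auto simp: ren_comm dest: wkn_ctx intro!: ctx_isty_tyeq_hasty_tmeq.cong_App)?; blast intro: wkn_intros)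
next
  case cong_Pr then show ?case
    by ((auto simp: ren_comm dest: wkn_ctx intro!: ctx_isty_tyeq_hasty_tmeq.cong_Pr)?; blast intro: wkn_intros)
next
  case cong_P1 then show ?case
    by ((auto simp: ren_comm dest: wkn_ctx intro!: ctx_isty_tyeq_hasty_tmeq.cong_P1)?; blast intro: wkn_intros)
next
  case cong_P2 then show ?case
    by ((auto simp: ren_comm dest: wkn_ctx intro!: ctx_isty_tyeq_hasty_tmeq.cong_P2)?; blast intro: wkn_intros)
next
  case cong_In1 then show ?case
    by ((auto simp: ren_comm dest: wkn_ctx intro!: ctx_isty_tyeq_hasty_tmeq.cong_In1)?; blast intro: wkn_intros)
next
  case cong_In2 then show ?case
    by ((auto simp: ren_comm dest: wkn_ctx intro!: ctx_isty_tyeq_hasty_tmeq.cong_In2)?; blast intro: wkn_intros)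
next
  case cong_Case then show ?case
    by ((auto simp: ren_comm dest: wk_branch wk_step intro!: ctx_isty_tyeq_hasty_tmeq.cong_Case)?; blast intro: wkn_intros)
next
  case cong_Efq then show ?case
    by ((auto simp: ren_comm dest: wkn_ctx intro!: ctx_isty_tyeq_hasty_tmeq.cong_Efq)?; blast intro: wkn_intros)
next
  case cong_UnitRec then show ?case
    by ((auto simp: ren_comm dest: wkn_ctx intro!: ctx_isty_tyeq_hasty_tmeq.cong_UnitRec)?; blast intro: wkn_intros)
next
  case cong_Succ then show ?case
    by ((auto simp: ren_comm dest: wkn_ctx intro!: ctx_isty_tyeq_hasty_tmeq.cong_Succ)?; blast intro: wkn_intros)
next
  case cong_NatRec then show ?case
    by ((auto simp: ren_comm dest: wk_branch wk_step intro!: ctx_isty_tyeq_hasty_tmeq.cong_NatRec)?; blast intro: wkn_intros)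
next
  case cong_Refl then show ?case
    by ((auto simp: ren_comm dest: wkn_ctx intro!: ctx_isty_tyeq_hasty_tmeq.cong_Refl)?; blast intro: wkn_intros)
next
  case cong_J then show ?case
    by ((auto simp: ren_comm dest: wkn_ctx intro!: ctx_isty_tyeq_hasty_tmeq.cong_J)?; blast intro: wkn_intros)
next
  case cong_TrIn then show ?case
    by ((auto simp: ren_comm dest: wkn_ctx intro!: ctx_isty_tyeq_hasty_tmeq.cong_TrIn)?; blast intro: wkn_intros)
next
  case cong_TrEq then show ?case
    by ((auto simp: ren_comm dest: wkn_ctx intro!: ctx_isty_tyeq_hasty_tmeq.cong_TrEq)?; blast intro: wkn_intros)
next
  case cong_TrRec then show ?case
    by ((auto simp: ren_comm dest: wkn_ctx intro!: ctx_isty_tyeq_hasty_tmeq.cong_TrRec)?; blast intro: wkn_intros)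
next
  case cong_FunExt then show ?case
    by ((auto simp: ren_comm dest: wkn_ctx intro!: ctx_isty_tyeq_hasty_tmeq.cong_FunExt)?; blast intro: wkn_intros)
next
  case cong_PropExt then show ?case
    by ((auto simp: ren_comm dest: wkn_ctx intro!: ctx_isty_tyeq_hasty_tmeq.cong_PropExt)?; blast intro: wkn_intros)
qed

section \<open>Consequences of weakening, inversion and scoping\<close>

lemma ctx_ConsD: "ctx (A # \<Gamma>) \<Longrightarrow> ctx \<Gamma> \<and> \<Gamma> \<turnstile> A type"
  by (erule ctx.cases) auto

lemma wkn_Suc: "ctx (A # \<Gamma>) \<Longrightarrow> wkn Suc \<Gamma> (A # \<Gamma>)"
  by (auto simp: wkn_def ren_ren)

lemma wk_type: "ctx (A # \<Gamma>) \<Longrightarrow> \<Gamma> \<turnstile> B type \<Longrightarrow> A # \<Gamma> \<turnstile> wk B type"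
  using weaken(2) wkn_Suc by blast

lemma wk_tm: "ctx (A # \<Gamma>) \<Longrightarrow> \<Gamma> \<turnstile> t \<Ztypecolon> B \<Longrightarrow> A # \<Gamma> \<turnstile> wk t \<Ztypecolon> wk B"
  using weaken(4) wkn_Suc by blast

lemma Var_0: "ctx (A # \<Gamma>) \<Longrightarrow> A # \<Gamma> \<turnstile> Var 0 \<Ztypecolon> wk A"
  using tm_Var[of "A # \<Gamma>" 0] by simp

lemma Var_type: "ctx \<Gamma> \<Longrightarrow> n < length \<Gamma> \<Longrightarrow> \<Gamma> \<turnstile> ren (\<lambda>i. i + Suc n) (\<Gamma> ! n) type"
proof (induction \<Gamma> arbitrary: n)
  case (Cons A \<Gamma>)
  note c = ctx_ConsD[OF Cons.prems(1)]
  show ?case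
  proof (cases n)
    case 0
    then show ?thesis using wk_type[OF Cons.prems(1)] c by simp
  next
    case (Suc m)
    then have "\<Gamma> \<turnstile> ren (\<lambda>i. i + Suc m) (\<Gamma> ! m) type"
      using Cons.IH[of m] Cons.prems(2) c by simp
    then show ?thesis using wk_type[OF Cons.prems(1)] Suc by (fastforce simp: ren_ren)
  qed
qed simp

lemma JCtx_ctx: "\<Gamma> \<turnstile> A type \<Longrightarrow> \<Gamma> \<turnstile> a \<Ztypecolon> A \<Longrightarrow> ctx \<Gamma> \<Longrightarrow> ctx (JCtx A a \<Gamma>)"
  unfolding JCtx_def by (meson ctx_cons ty_Eq wk_type wk_tm Var_0)

text \<open>The type \<open>T\<close> does not occur in the conclusion, which makes the conversion
  rule a trivial case. Only the typing judgement carries content; the other claims complete the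
  mutual induction.\<close>

lemma former_inversion:
  "ctx \<Gamma> \<Longrightarrow> True"
  "\<Gamma> \<turnstile> X type \<Longrightarrow> True"
  "\<Gamma> \<turnstile> X \<doteq> Y type \<Longrightarrow> True"
  "\<Gamma> \<turnstile> X \<Ztypecolon> T \<Longrightarrow> case X of
     Pi A B \<Rightarrow> \<Gamma> \<turnstile> A \<Ztypecolon> Univ \<and> A # \<Gamma> \<turnstile> B \<Ztypecolon> Univ
   | Sig A B \<Rightarrow> \<Gamma> \<turnstile> A \<Ztypecolon> Univ \<and> A # \<Gamma> \<turnstile> B \<Ztypecolon> Univ
   | Plus A B \<Rightarrow> \<Gamma> \<turnstile> A \<Ztypecolon> Univ \<and> \<Gamma> \<turnstile> B \<Ztypecolon> Univ
   | Eq A t u \<Rightarrow> \<Gamma> \<turnstile> A \<Ztypecolon> Univ \<and> \<Gamma> \<turnstile> t \<Ztypecolon> A \<and> \<Gamma> \<turnstile> u \<Ztypecolon> A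
   | Trunc A \<Rightarrow> \<Gamma> \<turnstile> A \<Ztypecolon> Univ
   | _ \<Rightarrow> True"
  "\<Gamma> \<turnstile> t \<doteq> u \<Ztypecolon> T \<Longrightarrow> True"
  by (induction rule: ctx_isty_tyeq_hasty_tmeq.inducts) simp_all

text \<open>A type former becomes a type either by its own rule or through \<open>ty_El\<close>; the
  second route is settled by \<open>former_inversion\<close>.\<close>

lemma type_inversion:
  "\<Gamma> \<turnstile> Pi A B type \<Longrightarrow> \<Gamma> \<turnstile> A type \<and> A # \<Gamma> \<turnstile> B type"
  "\<Gamma> \<turnstile> Sig A B type \<Longrightarrow> \<Gamma> \<turnstile> A type \<and> A # \<Gamma> \<turnstile> B type"
  "\<Gamma> \<turnstile> Plus A B type \<Longrightarrow> \<Gamma> \<turnstile> A type \<and> \<Gamma> \<turnstile> B type"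
  "\<Gamma> \<turnstile> Eq A t u type \<Longrightarrow> \<Gamma> \<turnstile> A type \<and> \<Gamma> \<turnstile> t \<Ztypecolon> A \<and> \<Gamma> \<turnstile> u \<Ztypecolon> A"
  "\<Gamma> \<turnstile> Trunc A type \<Longrightarrow> \<Gamma> \<turnstile> A type"
  by (erule isty.cases; force dest: former_inversion(4) intro: ty_El)+

lemma small_types: "ctx \<Gamma> \<Longrightarrow> \<Gamma> \<turnstile> Nat type" "ctx \<Gamma> \<Longrightarrow> \<Gamma> \<turnstile> Unit type" "ctx \<Gamma> \<Longrightarrow> \<Gamma> \<turnstile> Empty type"
  by (blast intro: ty_El tm_Nat tm_Unit tm_Empty)+

lemma sub_ups_wk: "sub (ups \<tau>) (wk t) = wk (sub \<tau> t)"
  by (simp add: sub_ren ren_sub ups_def)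

lemma ren_id: "ren (\<lambda>n. n) t = t"
proof -
  have "upr (\<lambda>n. n) n = n" for n by (cases n) auto
  then have "upr (\<lambda>n. n) = (\<lambda>n. n)" by auto
  then show ?thesis by (induction t) auto
qed

lemma from_nil:
  assumes "ctx \<Delta>"
  shows "[] \<turnstile> A \<doteq> B type \<Longrightarrow> \<Delta> \<turnstile> A \<doteq> B type" "[] \<turnstile> A type \<Longrightarrow> \<Delta> \<turnstile> A type"
    "[] \<turnstile> t \<Ztypecolon> A \<Longrightarrow> \<Delta> \<turnstile> t \<Ztypecolon> A" "[] \<turnstile> t \<doteq> u \<Ztypecolon> A \<Longrightarrow> \<Delta> \<turnstile> t \<doteq> u \<Ztypecolon> A"
proof -
  \<comment> \<open>The empty context has no variables, so the condition on types is vacuous and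
    even the identity qualifies as a renaming.\<close>
  have "wkn (\<lambda>n. n) [] \<Delta>" using assms by (simp add: wkn_def)
  then show "[] \<turnstile> A \<doteq> B type \<Longrightarrow> \<Delta> \<turnstile> A \<doteq> B type" "[] \<turnstile> A type \<Longrightarrow> \<Delta> \<turnstile> A type"
    "[] \<turnstile> t \<Ztypecolon> A \<Longrightarrow> \<Delta> \<turnstile> t \<Ztypecolon> A" "[] \<turnstile> t \<doteq> u \<Ztypecolon> A \<Longrightarrow> \<Delta> \<turnstile> t \<doteq> u \<Ztypecolon> A"
    using weaken(2-5)[of "[]"] by (fastforce simp: ren_id)+
qed

definition fixes_below :: "nat \<Rightarrow> (nat \<Rightarrow> tm) \<Rightarrow> bool" where
  "fixes_below k \<sigma> \<longleftrightarrow> (\<forall>n<k. \<sigma> n = Var n)"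

lemma fixes_below_ups: "fixes_below k \<sigma> \<Longrightarrow> fixes_below (Suc k) (ups \<sigma>)"
  by (auto simp: fixes_below_def ups_def less_Suc_eq_0_disj)

text \<open>Free variables are bounded without being defined: a term whose indices lie below
  \<open>k\<close> is fixed by every substitution that is the identity below \<open>k\<close>. The
  claim concerns the subject of a judgement and not the type assigned to it, hence the conversion
  case is immediate.\<close>

lemma scoping:
  "ctx \<Gamma> \<Longrightarrow> True"
  "\<Gamma> \<turnstile> A type \<Longrightarrow> \<forall>\<sigma>. fixes_below (length \<Gamma>) \<sigma> \<longrightarrow> sub \<sigma> A = A"
  "\<Gamma> \<turnstile> A \<doteq> B type \<Longrightarrow> True"
  "\<Gamma> \<turnstile> t \<Ztypecolon> A \<Longrightarrow> \<forall>\<sigma>. fixes_below (length \<Gamma>) \<sigma> \<longrightarrow> sub \<sigma> t = t"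
  "\<Gamma> \<turnstile> t \<doteq> u \<Ztypecolon> A \<Longrightarrow> True"
  by (induction rule: ctx_isty_tyeq_hasty_tmeq.inducts)
    (simp_all add: JCtx_def fixes_below_ups, simp_all add: fixes_below_def)

lemma closed_sub: "[] \<turnstile> t \<Ztypecolon> A \<Longrightarrow> sub \<sigma> t = t"
  using scoping(4)[of "[]"] by (simp add: fixes_below_def)

lemma sub_Var_ren: "sub (\<lambda>n. Var (r n)) t = ren r t"
  using ren_sub[of r Var t] by (simp add: sub_Var)

lemma closed_ren: "[] \<turnstile> t \<Ztypecolon> A \<Longrightarrow> ren r t = t"
  by (metis sub_Var_ren closed_sub)

section \<open>A type checker\<close>

abbreviation thn :: "'a option \<Rightarrow> ('a \<Rightarrow> 'b option) \<Rightarrow> 'b option" (infixr "\<bind>" 54) where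
  "m \<bind> f \<equiv> (case m of None \<Rightarrow> None | Some x \<Rightarrow> f x)"

definition dest_Pi where "dest_Pi t = (case t of Pi A B \<Rightarrow> Some (A, B) | _ \<Rightarrow> None)"
definition dest_Sig where "dest_Sig t = (case t of Sig A B \<Rightarrow> Some (A, B) | _ \<Rightarrow> None)"
definition dest_Plus where "dest_Plus t = (case t of Plus A B \<Rightarrow> Some (A, B) | _ \<Rightarrow> None)"
definition dest_Eq where "dest_Eq t = (case t of Eq A a b \<Rightarrow> Some (A, a, b) | _ \<Rightarrow> None)"
definition dest_Trunc where "dest_Trunc t = (case t of Trunc A \<Rightarrow> Some A | _ \<Rightarrow> None)"
definition dest_Lam where "dest_Lam t = (case t of Lam A b \<Rightarrow> Some (A, b) | _ \<Rightarrow> None)"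
definition dest_Pr where "dest_Pr t = (case t of Pr a b \<Rightarrow> Some (a, b) | _ \<Rightarrow> None)"
definition dest_In1 where "dest_In1 t = (case t of In1 a \<Rightarrow> Some a | _ \<Rightarrow> None)"
definition dest_In2 where "dest_In2 t = (case t of In2 a \<Rightarrow> Some a | _ \<Rightarrow> None)"
definition dest_Succ where "dest_Succ t = (case t of Succ n \<Rightarrow> Some n | _ \<Rightarrow> None)"
definition dest_Refl where "dest_Refl t = (case t of Refl a \<Rightarrow> Some a | _ \<Rightarrow> None)"
definition dest_P1 where "dest_P1 t = (case t of P1 a \<Rightarrow> Some a | _ \<Rightarrow> None)"
definition dest_App where "dest_App t = (case t of App f a \<Rightarrow> Some (f, a) | _ \<Rightarrow> None)"

text \<open>
  Pairs and injections do not determine their types. In normal forms they are wrapped in a type ascription,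
  the redex \<open>Ann T t\<close>, so that a normal form substituted into another term can be inferred again.
\<close>

definition Ann :: "tm \<Rightarrow> tm \<Rightarrow> tm" where
  "Ann T t = App (Lam T (Var 0)) t"

definition is_asc :: "tm \<Rightarrow> tm option" where
  "is_asc f = (dest_Lam f \<bind> (\<lambda>(T, x). if x = Var 0 then Some T else None))"

definition dest_Ann :: "tm \<Rightarrow> tm option" where
  "dest_Ann t = (dest_App t \<bind> (\<lambda>(f, a). is_asc f \<bind> (\<lambda>T. Some a)))"

text \<open>These are the introduction forms for which \<open>check\<close> exploits the expected
  type; any other term is inferred and its type compared. Going through a view leaves
  \<open>check\<close> with a single equation for positive fuel.\<close>

datatype view = VLam tm tm | VPr tm tm | VIn1 tm | VIn2 tm | VRefl tm | VTrIn tm | VOther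
definition view :: "tm \<Rightarrow> view" where
  "view t = (case t of Lam A b \<Rightarrow> VLam A b | Pr a b \<Rightarrow> VPr a b | In1 a \<Rightarrow> VIn1 a | In2 a \<Rightarrow> VIn2 a
     | Refl a \<Rightarrow> VRefl a | TrIn a \<Rightarrow> VTrIn a | _ \<Rightarrow> VOther)"

datatype tview = TUniv | TPi tm tm | TSig tm tm | TPlus tm tm | TEq tm tm tm | TTrunc tm | TOther
definition tview :: "tm \<Rightarrow> tview" where
  "tview t = (case t of Univ \<Rightarrow> TUniv | Pi A B \<Rightarrow> TPi A B | Sig A B \<Rightarrow> TSig A B | Plus A B \<Rightarrow> TPlus A B
     | Eq A a b \<Rightarrow> TEq A a b | Trunc A \<Rightarrow> TTrunc A | _ \<Rightarrow> TOther)"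

text \<open>Bidirectional checking that also normalises: \<open>infer\<close> returns a normal form
  with its type, \<open>check\<close> a normal form at a given type. The fuel makes the functions
  total without an appeal to termination of reduction. Failure is harmless, since soundness is
  claimed for successful runs alone.\<close>

fun infer :: "nat \<Rightarrow> tm list \<Rightarrow> tm \<Rightarrow> (tm \<times> tm) option"
and check :: "nat \<Rightarrow> tm list \<Rightarrow> tm \<Rightarrow> tm \<Rightarrow> tm option"
and norm_ty :: "nat \<Rightarrow> tm list \<Rightarrow> tm \<Rightarrow> tm option"
where
  "infer 0 \<Gamma> t = None"
| "infer (Suc k) \<Gamma> (Var n) =
     (if n < length \<Gamma> then Some (Var n, ren (\<lambda>i. i + Suc n) (\<Gamma> ! n)) else None)"
| "infer (Suc k) \<Gamma> Univ = None"
| "infer (Suc k) \<Gamma> (Pi A B) = (check k \<Gamma> A Univ \<bind> (\<lambda>A'. check k (A' # \<Gamma>) B Univ \<bind> (\<lambda>B'.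
     Some (Pi A' B', Univ))))"
| "infer (Suc k) \<Gamma> (Lam A b) = (norm_ty k \<Gamma> A \<bind> (\<lambda>A'. infer k (A' # \<Gamma>) b \<bind> (\<lambda>(b', B).
     Some (Lam A' b', Pi A' B))))"
\<comment> \<open>An ascription directs the checker to the type \<open>S\<close> and then
  disappears; around pairs and injections \<open>check\<close> puts it back. For any other redex the
  contractum is checked against the type already computed.\<close>
| "infer (Suc k) \<Gamma> (App f a) =
     (case is_asc f of
        Some S \<Rightarrow> norm_ty k \<Gamma> S \<bind> (\<lambda>S'. check k \<Gamma> a S' \<bind> (\<lambda>a'. Some (a', S')))
      | None \<Rightarrow> infer k \<Gamma> f \<bind> (\<lambda>(f', F). dest_Pi F \<bind> (\<lambda>(A, B). check k \<Gamma> a A \<bind> (\<lambda>a'.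
          norm_ty k \<Gamma> (inst B a') \<bind> (\<lambda>T.
          case dest_Lam f' of
            None \<Rightarrow> Some (App f' a', T)
          | Some (_, b) \<Rightarrow> check k \<Gamma> (inst b a') T \<bind> (\<lambda>t'. Some (t', T)))))))"
| "infer (Suc k) \<Gamma> (Sig A B) = (check k \<Gamma> A Univ \<bind> (\<lambda>A'. check k (A' # \<Gamma>) B Univ \<bind> (\<lambda>B'.
     Some (Sig A' B', Univ))))"
| "infer (Suc k) \<Gamma> (Pr a b) = None"
| "infer (Suc k) \<Gamma> (P1 p) = (infer k \<Gamma> p \<bind> (\<lambda>(p', S). dest_Sig S \<bind> (\<lambda>(A, B).
     case dest_Ann p' \<bind> dest_Pr of
       None \<Rightarrow> Some (P1 p', A)
     | Some (a, b) \<Rightarrow> check k \<Gamma> a A \<bind> (\<lambda>t'. Some (t', A)))))"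
\<comment> \<open>Once a pair is exposed, the type of its second component mentions \<open>a\<close>
  where \<open>T\<close> was computed from the projection. Requiring one normal form for both
  replaces a congruence rule for substitution; the clause for \<open>Case\<close> does the same for
  injections.\<close>
| "infer (Suc k) \<Gamma> (P2 p) = (infer k \<Gamma> p \<bind> (\<lambda>(p', S). dest_Sig S \<bind> (\<lambda>(A, B).
     norm_ty k \<Gamma> (inst B (P1 p')) \<bind> (\<lambda>T.
     case dest_Ann p' \<bind> dest_Pr of
       None \<Rightarrow> Some (P2 p', T)
     | Some (a, b) \<Rightarrow> if norm_ty k \<Gamma> (inst B a) = Some T then check k \<Gamma> b T \<bind> (\<lambda>t'. Some (t', T)) else None))))"
| "infer (Suc k) \<Gamma> (Plus A B) = (check k \<Gamma> A Univ \<bind> (\<lambda>A'. check k \<Gamma> B Univ \<bind> (\<lambda>B'.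
     Some (Plus A' B', Univ))))"
| "infer (Suc k) \<Gamma> (In1 a) = None"
| "infer (Suc k) \<Gamma> (In2 a) = None"
| "infer (Suc k) \<Gamma> (Case C l r s) = (infer k \<Gamma> s \<bind> (\<lambda>(s', S). dest_Plus S \<bind> (\<lambda>(A, B).
     norm_ty k (Plus A B # \<Gamma>) C \<bind> (\<lambda>C'.
     norm_ty k (A # \<Gamma>) (sub (In1 (Var 0) \<rhd> (\<lambda>n. Var (Suc n))) C') \<bind> (\<lambda>L. check k (A # \<Gamma>) l L \<bind> (\<lambda>l'.
     norm_ty k (B # \<Gamma>) (sub (In2 (Var 0) \<rhd> (\<lambda>n. Var (Suc n))) C') \<bind> (\<lambda>R. check k (B # \<Gamma>) r R \<bind> (\<lambda>r'.
     norm_ty k \<Gamma> (inst C' s') \<bind> (\<lambda>T.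
     case dest_Ann s' \<bind> dest_In1 of
       Some a \<Rightarrow> if norm_ty k \<Gamma> (inst C' (In1 a)) = Some T then check k \<Gamma> (inst l' a) T \<bind> (\<lambda>t'. Some (t', T)) else None
     | None \<Rightarrow> (case dest_Ann s' \<bind> dest_In2 of
         Some b \<Rightarrow> if norm_ty k \<Gamma> (inst C' (In2 b)) = Some T then check k \<Gamma> (inst r' b) T \<bind> (\<lambda>t'. Some (t', T)) else None
       | None \<Rightarrow> Some (Case C' l' r' s', T)))))))))))"
| "infer (Suc k) \<Gamma> Empty = Some (Empty, Univ)"
| "infer (Suc k) \<Gamma> (Efq C t) = (check k \<Gamma> t Empty \<bind> (\<lambda>t'. norm_ty k (Empty # \<Gamma>) C \<bind> (\<lambda>C'.
     norm_ty k \<Gamma> (inst C' t') \<bind> (\<lambda>T. Some (Efq C' t', T)))))"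
| "infer (Suc k) \<Gamma> Unit = Some (Unit, Univ)"
| "infer (Suc k) \<Gamma> Star = Some (Star, Unit)"
| "infer (Suc k) \<Gamma> (UnitRec C c t) = (check k \<Gamma> t Unit \<bind> (\<lambda>t'. norm_ty k (Unit # \<Gamma>) C \<bind> (\<lambda>C'.
     norm_ty k \<Gamma> (inst C' Star) \<bind> (\<lambda>T\<^sub>0. check k \<Gamma> c T\<^sub>0 \<bind> (\<lambda>c'.
     if t' = Star then Some (c', T\<^sub>0)
     else norm_ty k \<Gamma> (inst C' t') \<bind> (\<lambda>T. Some (UnitRec C' c' t', T)))))))"
| "infer (Suc k) \<Gamma> Nat = Some (Nat, Univ)"
| "infer (Suc k) \<Gamma> Zero = Some (Zero, Nat)"
| "infer (Suc k) \<Gamma> (Succ n) = (check k \<Gamma> n Nat \<bind> (\<lambda>n'. Some (Succ n', Nat)))"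
| "infer (Suc k) \<Gamma> (NatRec C z s n) = (check k \<Gamma> n Nat \<bind> (\<lambda>n'. norm_ty k (Nat # \<Gamma>) C \<bind> (\<lambda>C'.
     norm_ty k \<Gamma> (inst C' Zero) \<bind> (\<lambda>T\<^sub>0. check k \<Gamma> z T\<^sub>0 \<bind> (\<lambda>z'.
     norm_ty k (C' # Nat # \<Gamma>) (sub (Succ (Var 1) \<rhd> (\<lambda>n. Var (Suc (Suc n)))) C') \<bind> (\<lambda>S.
     check k (C' # Nat # \<Gamma>) s S \<bind> (\<lambda>s'.
     if n' = Zero then Some (z', T\<^sub>0)
     else norm_ty k \<Gamma> (inst C' n') \<bind> (\<lambda>T.
       case dest_Succ n' of
         None \<Rightarrow> Some (NatRec C' z' s' n', T)
       | Some m \<Rightarrow> check k \<Gamma> (inst2 s' m (NatRec C' z' s' m)) T \<bind> (\<lambda>t'. Some (t', T))))))))))"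
| "infer (Suc k) \<Gamma> (Eq A t u) = (check k \<Gamma> A Univ \<bind> (\<lambda>A'. check k \<Gamma> t A' \<bind> (\<lambda>t'. check k \<Gamma> u A' \<bind> (\<lambda>u'.
     Some (Eq A' t' u', Univ)))))"
| "infer (Suc k) \<Gamma> (Refl t) = (infer k \<Gamma> t \<bind> (\<lambda>(t', A). Some (Refl t', Eq A t' t')))"
| "infer (Suc k) \<Gamma> (J C d p) = (infer k \<Gamma> p \<bind> (\<lambda>(p', E). dest_Eq E \<bind> (\<lambda>(A, a, b).
     norm_ty k (JCtx A a \<Gamma>) C \<bind> (\<lambda>C'. norm_ty k \<Gamma> (inst2 C' a (Refl a)) \<bind> (\<lambda>D. check k \<Gamma> d D \<bind> (\<lambda>d'.
     case dest_Refl p' of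
       None \<Rightarrow> norm_ty k \<Gamma> (inst2 C' b p') \<bind> (\<lambda>T. Some (J C' d' p', T))
     | Some _ \<Rightarrow> Some (d', D)))))))"
| "infer (Suc k) \<Gamma> (Trunc A) = (check k \<Gamma> A Univ \<bind> (\<lambda>A'. Some (Trunc A', Univ)))"
| "infer (Suc k) \<Gamma> (TrIn t) = (infer k \<Gamma> t \<bind> (\<lambda>(t', A). Some (TrIn t', Trunc A)))"
| "infer (Suc k) \<Gamma> (TrEq t u) = (infer k \<Gamma> t \<bind> (\<lambda>(t', T). dest_Trunc T \<bind> (\<lambda>A. check k \<Gamma> u T \<bind> (\<lambda>u'.
     Some (TrEq t' u', Eq T t' u')))))"
| "infer (Suc k) \<Gamma> (TrRec B h f t) = (norm_ty k \<Gamma> B \<bind> (\<lambda>B'. infer k \<Gamma> t \<bind> (\<lambda>(t', T). dest_Trunc T \<bind> (\<lambda>A.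
     norm_ty k \<Gamma> (IsProp B') \<bind> (\<lambda>H. check k \<Gamma> h H \<bind> (\<lambda>h'.
     norm_ty k \<Gamma> (Arr A B') \<bind> (\<lambda>F. check k \<Gamma> f F \<bind> (\<lambda>f'.
     Some (TrRec B' h' f' t', B')))))))))"
| "infer (Suc k) \<Gamma> (FunExt f g h) = (infer k \<Gamma> f \<bind> (\<lambda>(f', P). dest_Pi P \<bind> (\<lambda>(A, B). check k \<Gamma> g P \<bind> (\<lambda>g'.
     norm_ty k \<Gamma> (Pi A (Eq B (App (wk f') (Var 0)) (App (wk g') (Var 0)))) \<bind> (\<lambda>H. check k \<Gamma> h H \<bind> (\<lambda>h'.
     Some (FunExt f' g' h', Eq P f' g')))))))"
| "infer (Suc k) \<Gamma> (PropExt P Q hP hQ f g) = (check k \<Gamma> P Univ \<bind> (\<lambda>P'. check k \<Gamma> Q Univ \<bind> (\<lambda>Q'.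
     norm_ty k \<Gamma> (IsProp P') \<bind> (\<lambda>H\<^sub>1. check k \<Gamma> hP H\<^sub>1 \<bind> (\<lambda>hP'.
     norm_ty k \<Gamma> (IsProp Q') \<bind> (\<lambda>H\<^sub>2. check k \<Gamma> hQ H\<^sub>2 \<bind> (\<lambda>hQ'.
     norm_ty k \<Gamma> (Arr P' Q') \<bind> (\<lambda>F. check k \<Gamma> f F \<bind> (\<lambda>f'.
     norm_ty k \<Gamma> (Arr Q' P') \<bind> (\<lambda>G. check k \<Gamma> g G \<bind> (\<lambda>g'.
     Some (PropExt P' Q' hP' hQ' f' g', Eq Univ P' Q'))))))))))))"
| "check 0 \<Gamma> t T = None"
\<comment> \<open>The test on \<open>P1\<close> and \<open>P2\<close> in the case of pairs
  implements surjective pairing. It insists that \<open>p\<close> infers to itself at type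
  \<open>T\<close>, so that the contracted term is again a normal form of that type.\<close>
| "check (Suc k) \<Gamma> t T = (case view t of
       VLam A b \<Rightarrow> dest_Pi T \<bind> (\<lambda>(A', B). if norm_ty k \<Gamma> A = Some A' then
         check k (A' # \<Gamma>) b B \<bind> (\<lambda>b'. Some (Lam A' b')) else None)
     | VPr a b \<Rightarrow> dest_Sig T \<bind> (\<lambda>(A, B). check k \<Gamma> a A \<bind> (\<lambda>a'. norm_ty k \<Gamma> (inst B a') \<bind> (\<lambda>B'.
         check k \<Gamma> b B' \<bind> (\<lambda>b'.
         case dest_P1 a' of
           None \<Rightarrow> Some (Ann T (Pr a' b'))
         | Some p \<Rightarrow> if b' = P2 p \<and> infer k \<Gamma> p = Some (p, T) then Some p else Some (Ann T (Pr a' b'))))))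
     | VIn1 a \<Rightarrow> dest_Plus T \<bind> (\<lambda>(A, B). check k \<Gamma> a A \<bind> (\<lambda>a'. Some (Ann T (In1 a'))))
     | VIn2 b \<Rightarrow> dest_Plus T \<bind> (\<lambda>(A, B). check k \<Gamma> b B \<bind> (\<lambda>b'. Some (Ann T (In2 b'))))
     | VRefl a \<Rightarrow> dest_Eq T \<bind> (\<lambda>(A, x, y). check k \<Gamma> a A \<bind> (\<lambda>a'.
         if x = a' \<and> y = a' then Some (Refl a') else None))
     | VTrIn a \<Rightarrow> dest_Trunc T \<bind> (\<lambda>A. check k \<Gamma> a A \<bind> (\<lambda>a'. Some (TrIn a')))
     | VOther \<Rightarrow> infer k \<Gamma> t \<bind> (\<lambda>(t', T'). if T' = T then Some t' else None))"
| "norm_ty 0 \<Gamma> A = None"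
| "norm_ty (Suc k) \<Gamma> X = (case tview X of
       TUniv \<Rightarrow> Some Univ
     | TPi A B \<Rightarrow> norm_ty k \<Gamma> A \<bind> (\<lambda>A'. norm_ty k (A' # \<Gamma>) B \<bind> (\<lambda>B'. Some (Pi A' B')))
     | TSig A B \<Rightarrow> norm_ty k \<Gamma> A \<bind> (\<lambda>A'. norm_ty k (A' # \<Gamma>) B \<bind> (\<lambda>B'. Some (Sig A' B')))
     | TPlus A B \<Rightarrow> norm_ty k \<Gamma> A \<bind> (\<lambda>A'. norm_ty k \<Gamma> B \<bind> (\<lambda>B'. Some (Plus A' B')))
     | TEq A t u \<Rightarrow> norm_ty k \<Gamma> A \<bind> (\<lambda>A'. check k \<Gamma> t A' \<bind> (\<lambda>t'. check k \<Gamma> u A' \<bind> (\<lambda>u'. Some (Eq A' t' u'))))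
     | TTrunc A \<Rightarrow> norm_ty k \<Gamma> A \<bind> (\<lambda>A'. Some (Trunc A'))
     | TOther \<Rightarrow> check k \<Gamma> X Univ)"

definition proves :: "nat \<Rightarrow> expr \<Rightarrow> expr \<Rightarrow> bool" where
  "proves k t T = (case norm_ty k [] (T 0) of None \<Rightarrow> False | Some T' \<Rightarrow> check k [] (t 0) T' \<noteq> None)"

section \<open>Soundness of the type checker\<close>

text \<open>
  \<open>good\<close> remembers the types of the components of a canonical normal form. This is what the computation rules
  need; recovering it from the typing of the normal form would require injectivity of the type formers.
\<close>

definition good :: "tm list \<Rightarrow> tm \<Rightarrow> tm \<Rightarrow> bool" where
  "good \<Gamma> t T \<longleftrightarrow> \<Gamma> \<turnstile> t \<Ztypecolon> T \<and>
     (\<forall>A b. t = Lam A b \<longrightarrow> (\<exists>B. T = Pi A B \<and> A # \<Gamma> \<turnstile> b \<Ztypecolon> B)) \<and>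
     (\<forall>S a b. t = Ann S (Pr a b) \<longrightarrow> S = T \<and> (\<exists>A B. T = Sig A B \<and> \<Gamma> \<turnstile> a \<Ztypecolon> A \<and> \<Gamma> \<turnstile> b \<Ztypecolon> inst B a)) \<and>
     (\<forall>S a. t = Ann S (In1 a) \<longrightarrow> S = T \<and> (\<exists>A B. T = Plus A B \<and> \<Gamma> \<turnstile> a \<Ztypecolon> A)) \<and>
     (\<forall>S b. t = Ann S (In2 b) \<longrightarrow> S = T \<and> (\<exists>A B. T = Plus A B \<and> \<Gamma> \<turnstile> b \<Ztypecolon> B)) \<and>
     (\<forall>n. t = Succ n \<longrightarrow> \<Gamma> \<turnstile> n \<Ztypecolon> Nat) \<and>
     (\<forall>a. t = Refl a \<longrightarrow> (\<exists>A. T = Eq A a a))"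

text \<open>
  Only the normal form is claimed to be well typed, not the original term: no presupposition lemma for
  judgemental equality is available.
\<close>

definition nf :: "tm list \<Rightarrow> tm \<Rightarrow> tm \<Rightarrow> tm \<Rightarrow> bool" where
  "nf \<Gamma> t' t T \<longleftrightarrow> \<Gamma> \<turnstile> t' \<doteq> t \<Ztypecolon> T \<and> good \<Gamma> t' T"

definition tnf :: "tm list \<Rightarrow> tm \<Rightarrow> tm \<Rightarrow> bool" where
  "tnf \<Gamma> A' A \<longleftrightarrow> \<Gamma> \<turnstile> A' \<doteq> A type \<and> \<Gamma> \<turnstile> A' type"

definition inert :: "tm \<Rightarrow> bool" where
  "inert t \<longleftrightarrow> (\<forall>A b. t \<noteq> Lam A b) \<and> (\<forall>T x. t \<noteq> Ann T x) \<and> (\<forall>n. t \<noteq> Succ n) \<and> (\<forall>a. t \<noteq> Refl a)"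

section \<open>Elementary properties of normal forms\<close>

lemma dest_iff [simp]:
  "dest_Pi t = Some p \<longleftrightarrow> t = Pi (fst p) (snd p)"
  "dest_Sig t = Some p \<longleftrightarrow> t = Sig (fst p) (snd p)"
  "dest_Plus t = Some p \<longleftrightarrow> t = Plus (fst p) (snd p)"
  "dest_Eq t = Some q \<longleftrightarrow> t = Eq (fst q) (fst (snd q)) (snd (snd q))"
  "dest_Trunc t = Some A \<longleftrightarrow> t = Trunc A"
  "dest_Lam t = Some p \<longleftrightarrow> t = Lam (fst p) (snd p)"
  "dest_Pr t = Some p \<longleftrightarrow> t = Pr (fst p) (snd p)"
  "dest_In1 t = Some A \<longleftrightarrow> t = In1 A"
  "dest_In2 t = Some A \<longleftrightarrow> t = In2 A"
  "dest_Succ t = Some A \<longleftrightarrow> t = Succ A"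
  "dest_Refl t = Some A \<longleftrightarrow> t = Refl A"
  "dest_P1 t = Some A \<longleftrightarrow> t = P1 A"
  "dest_App t = Some p \<longleftrightarrow> t = App (fst p) (snd p)"
  unfolding dest_Pi_def dest_Sig_def dest_Plus_def dest_Eq_def dest_Trunc_def dest_Lam_def dest_Pr_def
    dest_In1_def dest_In2_def dest_Succ_def dest_Refl_def dest_P1_def dest_App_def
  by (cases t; auto)+

lemma case_Some:
  "(case m of None \<Rightarrow> x | Some y \<Rightarrow> f y) = Some z \<longleftrightarrow> m = None \<and> x = Some z \<or> (\<exists>y. m = Some y \<and> f y = Some z)"
  by (cases m) auto

lemma is_asc_iff [simp]: "is_asc f = Some T \<longleftrightarrow> f = Lam T (Var 0)"
  by (auto simp: is_asc_def case_Some)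

lemma dest_Ann_iff [simp]: "dest_Ann t = Some x \<longleftrightarrow> (\<exists>T. t = Ann T x)"
  by (auto simp: dest_Ann_def case_Some Ann_def)

lemma inertI:
  "(\<And>A b. t \<noteq> Lam A b) \<Longrightarrow> (\<And>T x. t \<noteq> Ann T x) \<Longrightarrow> (\<And>n. t \<noteq> Succ n) \<Longrightarrow> (\<And>a. t \<noteq> Refl a) \<Longrightarrow> inert t"
  by (simp add: inert_def)

lemma good_inert: "inert t \<Longrightarrow> good \<Gamma> t T \<longleftrightarrow> \<Gamma> \<turnstile> t \<Ztypecolon> T"
  by (simp add: inert_def good_def)

lemma tnf_conv: "tnf \<Gamma> A' A \<Longrightarrow> \<Gamma> \<turnstile> t \<Ztypecolon> A \<Longrightarrow> \<Gamma> \<turnstile> t \<Ztypecolon> A'"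
  "tnf \<Gamma> A' A \<Longrightarrow> \<Gamma> \<turnstile> t \<doteq> u \<Ztypecolon> A \<Longrightarrow> \<Gamma> \<turnstile> t \<doteq> u \<Ztypecolon> A'"
  "tnf \<Gamma> A' A \<Longrightarrow> \<Gamma> \<turnstile> t \<Ztypecolon> A' \<Longrightarrow> \<Gamma> \<turnstile> t \<Ztypecolon> A"
  "tnf \<Gamma> A' A \<Longrightarrow> \<Gamma> \<turnstile> t \<doteq> u \<Ztypecolon> A' \<Longrightarrow> \<Gamma> \<turnstile> t \<doteq> u \<Ztypecolon> A"
  unfolding tnf_def by (blast intro: tm_conv tmeq_conv tyeq_sym)+

lemma tnf_type: "tnf \<Gamma> A' A \<Longrightarrow> \<Gamma> \<turnstile> A' type"
  by (simp add: tnf_def)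

lemma nf_tm: "nf \<Gamma> t' t T \<Longrightarrow> \<Gamma> \<turnstile> t' \<Ztypecolon> T"
  by (simp add: nf_def good_def)

lemma nf_eq: "nf \<Gamma> t' t T \<Longrightarrow> \<Gamma> \<turnstile> t' \<doteq> t \<Ztypecolon> T"
  by (simp add: nf_def)

lemma nf_inertI: "\<Gamma> \<turnstile> t' \<Ztypecolon> T \<Longrightarrow> \<Gamma> \<turnstile> t' \<doteq> t \<Ztypecolon> T \<Longrightarrow> inert t' \<Longrightarrow> nf \<Gamma> t' t T"
  by (simp add: nf_def good_inert)

lemma nf_transfer: "\<Gamma> \<turnstile> u \<doteq> t \<Ztypecolon> T \<Longrightarrow> nf \<Gamma> t' u T \<Longrightarrow> nf \<Gamma> t' t T"
  unfolding nf_def by (blast intro: tmeq_trans)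

section \<open>Soundness of the clauses for the individual term formers\<close>

lemma Ann_eq:
  assumes "ctx \<Gamma>" "\<Gamma> \<turnstile> T type" "\<Gamma> \<turnstile> t \<Ztypecolon> T"
  shows "\<Gamma> \<turnstile> Ann T t \<doteq> t \<Ztypecolon> T" "\<Gamma> \<turnstile> Ann T t \<Ztypecolon> T"
proof -
  have v: "T # \<Gamma> \<turnstile> Var 0 \<Ztypecolon> wk T"
    using assms by (intro Var_0 ctx_cons)
  show "\<Gamma> \<turnstile> Ann T t \<doteq> t \<Ztypecolon> T"
    using beta_Pi[OF assms(2) v assms(3)] by (simp add: Ann_def inst_wk)
  show "\<Gamma> \<turnstile> Ann T t \<Ztypecolon> T"
    using tm_App[OF tm_Lam[OF assms(2) v] assms(3)] by (simp add: Ann_def inst_wk)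
qed

lemma Ann_inject [simp]: "Ann S x = Ann T y \<longleftrightarrow> S = T \<and> x = y"
  by (simp add: Ann_def)

lemma Ann_neq [simp]: "Ann S x \<noteq> Lam A b" "Ann S x \<noteq> Succ n" "Ann S x \<noteq> Refl a"
  by (simp_all add: Ann_def)

text \<open>The second conclusion, without the ascription, is the starting point of the eta
  contraction in \<open>nf_eta\<close>.\<close>

lemma nf_Pr:
  assumes "ctx \<Gamma>" "\<Gamma> \<turnstile> Sig A B type" "nf \<Gamma> a' a A" "tnf \<Gamma> B' (inst B a')" "nf \<Gamma> b' b B'"
  shows "nf \<Gamma> (Ann (Sig A B) (Pr a' b')) (Pr a b) (Sig A B)"
    and "\<Gamma> \<turnstile> Pr a' b' \<doteq> Pr a b \<Ztypecolon> Sig A B"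
proof -
  note AB = type_inversion(2)[OF assms(2)]
  have b: "\<Gamma> \<turnstile> b' \<Ztypecolon> inst B a'" using assms(4,5) tnf_conv(3) nf_tm by blast
  have p: "\<Gamma> \<turnstile> Pr a' b' \<Ztypecolon> Sig A B"
    using AB b nf_tm[OF assms(3)] by (intro tm_Pr) auto
  show e: "\<Gamma> \<turnstile> Pr a' b' \<doteq> Pr a b \<Ztypecolon> Sig A B"
    using AB nf_eq[OF assms(3)] tnf_conv(4)[OF assms(4) nf_eq[OF assms(5)]] by (intro cong_Pr) auto
  show "nf \<Gamma> (Ann (Sig A B) (Pr a' b')) (Pr a b) (Sig A B)"
    using Ann_eq[OF assms(1,2) p] b nf_tm[OF assms(3)] tmeq_trans[OF _ e]
    by (auto simp: nf_def good_def Ann_inject)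
qed

lemma nf_In1:
  assumes "ctx \<Gamma>" "\<Gamma> \<turnstile> Plus A B type" "nf \<Gamma> a' a A"
  shows "nf \<Gamma> (Ann (Plus A B) (In1 a')) (In1 a) (Plus A B)"
proof -
  note AB = type_inversion(3)[OF assms(2)]
  have "\<Gamma> \<turnstile> In1 a' \<Ztypecolon> Plus A B" using AB nf_tm[OF assms(3)] by (intro tm_In1) auto
  moreover have "\<Gamma> \<turnstile> In1 a' \<doteq> In1 a \<Ztypecolon> Plus A B" using AB nf_eq[OF assms(3)] by (intro cong_In1) auto
  ultimately show ?thesis
    using Ann_eq[OF assms(1,2)] nf_tm[OF assms(3)] by (auto simp: nf_def good_def Ann_inject intro: tmeq_trans)
qed

lemma nf_In2:
  assumes "ctx \<Gamma>" "\<Gamma> \<turnstile> Plus A B type" "nf \<Gamma> b' b B"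
  shows "nf \<Gamma> (Ann (Plus A B) (In2 b')) (In2 b) (Plus A B)"
proof -
  note AB = type_inversion(3)[OF assms(2)]
  have "\<Gamma> \<turnstile> In2 b' \<Ztypecolon> Plus A B" using AB nf_tm[OF assms(3)] by (intro tm_In2) auto
  moreover have "\<Gamma> \<turnstile> In2 b' \<doteq> In2 b \<Ztypecolon> Plus A B" using AB nf_eq[OF assms(3)] by (intro cong_In2) auto
  ultimately show ?thesis
    using Ann_eq[OF assms(1,2)] nf_tm[OF assms(3)] by (auto simp: nf_def good_def Ann_inject intro: tmeq_trans)
qed

lemma nf_eta:
  assumes "nf \<Gamma> p p (Sig A B)" "\<Gamma> \<turnstile> Pr (P1 p) (P2 p) \<doteq> t \<Ztypecolon> Sig A B"
  shows "nf \<Gamma> p t (Sig A B)"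
  using assms tmeq_trans[OF eta_Sig[OF nf_tm[OF assms(1)]]] by (auto simp: nf_def)

lemma nf_Lam:
  assumes "tnf \<Gamma> A' A" "nf (A' # \<Gamma>) b' b B"
  shows "nf \<Gamma> (Lam A' b') (Lam A b) (Pi A' B)"
  using assms nf_tm[OF assms(2)]
  by (auto simp: nf_def good_def tnf_def Ann_def intro: tm_Lam cong_Lam)

lemma nf_Asc:
  assumes "ctx \<Gamma>" "tnf \<Gamma> S' S" "nf \<Gamma> a' a S'"
  shows "nf \<Gamma> a' (App (Lam S (Var 0)) a) S'"
proof -
  have S: "\<Gamma> \<turnstile> S' type" using assms(2) by (rule tnf_type)
  then have v: "S' # \<Gamma> \<turnstile> Var 0 \<Ztypecolon> wk S'" using assms(1) by (intro Var_0 ctx_cons)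
  have "\<Gamma> \<turnstile> Lam S' (Var 0) \<doteq> Lam S (Var 0) \<Ztypecolon> Pi S' (wk S')"
    using S v assms(2) by (intro cong_Lam tmeq_refl) (auto simp: tnf_def)
  from cong_App[OF this nf_eq[OF assms(3)]]
  have "\<Gamma> \<turnstile> Ann S' a' \<doteq> App (Lam S (Var 0)) a \<Ztypecolon> S'" by (simp add: inst_wk Ann_def)
  with Ann_eq(1)[OF assms(1) S nf_tm[OF assms(3)]]
  have "\<Gamma> \<turnstile> a' \<doteq> App (Lam S (Var 0)) a \<Ztypecolon> S'" by (blast intro: tmeq_sym tmeq_trans)
  then show ?thesis using assms(3) by (simp add: nf_def)
qed

lemma App_eq:
  assumes "nf \<Gamma> f' f (Pi A B)" "nf \<Gamma> a' a A" "tnf \<Gamma> T (inst B a')"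
  shows "\<Gamma> \<turnstile> App f' a' \<doteq> App f a \<Ztypecolon> T" "\<Gamma> \<turnstile> App f' a' \<Ztypecolon> T"
  using assms by (blast intro: tnf_conv cong_App tm_App nf_eq nf_tm)+

lemma nf_App:
  assumes "nf \<Gamma> f' f (Pi A B)" "nf \<Gamma> a' a A" "tnf \<Gamma> T (inst B a')" "dest_Lam f' = None"
  shows "nf \<Gamma> (App f' a') (App f a) T"
  using App_eq[OF assms(1-3)] assms(4) by (intro nf_inertI inertI) (auto simp: Ann_def dest_Lam_def)

text \<open>\<open>good\<close> supplies the typing of the body over the very domain and codomain of
  the inferred product. The contractum enters through its own check, the last assumption, and
  \<open>beta_Pi\<close> links it to the application.\<close>

lemma nf_beta:
  assumes "\<Gamma> \<turnstile> Pi A B type" "nf \<Gamma> (Lam A1 b) f (Pi A B)" "nf \<Gamma> a' a A" "tnf \<Gamma> T (inst B a')"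
    "nf \<Gamma> t' (inst b a') T"
  shows "nf \<Gamma> t' (App f a) T"
proof -
  have "A1 = A" and b: "A # \<Gamma> \<turnstile> b \<Ztypecolon> B" using assms(2) by (auto simp: nf_def good_def)
  have "\<Gamma> \<turnstile> App (Lam A b) a' \<doteq> inst b a' \<Ztypecolon> T"
    using type_inversion(1)[OF assms(1)] b nf_tm[OF assms(3)] tnf_conv(2)[OF assms(4)] beta_Pi by blast
  then show ?thesis
    using App_eq(1)[OF assms(2-4)] assms(5) \<open>A1 = A\<close> by (blast intro: tmeq_trans tmeq_sym nf_transfer)
qed

lemma nf_P1:
  assumes "nf \<Gamma> p' p (Sig A B)"
  shows "nf \<Gamma> (P1 p') (P1 p) A"
  using assms by (intro nf_inertI inertI) (auto simp: Ann_def intro: tm_P1 cong_P1 nf_tm nf_eq)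

lemma Ann_Pr_eq:
  assumes "ctx \<Gamma>" "\<Gamma> \<turnstile> Sig A B type" "nf \<Gamma> (Ann S (Pr a b)) p (Sig A B)"
  shows "\<Gamma> \<turnstile> Ann S (Pr a b) \<doteq> Pr a b \<Ztypecolon> Sig A B" "\<Gamma> \<turnstile> a \<Ztypecolon> A" "\<Gamma> \<turnstile> b \<Ztypecolon> inst B a"
proof -
  have S: "S = Sig A B" and ab: "\<Gamma> \<turnstile> a \<Ztypecolon> A" "\<Gamma> \<turnstile> b \<Ztypecolon> inst B a"
    using assms(3) by (auto simp: nf_def good_def Ann_inject)
  then show "\<Gamma> \<turnstile> a \<Ztypecolon> A" "\<Gamma> \<turnstile> b \<Ztypecolon> inst B a" by auto
  show "\<Gamma> \<turnstile> Ann S (Pr a b) \<doteq> Pr a b \<Ztypecolon> Sig A B"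
    using type_inversion(2)[OF assms(2)] ab S Ann_eq(1)[OF assms(1,2)] tm_Pr by blast
qed

lemma nf_P1_Pr:
  assumes "ctx \<Gamma>" "\<Gamma> \<turnstile> Sig A B type" "nf \<Gamma> (Ann S (Pr a b)) p (Sig A B)" "nf \<Gamma> t a A"
  shows "nf \<Gamma> t (P1 p) A"
proof -
  note AB = type_inversion(2)[OF assms(2)] and e = Ann_Pr_eq[OF assms(1-3)]
  have "\<Gamma> \<turnstile> Pr a b \<doteq> p \<Ztypecolon> Sig A B" using e(1) nf_eq[OF assms(3)] by (blast intro: tmeq_sym tmeq_trans)
  then have "\<Gamma> \<turnstile> P1 (Pr a b) \<doteq> P1 p \<Ztypecolon> A" by (rule cong_P1)
  then have "\<Gamma> \<turnstile> a \<doteq> P1 p \<Ztypecolon> A" using beta_P1[OF _ _ e(2,3)] AB by (blast intro: tmeq_sym tmeq_trans)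
  then show ?thesis using assms(4) by (rule nf_transfer)
qed

lemma nf_P2:
  assumes "nf \<Gamma> p' p (Sig A B)" "tnf \<Gamma> T (inst B (P1 p'))"
  shows "nf \<Gamma> (P2 p') (P2 p) T"
  using assms by (intro nf_inertI inertI) (auto simp: Ann_def intro: tnf_conv tm_P2 cong_P2 nf_tm nf_eq)

text \<open>\<open>T\<close> is a common normal form of \<open>B\<close> instantiated at the
  projection and at the first component. Therefore the computation rule, stated at the latter type,
  can be used at the former.\<close>

lemma nf_P2_Pr:
  assumes "ctx \<Gamma>" "\<Gamma> \<turnstile> Sig A B type" "nf \<Gamma> (Ann S (Pr a b)) p (Sig A B)"
    "tnf \<Gamma> T (inst B (P1 (Ann S (Pr a b))))" "tnf \<Gamma> T (inst B a)" "nf \<Gamma> t b T"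
  shows "nf \<Gamma> t (P2 p) T"
proof -
  note AB = type_inversion(2)[OF assms(2)] and e = Ann_Pr_eq[OF assms(1-3)]
  have "\<Gamma> \<turnstile> P2 (Ann S (Pr a b)) \<doteq> P2 (Pr a b) \<Ztypecolon> T" "\<Gamma> \<turnstile> P2 (Ann S (Pr a b)) \<doteq> P2 p \<Ztypecolon> T"
    using cong_P2[OF e(1)] cong_P2[OF nf_eq[OF assms(3)]] tnf_conv(2)[OF assms(4)] by auto
  moreover have "\<Gamma> \<turnstile> P2 (Pr a b) \<doteq> b \<Ztypecolon> T"
    using beta_P2[OF _ _ e(2,3)] AB tnf_conv(2)[OF assms(5)] by auto
  ultimately have "\<Gamma> \<turnstile> b \<doteq> P2 p \<Ztypecolon> T" by (blast intro: tmeq_sym tmeq_trans)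
  then show ?thesis using assms(6) by (rule nf_transfer)
qed

text \<open>The third conclusion exchanges the scrutinee for an equal one with the same normal
  result type. It removes the ascription from an injection, so that \<open>beta_In1\<close> and
  \<open>beta_In2\<close> apply.\<close>

lemma Case_eq:
  assumes "nf \<Gamma> s' s (Plus A B)" "tnf (Plus A B # \<Gamma>) C' C"
    "tnf (A # \<Gamma>) L (sub (In1 (Var 0) \<rhd> (\<lambda>n. Var (Suc n))) C')" "nf (A # \<Gamma>) l' l L"
    "tnf (B # \<Gamma>) R (sub (In2 (Var 0) \<rhd> (\<lambda>n. Var (Suc n))) C')" "nf (B # \<Gamma>) r' r R"
    "tnf \<Gamma> T (inst C' s')"
  shows "\<Gamma> \<turnstile> Case C' l' r' s' \<doteq> Case C l r s \<Ztypecolon> T" "\<Gamma> \<turnstile> Case C' l' r' s' \<Ztypecolon> T"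
    "\<Gamma> \<turnstile> v \<doteq> s' \<Ztypecolon> Plus A B \<Longrightarrow> tnf \<Gamma> T (inst C' v) \<Longrightarrow> \<Gamma> \<turnstile> Case C' l' r' v \<doteq> Case C' l' r' s' \<Ztypecolon> T"
proof -
  have C: "Plus A B # \<Gamma> \<turnstile> C' \<doteq> C type" "Plus A B # \<Gamma> \<turnstile> C' type" using assms(2) by (auto simp: tnf_def)
  have l: "A # \<Gamma> \<turnstile> l' \<Ztypecolon> sub (In1 (Var 0) \<rhd> (\<lambda>n. Var (Suc n))) C'"
    "A # \<Gamma> \<turnstile> l' \<doteq> l \<Ztypecolon> sub (In1 (Var 0) \<rhd> (\<lambda>n. Var (Suc n))) C'"
    using tnf_conv[OF assms(3)] assms(4) nf_tm nf_eq by blast+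
  have r: "B # \<Gamma> \<turnstile> r' \<Ztypecolon> sub (In2 (Var 0) \<rhd> (\<lambda>n. Var (Suc n))) C'"
    "B # \<Gamma> \<turnstile> r' \<doteq> r \<Ztypecolon> sub (In2 (Var 0) \<rhd> (\<lambda>n. Var (Suc n))) C'"
    using tnf_conv[OF assms(5)] assms(6) nf_tm nf_eq by blast+
  show "\<Gamma> \<turnstile> Case C' l' r' s' \<doteq> Case C l r s \<Ztypecolon> T"
    using cong_Case[OF C(1) l(2) r(2) nf_eq[OF assms(1)]] tnf_conv(2)[OF assms(7)] by blast
  show "\<Gamma> \<turnstile> Case C' l' r' s' \<Ztypecolon> T"
    using tm_Case[OF C(2) l(1) r(1) nf_tm[OF assms(1)]] tnf_conv(1)[OF assms(7)] by blast
  show "\<Gamma> \<turnstile> Case C' l' r' v \<doteq> Case C' l' r' s' \<Ztypecolon> T"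
    if "\<Gamma> \<turnstile> v \<doteq> s' \<Ztypecolon> Plus A B" "tnf \<Gamma> T (inst C' v)"
    using cong_Case[OF tyeq_refl[OF C(2)] tmeq_refl[OF l(1)] tmeq_refl[OF r(1)] that(1)] tnf_conv(2)[OF that(2)]
    by blast
qed

lemma nf_Case:
  assumes "nf \<Gamma> s' s (Plus A B)" "tnf (Plus A B # \<Gamma>) C' C"
    "tnf (A # \<Gamma>) L (sub (In1 (Var 0) \<rhd> (\<lambda>n. Var (Suc n))) C')" "nf (A # \<Gamma>) l' l L"
    "tnf (B # \<Gamma>) R (sub (In2 (Var 0) \<rhd> (\<lambda>n. Var (Suc n))) C')" "nf (B # \<Gamma>) r' r R"
    "tnf \<Gamma> T (inst C' s')"
  shows "nf \<Gamma> (Case C' l' r' s') (Case C l r s) T"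
  using Case_eq(1,2)[OF assms] by (intro nf_inertI inertI) (auto simp: Ann_def)

lemma nf_Case_In1:
  assumes "ctx \<Gamma>" "\<Gamma> \<turnstile> Plus A B type"
  and *: "nf \<Gamma> (Ann S (In1 a)) s (Plus A B)" "tnf (Plus A B # \<Gamma>) C' C"
    "tnf (A # \<Gamma>) L (sub (In1 (Var 0) \<rhd> (\<lambda>n. Var (Suc n))) C')" "nf (A # \<Gamma>) l' l L"
    "tnf (B # \<Gamma>) R (sub (In2 (Var 0) \<rhd> (\<lambda>n. Var (Suc n))) C')" "nf (B # \<Gamma>) r' r R"
    "tnf \<Gamma> T (inst C' (Ann S (In1 a)))"
  and T: "tnf \<Gamma> T (inst C' (In1 a))" and t: "nf \<Gamma> t (inst l' a) T"
  shows "nf \<Gamma> t (Case C l r s) T"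
proof -
  have S: "S = Plus A B" and a: "\<Gamma> \<turnstile> a \<Ztypecolon> A" using *(1) by (auto simp: nf_def good_def Ann_inject)
  have "\<Gamma> \<turnstile> In1 a \<Ztypecolon> Plus A B" using a type_inversion(3)[OF assms(2)] by (intro tm_In1) auto
  then have "\<Gamma> \<turnstile> In1 a \<doteq> Ann S (In1 a) \<Ztypecolon> Plus A B" using Ann_eq(1)[OF assms(1,2)] S by (blast intro: tmeq_sym)
  with Case_eq[OF *] T have 1: "\<Gamma> \<turnstile> Case C' l' r' (In1 a) \<doteq> Case C l r s \<Ztypecolon> T"
    by (blast intro: tmeq_trans)
  have "\<Gamma> \<turnstile> Case C' l' r' (In1 a) \<doteq> inst l' a \<Ztypecolon> inst C' (In1 a)"
    using a *(2) tnf_conv(3)[OF *(3) nf_tm[OF *(4)]] tnf_conv(3)[OF *(5) nf_tm[OF *(6)]]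
    by (intro beta_In1) (auto simp: tnf_def)
  with 1 have "\<Gamma> \<turnstile> inst l' a \<doteq> Case C l r s \<Ztypecolon> T" using tnf_conv(2)[OF T] by (blast intro: tmeq_trans tmeq_sym)
  then show ?thesis using t by (rule nf_transfer)
qed

lemma nf_Case_In2:
  assumes "ctx \<Gamma>" "\<Gamma> \<turnstile> Plus A B type"
  and *: "nf \<Gamma> (Ann S (In2 a)) s (Plus A B)" "tnf (Plus A B # \<Gamma>) C' C"
    "tnf (A # \<Gamma>) L (sub (In1 (Var 0) \<rhd> (\<lambda>n. Var (Suc n))) C')" "nf (A # \<Gamma>) l' l L"
    "tnf (B # \<Gamma>) R (sub (In2 (Var 0) \<rhd> (\<lambda>n. Var (Suc n))) C')" "nf (B # \<Gamma>) r' r R"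
    "tnf \<Gamma> T (inst C' (Ann S (In2 a)))"
  and T: "tnf \<Gamma> T (inst C' (In2 a))" and t: "nf \<Gamma> t (inst r' a) T"
  shows "nf \<Gamma> t (Case C l r s) T"
proof -
  have S: "S = Plus A B" and a: "\<Gamma> \<turnstile> a \<Ztypecolon> B" using *(1) by (auto simp: nf_def good_def Ann_inject)
  have "\<Gamma> \<turnstile> In2 a \<Ztypecolon> Plus A B" using a type_inversion(3)[OF assms(2)] by (intro tm_In2) auto
  then have "\<Gamma> \<turnstile> In2 a \<doteq> Ann S (In2 a) \<Ztypecolon> Plus A B" using Ann_eq(1)[OF assms(1,2)] S by (blast intro: tmeq_sym)
  with Case_eq[OF *] T have 1: "\<Gamma> \<turnstile> Case C' l' r' (In2 a) \<doteq> Case C l r s \<Ztypecolon> T"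
    by (blast intro: tmeq_trans)
  have "\<Gamma> \<turnstile> Case C' l' r' (In2 a) \<doteq> inst r' a \<Ztypecolon> inst C' (In2 a)"
    using a *(2) tnf_conv(3)[OF *(3) nf_tm[OF *(4)]] tnf_conv(3)[OF *(5) nf_tm[OF *(6)]]
    by (intro beta_In2) (auto simp: tnf_def)
  with 1 have "\<Gamma> \<turnstile> inst r' a \<doteq> Case C l r s \<Ztypecolon> T" using tnf_conv(2)[OF T] by (blast intro: tmeq_trans tmeq_sym)
  then show ?thesis using t by (rule nf_transfer)
qed

lemma nf_Efq:
  assumes "nf \<Gamma> t' t Empty" "tnf (Empty # \<Gamma>) C' C" "tnf \<Gamma> T (inst C' t')"
  shows "nf \<Gamma> (Efq C' t') (Efq C t) T"
  using assms(2) nf_eq[OF assms(1)] nf_tm[OF assms(1)]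
  by (intro nf_inertI inertI) (auto simp: Ann_def tnf_def intro!: tnf_conv(1,2)[OF assms(3)] tm_Efq cong_Efq)

lemma UnitRec_eq:
  assumes "nf \<Gamma> t' t Unit" "tnf (Unit # \<Gamma>) C' C" "tnf \<Gamma> D (inst C' Star)" "nf \<Gamma> c' c D" "tnf \<Gamma> T (inst C' t')"
  shows "\<Gamma> \<turnstile> UnitRec C' c' t' \<doteq> UnitRec C c t \<Ztypecolon> T" "\<Gamma> \<turnstile> UnitRec C' c' t' \<Ztypecolon> T"
  using assms(2) nf_eq[OF assms(1)] nf_tm[OF assms(1)]
    tnf_conv(3)[OF assms(3) nf_tm[OF assms(4)]] tnf_conv(4)[OF assms(3) nf_eq[OF assms(4)]]
  by (auto simp: tnf_def intro!: tnf_conv(1,2)[OF assms(5)] tm_UnitRec cong_UnitRec)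

lemma nf_UnitRec:
  assumes "nf \<Gamma> t' t Unit" "tnf (Unit # \<Gamma>) C' C" "tnf \<Gamma> D (inst C' Star)" "nf \<Gamma> c' c D" "tnf \<Gamma> T (inst C' t')"
  shows "nf \<Gamma> (UnitRec C' c' t') (UnitRec C c t) T"
  using UnitRec_eq[OF assms] by (intro nf_inertI inertI) (auto simp: Ann_def)

lemma nf_UnitRec_Star:
  assumes "nf \<Gamma> Star t Unit" "tnf (Unit # \<Gamma>) C' C" "tnf \<Gamma> D (inst C' Star)" "nf \<Gamma> c' c D"
  shows "nf \<Gamma> c' (UnitRec C c t) D"
proof -
  have "\<Gamma> \<turnstile> UnitRec C' c' Star \<doteq> c' \<Ztypecolon> inst C' Star"
    using assms(2) tnf_conv(3)[OF assms(3) nf_tm[OF assms(4)]] by (intro beta_Star) (auto simp: tnf_def)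
  then have "\<Gamma> \<turnstile> c' \<doteq> UnitRec C c t \<Ztypecolon> D"
    using UnitRec_eq(1)[OF assms(1-4,3)] tnf_conv(2)[OF assms(3)] by (blast intro: tmeq_trans tmeq_sym)
  then show ?thesis using assms(4) by (simp add: nf_def)
qed

lemma NatRec_eq:
  assumes "nf \<Gamma> n' n Nat" "tnf (Nat # \<Gamma>) C' C" "tnf \<Gamma> D (inst C' Zero)" "nf \<Gamma> z' z D"
    "tnf (C' # Nat # \<Gamma>) S (sub (Succ (Var 1) \<rhd> (\<lambda>n. Var (Suc (Suc n)))) C')" "nf (C' # Nat # \<Gamma>) s' s S"
    "tnf \<Gamma> T (inst C' n')"
  shows "\<Gamma> \<turnstile> NatRec C' z' s' n' \<doteq> NatRec C z s n \<Ztypecolon> T" "\<Gamma> \<turnstile> NatRec C' z' s' n' \<Ztypecolon> T"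
  using assms(2) nf_eq[OF assms(1)] nf_tm[OF assms(1)]
    tnf_conv(3)[OF assms(3) nf_tm[OF assms(4)]] tnf_conv(4)[OF assms(3) nf_eq[OF assms(4)]]
    tnf_conv(3)[OF assms(5) nf_tm[OF assms(6)]] tnf_conv(4)[OF assms(5) nf_eq[OF assms(6)]]
  by (auto simp: tnf_def intro!: tnf_conv(1,2)[OF assms(7)] tm_NatRec cong_NatRec)

lemma nf_NatRec:
  assumes "nf \<Gamma> n' n Nat" "tnf (Nat # \<Gamma>) C' C" "tnf \<Gamma> D (inst C' Zero)" "nf \<Gamma> z' z D"
    "tnf (C' # Nat # \<Gamma>) S (sub (Succ (Var 1) \<rhd> (\<lambda>n. Var (Suc (Suc n)))) C')" "nf (C' # Nat # \<Gamma>) s' s S"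
    "tnf \<Gamma> T (inst C' n')"
  shows "nf \<Gamma> (NatRec C' z' s' n') (NatRec C z s n) T"
  using NatRec_eq[OF assms] by (intro nf_inertI inertI) (auto simp: Ann_def)

lemma nf_NatRec_Zero:
  assumes "nf \<Gamma> Zero n Nat" "tnf (Nat # \<Gamma>) C' C" "tnf \<Gamma> D (inst C' Zero)" "nf \<Gamma> z' z D"
    "tnf (C' # Nat # \<Gamma>) S (sub (Succ (Var 1) \<rhd> (\<lambda>n. Var (Suc (Suc n)))) C')" "nf (C' # Nat # \<Gamma>) s' s S"
  shows "nf \<Gamma> z' (NatRec C z s n) D"
proof -
  have "\<Gamma> \<turnstile> NatRec C' z' s' Zero \<doteq> z' \<Ztypecolon> inst C' Zero"
    using assms(2) tnf_conv(3)[OF assms(3) nf_tm[OF assms(4)]] tnf_conv(3)[OF assms(5) nf_tm[OF assms(6)]]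
    by (intro beta_Zero) (auto simp: tnf_def)
  then have "\<Gamma> \<turnstile> z' \<doteq> NatRec C z s n \<Ztypecolon> D"
    using NatRec_eq(1)[OF assms(1-6,3)] tnf_conv(2)[OF assms(3)] by (blast intro: tmeq_trans tmeq_sym)
  then show ?thesis using assms(4) by (simp add: nf_def)
qed

lemma nf_NatRec_Succ:
  assumes "nf \<Gamma> (Succ m) n Nat" "tnf (Nat # \<Gamma>) C' C" "tnf \<Gamma> D (inst C' Zero)" "nf \<Gamma> z' z D"
    "tnf (C' # Nat # \<Gamma>) S (sub (Succ (Var 1) \<rhd> (\<lambda>n. Var (Suc (Suc n)))) C')" "nf (C' # Nat # \<Gamma>) s' s S"
    "tnf \<Gamma> T (inst C' (Succ m))" "nf \<Gamma> t (inst2 s' m (NatRec C' z' s' m)) T"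
  shows "nf \<Gamma> t (NatRec C z s n) T"
proof -
  have "\<Gamma> \<turnstile> m \<Ztypecolon> Nat" using assms(1) by (simp add: nf_def good_def)
  then have "\<Gamma> \<turnstile> NatRec C' z' s' (Succ m) \<doteq> inst2 s' m (NatRec C' z' s' m) \<Ztypecolon> inst C' (Succ m)"
    using assms(2) tnf_conv(3)[OF assms(3) nf_tm[OF assms(4)]] tnf_conv(3)[OF assms(5) nf_tm[OF assms(6)]]
    by (intro beta_Succ) (auto simp: tnf_def)
  then have "\<Gamma> \<turnstile> inst2 s' m (NatRec C' z' s' m) \<doteq> NatRec C z s n \<Ztypecolon> T"
    using NatRec_eq(1)[OF assms(1-7)] tnf_conv(2)[OF assms(7)] by (blast intro: tmeq_trans tmeq_sym)
  then show ?thesis using assms(8) by (rule nf_transfer)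
qed

lemma nf_Refl:
  assumes "nf \<Gamma> a' a A"
  shows "nf \<Gamma> (Refl a') (Refl a) (Eq A a' a')"
  using assms by (auto simp: nf_def good_def Ann_def intro: tm_Refl cong_Refl)

lemma J_eq:
  assumes "\<Gamma> \<turnstile> Eq A a b type" "nf \<Gamma> p' p (Eq A a b)" "tnf (JCtx A a \<Gamma>) C' C"
    "tnf \<Gamma> D (inst2 C' a (Refl a))" "nf \<Gamma> d' d D" "tnf \<Gamma> T (inst2 C' b p')"
  shows "\<Gamma> \<turnstile> J C' d' p' \<doteq> J C d p \<Ztypecolon> T" "\<Gamma> \<turnstile> J C' d' p' \<Ztypecolon> T"
proof -
  note ab = type_inversion(4)[OF assms(1)]
  have C: "JCtx A a \<Gamma> \<turnstile> C' \<doteq> C type" "JCtx A a \<Gamma> \<turnstile> C' type" using assms(3) by (auto simp: tnf_def)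
  show "\<Gamma> \<turnstile> J C' d' p' \<doteq> J C d p \<Ztypecolon> T"
    using ab by (intro tnf_conv(2)[OF assms(6)]
        cong_J[OF _ C(1) tnf_conv(4)[OF assms(4) nf_eq[OF assms(5)]] _ nf_eq[OF assms(2)]]) auto
  show "\<Gamma> \<turnstile> J C' d' p' \<Ztypecolon> T"
    using ab by (intro tnf_conv(1)[OF assms(6)]
        tm_J[OF _ C(2) tnf_conv(3)[OF assms(4) nf_tm[OF assms(5)]] _ nf_tm[OF assms(2)]]) auto
qed

lemma nf_J:
  assumes "\<Gamma> \<turnstile> Eq A a b type" "nf \<Gamma> p' p (Eq A a b)" "tnf (JCtx A a \<Gamma>) C' C"
    "tnf \<Gamma> D (inst2 C' a (Refl a))" "nf \<Gamma> d' d D" "tnf \<Gamma> T (inst2 C' b p')"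
  shows "nf \<Gamma> (J C' d' p') (J C d p) T"
  using J_eq[OF assms] by (intro nf_inertI inertI) (auto simp: Ann_def)

lemma nf_J_Refl:
  assumes "\<Gamma> \<turnstile> Eq A a b type" "nf \<Gamma> (Refl c) p (Eq A a b)" "tnf (JCtx A a \<Gamma>) C' C"
    "tnf \<Gamma> D (inst2 C' a (Refl a))" "nf \<Gamma> d' d D"
  shows "nf \<Gamma> d' (J C d p) D"
proof -
  \<comment> \<open>Both equations come from the clause of \<open>good\<close> for reflexivity,
    which forces the type to be literally \<open>Eq A c c\<close>.\<close>
  have [simp]: "b = a" "c = a" using assms(2) by (auto simp: nf_def good_def)
  have "\<Gamma> \<turnstile> J C' d' (Refl a) \<doteq> d' \<Ztypecolon> inst2 C' a (Refl a)"
    using type_inversion(4)[OF assms(1)] assms(3) tnf_conv(3)[OF assms(4) nf_tm[OF assms(5)]]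
    by (intro beta_Refl) (auto simp: tnf_def)
  then have "\<Gamma> \<turnstile> J C' d' (Refl a) \<doteq> d' \<Ztypecolon> D" by (rule tnf_conv(2)[OF assms(4)])
  moreover have "\<Gamma> \<turnstile> J C' d' (Refl a) \<doteq> J C d p \<Ztypecolon> D"
    using J_eq(1)[OF assms(1-5), of D] assms(4) by simp
  ultimately have "\<Gamma> \<turnstile> d' \<doteq> J C d p \<Ztypecolon> D" by (rule tmeq_trans[OF tmeq_sym])
  then show ?thesis using assms(5) by (simp add: nf_def)
qed

lemma nf_TrRec:
  assumes "tnf \<Gamma> B' B" "nf \<Gamma> t' t (Trunc A)" "tnf \<Gamma> H (IsProp B')" "nf \<Gamma> h' h H"
    "tnf \<Gamma> F (Arr A B')" "nf \<Gamma> f' f F"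
  shows "nf \<Gamma> (TrRec B' h' f' t') (TrRec B h f t) B'"
  using assms(1) nf_eq[OF assms(2)] nf_tm[OF assms(2)]
    tnf_conv(3)[OF assms(3) nf_tm[OF assms(4)]] tnf_conv(4)[OF assms(3) nf_eq[OF assms(4)]]
    tnf_conv(3)[OF assms(5) nf_tm[OF assms(6)]] tnf_conv(4)[OF assms(5) nf_eq[OF assms(6)]]
  by (intro nf_inertI inertI tm_TrRec cong_TrRec) (auto simp: tnf_def Ann_def)

lemma nf_FunExt:
  assumes "nf \<Gamma> f' f (Pi A B)" "nf \<Gamma> g' g (Pi A B)"
    "tnf \<Gamma> H (Pi A (Eq B (App (wk f') (Var 0)) (App (wk g') (Var 0))))" "nf \<Gamma> h' h H"
  shows "nf \<Gamma> (FunExt f' g' h') (FunExt f g h) (Eq (Pi A B) f' g')"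
  using nf_eq[OF assms(1)] nf_tm[OF assms(1)] nf_eq[OF assms(2)] nf_tm[OF assms(2)]
    tnf_conv(3)[OF assms(3) nf_tm[OF assms(4)]] tnf_conv(4)[OF assms(3) nf_eq[OF assms(4)]]
  by (intro nf_inertI inertI tm_FunExt cong_FunExt) (auto simp: tnf_def Ann_def)

lemma nf_PropExt:
  assumes "nf \<Gamma> P' P Univ" "nf \<Gamma> Q' Q Univ"
    "tnf \<Gamma> H\<^sub>1 (IsProp P')" "nf \<Gamma> hP' hP H\<^sub>1" "tnf \<Gamma> H\<^sub>2 (IsProp Q')" "nf \<Gamma> hQ' hQ H\<^sub>2"
    "tnf \<Gamma> F (Arr P' Q')" "nf \<Gamma> f' f F" "tnf \<Gamma> G (Arr Q' P')" "nf \<Gamma> g' g G"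
  shows "nf \<Gamma> (PropExt P' Q' hP' hQ' f' g') (PropExt P Q hP hQ f g) (Eq Univ P' Q')"
  using nf_eq[OF assms(1)] nf_tm[OF assms(1)] nf_eq[OF assms(2)] nf_tm[OF assms(2)]
    tnf_conv(3)[OF assms(3) nf_tm[OF assms(4)]] tnf_conv(4)[OF assms(3) nf_eq[OF assms(4)]]
    tnf_conv(3)[OF assms(5) nf_tm[OF assms(6)]] tnf_conv(4)[OF assms(5) nf_eq[OF assms(6)]]
    tnf_conv(3)[OF assms(7) nf_tm[OF assms(8)]] tnf_conv(4)[OF assms(7) nf_eq[OF assms(8)]]
    tnf_conv(3)[OF assms(9) nf_tm[OF assms(10)]] tnf_conv(4)[OF assms(9) nf_eq[OF assms(10)]]
  by (intro nf_inertI inertI tm_PropExt cong_PropExt) (auto simp: tnf_def Ann_def)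

lemma nf_formers:
  "nf \<Gamma> A' A Univ \<Longrightarrow> nf (A' # \<Gamma>) B' B Univ \<Longrightarrow> nf \<Gamma> (Pi A' B') (Pi A B) Univ"
  "nf \<Gamma> A' A Univ \<Longrightarrow> nf (A' # \<Gamma>) B' B Univ \<Longrightarrow> nf \<Gamma> (Sig A' B') (Sig A B) Univ"
  "nf \<Gamma> A' A Univ \<Longrightarrow> nf \<Gamma> B' B Univ \<Longrightarrow> nf \<Gamma> (Plus A' B') (Plus A B) Univ"
  "nf \<Gamma> A' A Univ \<Longrightarrow> nf \<Gamma> t' t A' \<Longrightarrow> nf \<Gamma> u' u A' \<Longrightarrow> nf \<Gamma> (Eq A' t' u') (Eq A t u) Univ"
  "nf \<Gamma> A' A Univ \<Longrightarrow> nf \<Gamma> (Trunc A') (Trunc A) Univ"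
  by (auto simp: nf_def good_def Ann_def
      intro: tm_Pi tm_Sig tm_Plus tm_Eq tm_Trunc cong_Pi cong_Sig cong_Plus cong_Eq cong_Trunc)

lemma tnf_formers:
  "tnf \<Gamma> A' A \<Longrightarrow> tnf (A' # \<Gamma>) B' B \<Longrightarrow> tnf \<Gamma> (Pi A' B') (Pi A B)"
  "tnf \<Gamma> A' A \<Longrightarrow> tnf (A' # \<Gamma>) B' B \<Longrightarrow> tnf \<Gamma> (Sig A' B') (Sig A B)"
  "tnf \<Gamma> A' A \<Longrightarrow> tnf \<Gamma> B' B \<Longrightarrow> tnf \<Gamma> (Plus A' B') (Plus A B)"
  "tnf \<Gamma> A' A \<Longrightarrow> nf \<Gamma> t' t A' \<Longrightarrow> nf \<Gamma> u' u A' \<Longrightarrow> tnf \<Gamma> (Eq A' t' u') (Eq A t u)"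
  "tnf \<Gamma> A' A \<Longrightarrow> tnf \<Gamma> (Trunc A') (Trunc A)"
  "ctx \<Gamma> \<Longrightarrow> tnf \<Gamma> Univ Univ"
  "nf \<Gamma> A' A Univ \<Longrightarrow> tnf \<Gamma> A' A"
  by (auto simp: tnf_def dest: nf_eq nf_tm intro: ty_Univ ty_El ty_Pi ty_Sig ty_Plus ty_Eq ty_Trunc
      tyeq_refl tyeq_El tyeq_Pi tyeq_Sig tyeq_Plus tyeq_Eq tyeq_Trunc)

lemma nf_Succ: "nf \<Gamma> n' n Nat \<Longrightarrow> nf \<Gamma> (Succ n') (Succ n) Nat"
  by (auto simp: nf_def good_def Ann_def intro: tm_Succ cong_Succ)

lemma nf_TrIn: "nf \<Gamma> a' a A \<Longrightarrow> nf \<Gamma> (TrIn a') (TrIn a) (Trunc A)"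
  by (auto simp: nf_def good_def Ann_def intro: tm_TrIn cong_TrIn)

lemma nf_TrEq: "nf \<Gamma> t' t (Trunc A) \<Longrightarrow> nf \<Gamma> u' u (Trunc A) \<Longrightarrow> nf \<Gamma> (TrEq t' u') (TrEq t u) (Eq (Trunc A) t' u')"
  by (auto simp: nf_def good_def Ann_def intro: tm_TrEq cong_TrEq)

lemma nf_atom: "\<Gamma> \<turnstile> t \<Ztypecolon> T \<Longrightarrow> inert t \<Longrightarrow> nf \<Gamma> t t T"
  by (intro nf_inertI tmeq_refl)

section \<open>The induction step on the fuel\<close>

context
  fixes k :: nat
  assumes infer_IH: "\<And>\<Gamma> t t' T. infer k \<Gamma> t = Some (t', T) \<Longrightarrow> ctx \<Gamma> \<Longrightarrow> nf \<Gamma> t' t T \<and> \<Gamma> \<turnstile> T type"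
    and check_IH: "\<And>\<Gamma> t t' T. check k \<Gamma> t T = Some t' \<Longrightarrow> ctx \<Gamma> \<Longrightarrow> \<Gamma> \<turnstile> T type \<Longrightarrow> nf \<Gamma> t' t T"
    and norm_ty_IH: "\<And>\<Gamma> A A'. norm_ty k \<Gamma> A = Some A' \<Longrightarrow> ctx \<Gamma> \<Longrightarrow> tnf \<Gamma> A' A"
begin

lemma infer_nf: "infer k \<Gamma> t = Some (t', T) \<Longrightarrow> ctx \<Gamma> \<Longrightarrow> nf \<Gamma> t' t T"
  and infer_type: "infer k \<Gamma> t = Some (t', T) \<Longrightarrow> ctx \<Gamma> \<Longrightarrow> \<Gamma> \<turnstile> T type"
  using infer_IH by blast+

lemma norm_ty_type: "norm_ty k \<Gamma> A = Some A' \<Longrightarrow> ctx \<Gamma> \<Longrightarrow> \<Gamma> \<turnstile> A' type"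
  using norm_ty_IH tnf_type by blast

lemma check_Univ: "check k \<Gamma> A Univ = Some A' \<Longrightarrow> ctx \<Gamma> \<Longrightarrow> nf \<Gamma> A' A Univ"
  using check_IH ty_Univ by blast

lemma check_Univ_type: "check k \<Gamma> A Univ = Some A' \<Longrightarrow> ctx \<Gamma> \<Longrightarrow> \<Gamma> \<turnstile> A' type"
  using check_Univ nf_tm ty_El by blast

lemma infer_components:
  "infer k \<Gamma> t = Some (t', Pi A B) \<Longrightarrow> ctx \<Gamma> \<Longrightarrow> \<Gamma> \<turnstile> A type"
  "infer k \<Gamma> t = Some (t', Sig A B) \<Longrightarrow> ctx \<Gamma> \<Longrightarrow> \<Gamma> \<turnstile> A type"
  "infer k \<Gamma> t = Some (t', Plus A B) \<Longrightarrow> ctx \<Gamma> \<Longrightarrow> \<Gamma> \<turnstile> A type"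
  "infer k \<Gamma> t = Some (t', Plus A B) \<Longrightarrow> ctx \<Gamma> \<Longrightarrow> \<Gamma> \<turnstile> B type"
  "infer k \<Gamma> t = Some (t', Eq A a b) \<Longrightarrow> ctx \<Gamma> \<Longrightarrow> \<Gamma> \<turnstile> A type"
  "infer k \<Gamma> t = Some (t', Eq A a b) \<Longrightarrow> ctx \<Gamma> \<Longrightarrow> \<Gamma> \<turnstile> a \<Ztypecolon> A"
  by (blast dest: infer_type type_inversion)+

lemmas IH = infer_nf infer_type check_IH norm_ty_IH norm_ty_type check_Univ check_Univ_type
  small_types infer_components
  ctx_cons JCtx_ctx ty_Univ

lemma check_sound:
  assumes "check (Suc k) \<Gamma> t T = Some t'" "ctx \<Gamma>" "\<Gamma> \<turnstile> T type"
  shows "nf \<Gamma> t' t T"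
proof (cases "view t")
  case (VLam A b)
  then have t: "t = Lam A b" by (auto simp: view_def split: tm.splits)
  obtain A' B b' where *: "T = Pi A' B" "norm_ty k \<Gamma> A = Some A'" "check k (A' # \<Gamma>) b B = Some b'" "t' = Lam A' b'"
    using assms(1) VLam by (auto simp: case_Some split: if_splits)
  moreover from this have "\<Gamma> \<turnstile> A' type" "A' # \<Gamma> \<turnstile> B type" using type_inversion(1) assms(3) by auto
  ultimately show ?thesis unfolding t using assms(2) by (blast intro: nf_Lam norm_ty_IH check_IH ctx_cons)
next
  case (VPr a b)
  then have t: "t = Pr a b" by (auto simp: view_def split: tm.splits)
  obtain A B a' B' b' where *: "T = Sig A B" "check k \<Gamma> a A = Some a'" "norm_ty k \<Gamma> (inst B a') = Some B'"
    "check k \<Gamma> b B' = Some b'"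
    "t' = Ann T (Pr a' b') \<or> (\<exists>p. a' = P1 p \<and> b' = P2 p \<and> infer k \<Gamma> p = Some (p, T) \<and> t' = p)"
    using assms(1) VPr by (auto simp: case_Some split: if_split_asm)
  have nf: "nf \<Gamma> a' a A" "tnf \<Gamma> B' (inst B a')" "nf \<Gamma> b' b B'"
    using * assms(2) type_inversion(2)[of \<Gamma> A B] assms(3) by (auto intro: check_IH norm_ty_IH norm_ty_type)
  show ?thesis using *(5)
  proof (elim disjE exE conjE)
    assume "t' = Ann T (Pr a' b')"
    then show ?thesis using nf_Pr(1)[OF assms(2) _ nf] assms(3) *(1) t by simp
  next
    fix p assume "a' = P1 p" "b' = P2 p" "infer k \<Gamma> p = Some (p, T)" "t' = p"
    then show ?thesis using nf_Pr(2)[OF assms(2) _ nf] assms(2,3) *(1) t by (auto intro: nf_eta infer_nf)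
  qed
next
  case (VIn1 a)
  then have t: "t = In1 a" by (auto simp: view_def split: tm.splits)
  obtain A B a' where *: "T = Plus A B" "check k \<Gamma> a A = Some a'" "t' = Ann T (In1 a')"
    using assms(1) VIn1 by (auto simp: case_Some)
  then show ?thesis unfolding t using assms(2,3) type_inversion(3)[of \<Gamma> A B] by (auto intro: nf_In1 check_IH)
next
  case (VIn2 b)
  then have t: "t = In2 b" by (auto simp: view_def split: tm.splits)
  obtain A B b' where *: "T = Plus A B" "check k \<Gamma> b B = Some b'" "t' = Ann T (In2 b')"
    using assms(1) VIn2 by (auto simp: case_Some)
  then show ?thesis unfolding t using assms(2,3) type_inversion(3)[of \<Gamma> A B] by (auto intro: nf_In2 check_IH)
next
  case (VRefl a)
  then have t: "t = Refl a" by (auto simp: view_def split: tm.splits)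
  obtain A a' where *: "T = Eq A a' a'" "check k \<Gamma> a A = Some a'" "t' = Refl a'"
    using assms(1) VRefl by (auto simp: case_Some split: if_splits)
  then show ?thesis unfolding t using assms(2,3) type_inversion(4)[of \<Gamma> A a' a'] by (auto intro: nf_Refl check_IH)
next
  case (VTrIn a)
  then have t: "t = TrIn a" by (auto simp: view_def split: tm.splits)
  obtain A a' where *: "T = Trunc A" "check k \<Gamma> a A = Some a'" "t' = TrIn a'"
    using assms(1) VTrIn by (auto simp: case_Some)
  then show ?thesis unfolding t using assms(2,3) type_inversion(5)[of \<Gamma> A] by (auto intro: nf_TrIn check_IH)
next
  case VOther
  then have "infer k \<Gamma> t = Some (t', T)"
    using assms(1) by (auto simp: case_Some split: if_splits)
  then show ?thesis using assms(2) by (rule infer_nf)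
qed

lemma norm_ty_sound:
  assumes "norm_ty (Suc k) \<Gamma> X = Some Y" "ctx \<Gamma>"
  shows "tnf \<Gamma> Y X"
  using assms by (cases X) (auto simp: tview_def case_Some intro!: tnf_formers(1-6) intro: tnf_formers(7) IH)

lemma infer_sound:
  assumes "infer (Suc k) \<Gamma> t = Some (t', T)" "ctx \<Gamma>"
  shows "nf \<Gamma> t' t T \<and> \<Gamma> \<turnstile> T type"
proof (cases t)
  case (Var n)
  then show ?thesis using assms
    by (auto simp: Ann_def split: if_splits intro!: nf_atom inertI simp del: add_Suc_right intro: tm_Var Var_type)
next
  case Univ
  then show ?thesis using assms by simp
next
  case (Pi A B)
  then show ?thesis using assms by (auto simp: case_Some intro!: nf_formers intro: IH)
next
  case (Lam A b)
  then show ?thesis using assms by (auto simp: case_Some intro!: nf_Lam ty_Pi intro: IH)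
next
  case (App f a)
  show ?thesis
  proof (cases "is_asc f")
    case (Some S)
    then obtain S' where "f = Lam S (Var 0)" "norm_ty k \<Gamma> S = Some S'" "check k \<Gamma> a S' = Some t'" "T = S'"
      using App assms(1) by (auto simp: case_Some simp del: is_asc_iff) simp
    then show ?thesis unfolding App using assms(2) by (blast intro: nf_Asc IH)
  next
    case None
    then obtain f' A B a' where *: "infer k \<Gamma> f = Some (f', Pi A B)" "check k \<Gamma> a A = Some a'"
      "norm_ty k \<Gamma> (inst B a') = Some T"
      "dest_Lam f' = None \<and> t' = App f' a' \<or> (\<exists>A1 b. f' = Lam A1 b \<and> check k \<Gamma> (inst b a') T = Some t')"
      using App assms(1) by (auto simp: case_Some)
    then show ?thesis unfolding App using assms(2) by (blast intro: nf_App nf_beta IH)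
  qed
next
  case (Sig A B)
  then show ?thesis using assms by (auto simp: case_Some intro!: nf_formers intro: IH)
next
  case (Pr a b)
  then show ?thesis using assms by simp
next
  case (P1 p)
  then obtain p' B where *: "infer k \<Gamma> p = Some (p', Sig T B)"
    "t' = P1 p' \<or> (\<exists>S a b. p' = Ann S (Pr a b) \<and> check k \<Gamma> a T = Some t')"
    using assms(1) by (auto simp: case_Some)
  then show ?thesis unfolding P1 using assms(2) by (blast intro: nf_P1 nf_P1_Pr IH)
next
  case (P2 p)
  then obtain p' A B where *: "infer k \<Gamma> p = Some (p', Sig A B)" "norm_ty k \<Gamma> (inst B (P1 p')) = Some T"
    "t' = P2 p' \<or> (\<exists>S a b. p' = Ann S (Pr a b) \<and> norm_ty k \<Gamma> (inst B a) = Some T \<and> check k \<Gamma> b T = Some t')"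
    using assms(1) by (auto simp: case_Some split: if_split_asm)
  then show ?thesis unfolding P2 using assms(2) by (blast intro: nf_P2 nf_P2_Pr IH)
next
  case (Plus A B)
  then show ?thesis using assms by (auto simp: case_Some intro!: nf_formers intro: IH)
next
  case (In1 a)
  then show ?thesis using assms by simp
next
  case (In2 a)
  then show ?thesis using assms by simp
next
  case (Case C l r s)
  then obtain s' A B C' L l' R r' where *: "infer k \<Gamma> s = Some (s', Plus A B)" "norm_ty k (Plus A B # \<Gamma>) C = Some C'"
    "norm_ty k (A # \<Gamma>) (sub (In1 (Var 0) \<rhd> (\<lambda>n. Var (Suc n))) C') = Some L" "check k (A # \<Gamma>) l L = Some l'"
    "norm_ty k (B # \<Gamma>) (sub (In2 (Var 0) \<rhd> (\<lambda>n. Var (Suc n))) C') = Some R" "check k (B # \<Gamma>) r R = Some r'"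
    "norm_ty k \<Gamma> (inst C' s') = Some T"
    "(\<exists>S a. s' = Ann S (In1 a) \<and> norm_ty k \<Gamma> (inst C' (In1 a)) = Some T \<and> check k \<Gamma> (inst l' a) T = Some t') \<or>
     (\<exists>S b. s' = Ann S (In2 b) \<and> norm_ty k \<Gamma> (inst C' (In2 b)) = Some T \<and> check k \<Gamma> (inst r' b) T = Some t') \<or>
     t' = Case C' l' r' s'"
    using assms(1) by (auto simp: case_Some split: if_split_asm)
  have **: "\<Gamma> \<turnstile> Plus A B type" "nf \<Gamma> s' s (Plus A B)" "tnf (Plus A B # \<Gamma>) C' C"
    "tnf (A # \<Gamma>) L (sub (In1 (Var 0) \<rhd> (\<lambda>n. Var (Suc n))) C')" "nf (A # \<Gamma>) l' l L"
    "tnf (B # \<Gamma>) R (sub (In2 (Var 0) \<rhd> (\<lambda>n. Var (Suc n))) C')" "nf (B # \<Gamma>) r' r R"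
    "tnf \<Gamma> T (inst C' s')"
    using *(1-7) assms(2) by (blast intro: IH)+
  then show ?thesis unfolding Case using *(8) assms(2)
    by (blast intro: nf_Case nf_Case_In1 nf_Case_In2 check_IH norm_ty_IH tnf_type)
next
  case Empty
  then show ?thesis using assms by (auto simp: Ann_def intro!: nf_atom inertI tm_Empty ty_Univ)
next
  case (Efq C u)
  then show ?thesis using assms by (auto simp: case_Some intro!: nf_Efq intro: IH)
next
  case Unit
  then show ?thesis using assms by (auto simp: Ann_def intro!: nf_atom inertI tm_Unit ty_Univ)
next
  case Star
  then show ?thesis using assms by (auto simp: Ann_def intro!: nf_atom inertI tm_Star small_types)
next
  case (UnitRec C c u)
  then obtain u' C' D c' where *: "check k \<Gamma> u Unit = Some u'" "norm_ty k (Unit # \<Gamma>) C = Some C'"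
    "norm_ty k \<Gamma> (inst C' Star) = Some D" "check k \<Gamma> c D = Some c'"
    "u' = Star \<and> t' = c' \<and> T = D \<or> norm_ty k \<Gamma> (inst C' u') = Some T \<and> t' = UnitRec C' c' u'"
    using assms(1) by (auto simp: case_Some split: if_splits)
  then show ?thesis unfolding UnitRec using assms(2) by (blast intro: nf_UnitRec nf_UnitRec_Star IH)
next
  case Nat
  then show ?thesis using assms by (auto simp: Ann_def intro!: nf_atom inertI tm_Nat ty_Univ)
next
  case Zero
  then show ?thesis using assms by (auto simp: Ann_def intro!: nf_atom inertI tm_Zero small_types)
next
  case (Succ n)
  then show ?thesis using assms by (auto simp: case_Some intro!: nf_Succ intro: IH)
next
  case (NatRec C z s n)
  then obtain n' C' D z' S s' where *: "check k \<Gamma> n Nat = Some n'" "norm_ty k (Nat # \<Gamma>) C = Some C'"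
    "norm_ty k \<Gamma> (inst C' Zero) = Some D" "check k \<Gamma> z D = Some z'"
    "norm_ty k (C' # Nat # \<Gamma>) (sub (Succ (Var 1) \<rhd> (\<lambda>n. Var (Suc (Suc n)))) C') = Some S"
    "check k (C' # Nat # \<Gamma>) s S = Some s'"
    "n' = Zero \<and> t' = z' \<and> T = D \<or> norm_ty k \<Gamma> (inst C' n') = Some T \<and>
       (t' = NatRec C' z' s' n' \<or>
        (\<exists>m. n' = Succ m \<and> check k \<Gamma> (inst2 s' m (NatRec C' z' s' m)) T = Some t'))"
    using assms(1) by (auto simp: case_Some split: if_split_asm)
  have **: "nf \<Gamma> n' n Nat" "tnf (Nat # \<Gamma>) C' C" "tnf \<Gamma> D (inst C' Zero)" "nf \<Gamma> z' z D"
    "tnf (C' # Nat # \<Gamma>) S (sub (Succ (Var 1) \<rhd> (\<lambda>n. Var (Suc (Suc n)))) C')" "nf (C' # Nat # \<Gamma>) s' s S"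
    using *(1-6) assms(2) by (blast intro: IH)+
  then show ?thesis unfolding NatRec using *(7) assms(2)
    by (blast intro: nf_NatRec nf_NatRec_Zero nf_NatRec_Succ check_IH norm_ty_IH tnf_type)
next
  case (Eq A u v)
  then show ?thesis using assms by (auto simp: case_Some intro!: nf_formers intro: IH)
next
  case (Refl a)
  then show ?thesis using assms by (auto simp: case_Some intro!: nf_Refl ty_Eq intro: IH nf_tm)
next
  case (J C d p)
  then obtain p' A a b C' D d' where *: "infer k \<Gamma> p = Some (p', Eq A a b)" "norm_ty k (JCtx A a \<Gamma>) C = Some C'"
    "norm_ty k \<Gamma> (inst2 C' a (Refl a)) = Some D" "check k \<Gamma> d D = Some d'"
    "norm_ty k \<Gamma> (inst2 C' b p') = Some T \<and> t' = J C' d' p' \<or> (\<exists>c. p' = Refl c) \<and> t' = d' \<and> T = D"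
    using assms(1) by (auto simp: case_Some)
  have **: "\<Gamma> \<turnstile> Eq A a b type" "nf \<Gamma> p' p (Eq A a b)" "tnf (JCtx A a \<Gamma>) C' C"
    "tnf \<Gamma> D (inst2 C' a (Refl a))" "nf \<Gamma> d' d D"
    using *(1-4) assms(2) by (blast intro: IH)+
  then show ?thesis unfolding J using *(5) assms(2) by (blast intro: nf_J nf_J_Refl norm_ty_IH tnf_type)
next
  case (Trunc A)
  then show ?thesis using assms by (auto simp: case_Some intro!: nf_formers intro: IH)
next
  case (TrIn a)
  then show ?thesis using assms by (auto simp: case_Some intro!: nf_TrIn ty_Trunc intro: IH)
next
  case (TrEq u v)
  then show ?thesis using assms by (auto simp: case_Some intro!: nf_TrEq ty_Eq intro: IH nf_tm)
next
  case (TrRec B h f u)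
  then obtain B' u' A H h' F f' where *: "norm_ty k \<Gamma> B = Some B'" "infer k \<Gamma> u = Some (u', Trunc A)"
    "norm_ty k \<Gamma> (IsProp B') = Some H" "check k \<Gamma> h H = Some h'" "norm_ty k \<Gamma> (Arr A B') = Some F" "check k \<Gamma> f F = Some f'"
    "t' = TrRec B' h' f' u'" "T = B'"
    using assms(1) by (auto simp: case_Some)
  then show ?thesis unfolding TrRec *(7,8) using assms(2) by (blast intro: nf_TrRec IH)
next
  case (FunExt f g h)
  then obtain f' A B g' H h' where *: "infer k \<Gamma> f = Some (f', Pi A B)" "check k \<Gamma> g (Pi A B) = Some g'"
    "norm_ty k \<Gamma> (Pi A (Eq B (App (wk f') (Var 0)) (App (wk g') (Var 0)))) = Some H" "check k \<Gamma> h H = Some h'"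
    "t' = FunExt f' g' h'" "T = Eq (Pi A B) f' g'"
    using assms(1) by (auto simp: case_Some)
  then show ?thesis unfolding FunExt *(5,6) using assms(2) by (blast intro: nf_FunExt ty_Eq nf_tm IH)
next
  case (PropExt P Q hP hQ f g)
  then obtain P' Q' H\<^sub>1 hP' H\<^sub>2 hQ' F f' G g' where *: "check k \<Gamma> P Univ = Some P'" "check k \<Gamma> Q Univ = Some Q'"
    "norm_ty k \<Gamma> (IsProp P') = Some H\<^sub>1" "check k \<Gamma> hP H\<^sub>1 = Some hP'"
    "norm_ty k \<Gamma> (IsProp Q') = Some H\<^sub>2" "check k \<Gamma> hQ H\<^sub>2 = Some hQ'"
    "norm_ty k \<Gamma> (Arr P' Q') = Some F" "check k \<Gamma> f F = Some f'" "norm_ty k \<Gamma> (Arr Q' P') = Some G" "check k \<Gamma> g G = Some g'"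
    "t' = PropExt P' Q' hP' hQ' f' g'" "T = Eq Univ P' Q'"
    using assms(1) by (auto simp: case_Some)
  then show ?thesis unfolding PropExt *(11,12) using assms(2) by (blast intro: nf_PropExt ty_Eq nf_tm IH)
qed

end

lemma checker_sound:
  "(\<forall>\<Gamma> t t' T. infer k \<Gamma> t = Some (t', T) \<longrightarrow> ctx \<Gamma> \<longrightarrow> nf \<Gamma> t' t T \<and> \<Gamma> \<turnstile> T type) \<and>
   (\<forall>\<Gamma> t t' T. check k \<Gamma> t T = Some t' \<longrightarrow> ctx \<Gamma> \<longrightarrow> \<Gamma> \<turnstile> T type \<longrightarrow> nf \<Gamma> t' t T) \<and>
   (\<forall>\<Gamma> A A'. norm_ty k \<Gamma> A = Some A' \<longrightarrow> ctx \<Gamma> \<longrightarrow> tnf \<Gamma> A' A)"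
proof (induction k)
  case (Suc k)
  then have IH: "\<And>\<Gamma> t t' T. infer k \<Gamma> t = Some (t', T) \<Longrightarrow> ctx \<Gamma> \<Longrightarrow> nf \<Gamma> t' t T \<and> \<Gamma> \<turnstile> T type"
    "\<And>\<Gamma> t t' T. check k \<Gamma> t T = Some t' \<Longrightarrow> ctx \<Gamma> \<Longrightarrow> \<Gamma> \<turnstile> T type \<Longrightarrow> nf \<Gamma> t' t T"
    "\<And>\<Gamma> A A'. norm_ty k \<Gamma> A = Some A' \<Longrightarrow> ctx \<Gamma> \<Longrightarrow> tnf \<Gamma> A' A"
    by blast+
  show ?case using infer_sound[OF IH] check_sound[OF IH] norm_ty_sound[OF IH] by blast
qed simp

lemma proves_sound:
  assumes "proves k t T"
  obtains t' where "[] \<turnstile> t' \<Ztypecolon> T 0" "[] \<turnstile> t' \<doteq> t 0 \<Ztypecolon> T 0"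
proof -
  obtain T' t' where "norm_ty k [] (T 0) = Some T'" "check k [] (t 0) T' = Some t'"
    using assms by (auto simp: proves_def split: option.splits)
  then have "tnf [] T' (T 0)" "nf [] t' (t 0) T'" using checker_sound[of k] ctx_nil tnf_type by blast+
  then show ?thesis using that nf_tm nf_eq tnf_conv(3,4) by blast
qed

section \<open>Proof terms\<close>

definition jrec :: "(expr \<Rightarrow> expr \<Rightarrow> expr) \<Rightarrow> expr \<Rightarrow> expr \<Rightarrow> expr" where
  "jrec C c p = (\<lambda>d. J (bind (\<lambda>y. bind (C y)) d) (c d) (p d))"
definition efq :: "expr \<Rightarrow> expr \<Rightarrow> expr" where
  "efq C t = (\<lambda>d. Efq (bind (\<lambda>_. C) d) (t d))"
definition trin :: "expr \<Rightarrow> expr" where "trin t = (\<lambda>d. TrIn (t d))"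
definition treq :: "expr \<Rightarrow> expr \<Rightarrow> expr" where "treq t u = (\<lambda>d. TrEq (t d) (u d))"
definition trrec :: "expr \<Rightarrow> expr \<Rightarrow> expr \<Rightarrow> expr \<Rightarrow> expr" where
  "trrec B h f t = (\<lambda>d. TrRec (B d) (h d) (f d) (t d))"
definition funext :: "expr \<Rightarrow> expr \<Rightarrow> expr \<Rightarrow> expr" where
  "funext f g h = (\<lambda>d. FunExt (f d) (g d) (h d))"
definition propext :: "expr \<Rightarrow> expr \<Rightarrow> expr \<Rightarrow> expr \<Rightarrow> expr \<Rightarrow> expr \<Rightarrow> expr" where
  "propext P Q hP hQ f g = (\<lambda>d. PropExt (P d) (Q d) (hP d) (hQ d) (f d) (g d))"

text \<open>The end point of a path is recovered from its inferred type, so these operations receive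
  just the start point, which their motives mention.\<close>

definition tsym :: "expr \<Rightarrow> expr \<Rightarrow> expr \<Rightarrow> expr" where
  "tsym A a p = jrec (\<lambda>y _. eq A y a) (rfl a) p"
definition ttrans :: "expr \<Rightarrow> expr \<Rightarrow> expr \<Rightarrow> expr \<Rightarrow> expr" where
  "ttrans A a p q = jrec (\<lambda>y _. eq A a y) p q"
definition tap :: "expr \<Rightarrow> (expr \<Rightarrow> expr) \<Rightarrow> expr \<Rightarrow> expr \<Rightarrow> expr" where
  "tap B f a p = jrec (\<lambda>y _. eq B (f a) (f y)) (rfl (f a)) p"

section \<open>Hedberg's theorem, applied to the naturals and the unit type\<close>

definition const_endo :: "expr \<Rightarrow> expr" where
  "const_endo X = sig (X \<rightarrow>\<^sub>t X) (\<lambda>w. pi X (\<lambda>p. pi X (\<lambda>p'. eq X (w \<cdot> p) (w \<cdot> p'))))"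

definition hedberg_ty :: expr where
  "hedberg_ty = pi univ (\<lambda>A. pi A (\<lambda>x. pi A (\<lambda>y. const_endo (eq A x y)) \<rightarrow>\<^sub>t
     pi A (\<lambda>y. isProp (eq A x y))))"

text \<open>Local form of the theorem, with the base point \<open>x\<close> fixed. Let
  \<open>c\<close> be the value of the endomap at reflexivity and \<open>f y q\<close> the inverse
  of \<open>c\<close> followed by the value at \<open>q\<close>. Path induction identifies
  \<open>f y q\<close> with \<open>q\<close>; this is \<open>k\<close>, and its base case is the
  cancellation law \<open>inv\<close>. Constancy links \<open>f y p\<close> to
  \<open>f y p'\<close>, hence \<open>p\<close> to \<open>p'\<close>.\<close>

definition hedberg :: expr where
  "hedberg = lam univ (\<lambda>A. lam A (\<lambda>x. lam (pi A (\<lambda>y. const_endo (eq A x y))) (\<lambda>w.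
     lam A (\<lambda>y. lam (eq A x y) (\<lambda>p. lam (eq A x y) (\<lambda>p'.
       let c = pr1 (w \<cdot> x) \<cdot> rfl x;
           f = (\<lambda>y q. ttrans A x (tsym A x c) (pr1 (w \<cdot> y) \<cdot> q));
           inv = jrec (\<lambda>z c. eq (eq A z z) (ttrans A z (tsym A x c) c) (rfl z)) (rfl (rfl x)) c;
           k = (\<lambda>q. jrec (\<lambda>y q. eq (eq A x y) (f y q) q) inv q)
       in ttrans (eq A x y) p (tsym (eq A x y) (f y p) (k p))
           (ttrans (eq A x y) (f y p)
             (tap (eq A x y) (\<lambda>u. ttrans A x (tsym A x c) u) (pr1 (w \<cdot> y) \<cdot> p) (pr2 (w \<cdot> y) \<cdot> p \<cdot> p'))
             (k p'))))))))"

definition nat_dec_ty :: expr where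
  "nat_dec_ty = pi nat\<^sub>t (\<lambda>m. pi nat\<^sub>t (\<lambda>n. decidable (eq nat\<^sub>t m n)))"

text \<open>With \<open>is_succ\<close>, a family into the universe that separates zero from
  successors: transporting \<open>star\<close> along an identification of the two lands in
  \<open>empty\<close>.\<close>

definition is_zero :: "expr \<Rightarrow> expr" where
  "is_zero n = natrec (\<lambda>_. univ) unit (\<lambda>_ _. empty) n"

definition is_succ :: "expr \<Rightarrow> expr" where
  "is_succ n = natrec (\<lambda>_. univ) empty (\<lambda>_ _. unit) n"

definition pred :: "expr \<Rightarrow> expr" where
  "pred n = natrec (\<lambda>_. nat\<^sub>t) zero (\<lambda>k _. k) n"

definition nat_dec :: expr where
  "nat_dec = lam nat\<^sub>t (\<lambda>m. natrec (\<lambda>m. pi nat\<^sub>t (\<lambda>n. decidable (eq nat\<^sub>t m n)))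
     (lam nat\<^sub>t (\<lambda>n. natrec (\<lambda>n. decidable (eq nat\<^sub>t zero n))
        (inl (rfl zero))
        (\<lambda>k _. inr (lam (eq nat\<^sub>t zero (succ k)) (\<lambda>p. jrec (\<lambda>y _. is_zero y) star p))) n))
     (\<lambda>m ih. lam nat\<^sub>t (\<lambda>n. natrec (\<lambda>n. decidable (eq nat\<^sub>t (succ m) n))
        (inr (lam (eq nat\<^sub>t (succ m) zero) (\<lambda>p. jrec (\<lambda>y _. is_succ y) star p)))
        (\<lambda>k _. cases (\<lambda>_. decidable (eq nat\<^sub>t (succ m) (succ k)))
           (\<lambda>p. inl (tap nat\<^sub>t succ m p))
           (\<lambda>h. inr (lam (eq nat\<^sub>t (succ m) (succ k)) (\<lambda>p. h \<cdot> (tap nat\<^sub>t pred (succ m) p))))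
           (ih \<cdot> k)) n)) m)"

definition nat_set_ty :: expr where
  "nat_set_ty = pi nat\<^sub>t (\<lambda>m. pi nat\<^sub>t (\<lambda>n. isProp (eq nat\<^sub>t m n)))"

text \<open>Earlier results enter as leading variables, here \<open>H\<close> and \<open>D\<close>,
  so that the checker does not unfold their proofs; \<open>inhabited_mp\<close> discharges them. A
  decidable type has a constant endomap: constantly the given element, or the identity if the type
  is refuted.\<close>

definition nat_set :: expr where
  "nat_set = lam hedberg_ty (\<lambda>H. lam nat_dec_ty (\<lambda>D. lam nat\<^sub>t (\<lambda>m. H \<cdot> nat\<^sub>t \<cdot> m \<cdot> lam nat\<^sub>t (\<lambda>n.
     let X = eq nat\<^sub>t m n in
     cases (\<lambda>_. const_endo X)
       (\<lambda>p. pair (lam X (\<lambda>_. p)) (lam X (\<lambda>_. lam X (\<lambda>_. rfl p))))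
       (\<lambda>h. pair (lam X (\<lambda>p. p)) (lam X (\<lambda>p. lam X (\<lambda>p'. efq (eq X p p') (h \<cdot> p)))))
       (D \<cdot> m \<cdot> n)))))"

definition unit_set_ty :: expr where
  "unit_set_ty = pi unit (\<lambda>a. pi unit (\<lambda>b. isProp (eq unit a b)))"

definition unit_set :: expr where
  "unit_set = lam hedberg_ty (\<lambda>H. lam unit (\<lambda>a. H \<cdot> unit \<cdot> a \<cdot> lam unit (\<lambda>b.
     pair (lam (eq unit a b) (\<lambda>_. unit_isProp \<cdot> a \<cdot> b))
       (lam (eq unit a b) (\<lambda>_. lam (eq unit a b) (\<lambda>_. rfl (unit_isProp \<cdot> a \<cdot> b)))))))"

text \<open>
  For \<open>e\<close> identifying the first components of \<open>u\<close> and \<open>v\<close> in \<open>sig A B\<close>, where \<open>h a\<close> proves that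
  \<open>B a\<close> is a proposition. The base case of the two path inductions is \<open>rfl u\<close>, by eta for pairs.
\<close>

definition subtype_eq :: "expr \<Rightarrow> (expr \<Rightarrow> expr) \<Rightarrow> (expr \<Rightarrow> expr \<Rightarrow> expr \<Rightarrow> expr) \<Rightarrow> expr \<Rightarrow> expr \<Rightarrow> expr \<Rightarrow> expr" where
  "subtype_eq A B h u v e =
     jrec (\<lambda>b _. pi (B b) (\<lambda>t. eq (sig A B) u (pair b t)))
       (lam (B (pr1 u)) (\<lambda>t. jrec (\<lambda>t' _. eq (sig A B) u (pair (pr1 u) t')) (rfl u) (h (pr1 u) (pr2 u) t)))
       e \<cdot> pr2 v"

section \<open>Runs of machines and uniqueness of their outputs\<close>

definition iterate :: "expr \<Rightarrow> expr \<Rightarrow> expr \<Rightarrow> expr" where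
  "iterate s z k = natrec (\<lambda>_. nat\<^sub>t +\<^sub>t nat\<^sub>t) z (\<lambda>_ w. s \<cdot> w) k"

definition halts :: "expr \<Rightarrow> expr \<Rightarrow> expr \<Rightarrow> expr" where
  "halts s z y = sig nat\<^sub>t (\<lambda>k. eq (nat\<^sub>t +\<^sub>t nat\<^sub>t) (iterate s z k) (inr y))"

text \<open>Stated for any step function that fixes right injections, so that machines enter later
  as an instance. In the proof term, \<open>shift\<close> carries one step past \<open>k\<close>
  steps and drives the induction in \<open>comm\<close>. The equality of the outputs is extracted
  from that of their right injections by the map taking a right injection to its content, with
  \<open>zero\<close> as default on left injections.\<close>

definition halts_unique_ty :: expr where
  "halts_unique_ty = pi (nat\<^sub>t +\<^sub>t nat\<^sub>t \<rightarrow>\<^sub>t nat\<^sub>t +\<^sub>t nat\<^sub>t) (\<lambda>s.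
     pi nat\<^sub>t (\<lambda>y. eq (nat\<^sub>t +\<^sub>t nat\<^sub>t) (s \<cdot> inr y) (inr y)) \<rightarrow>\<^sub>t
     pi (nat\<^sub>t +\<^sub>t nat\<^sub>t) (\<lambda>z. pi nat\<^sub>t (\<lambda>y. pi nat\<^sub>t (\<lambda>y'. halts s z y \<rightarrow>\<^sub>t halts s z y' \<rightarrow>\<^sub>t eq nat\<^sub>t y y'))))"

text \<open>
  If \<open>k\<close> steps from \<open>z\<close> give \<open>inr y\<close> and \<open>k'\<close> steps give \<open>inr y'\<close>, then taking both numbers of
  steps, in either order, gives both \<open>inr y\<close> and \<open>inr y'\<close>.
\<close>

definition halts_unique :: expr where
  "halts_unique = (let S = nat\<^sub>t +\<^sub>t nat\<^sub>t in lam (S \<rightarrow>\<^sub>t S) (\<lambda>s. lam (pi nat\<^sub>t (\<lambda>y. eq S (s \<cdot> inr y) (inr y))) (\<lambda>fix.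
     lam S (\<lambda>z. lam nat\<^sub>t (\<lambda>y. lam nat\<^sub>t (\<lambda>y'. lam (halts s z y) (\<lambda>u. lam (halts s z y') (\<lambda>u'.
     let shift = (\<lambda>k z. natrec (\<lambda>k. eq S (iterate s (s \<cdot> z) k) (s \<cdot> iterate s z k)) (rfl (s \<cdot> z))
           (\<lambda>k ih. tap S (\<lambda>w. s \<cdot> w) (iterate s (s \<cdot> z) k) ih) k);
         comm = (\<lambda>k k'. natrec (\<lambda>k'. eq S (iterate s (iterate s z k) k') (iterate s (iterate s z k') k))
           (rfl (iterate s z k))
           (\<lambda>k' ih. ttrans S (s \<cdot> iterate s (iterate s z k) k')
              (tap S (\<lambda>w. s \<cdot> w) (iterate s (iterate s z k) k') ih)
              (tsym S (iterate s (s \<cdot> iterate s z k') k) (shift k (iterate s z k')))) k');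
         stay = (\<lambda>y k. natrec (\<lambda>k. eq S (iterate s (inr y) k) (inr y)) (rfl (inr y))
           (\<lambda>k ih. ttrans S (s \<cdot> iterate s (inr y) k) (tap S (\<lambda>w. s \<cdot> w) (iterate s (inr y) k) ih) (fix \<cdot> y)) k);
         k = pr1 u; k' = pr1 u';
         e = ttrans S (inr y)
               (ttrans S (inr y)
                 (ttrans S (inr y)
                   (ttrans S (inr y)
                     (tsym S (iterate s (inr y) k') (stay y k'))
                     (tsym S (iterate s (iterate s z k) k')
                       (tap S (\<lambda>w. iterate s w k') (iterate s z k) (pr2 u))))
                   (comm k k'))
                 (tap S (\<lambda>w. iterate s w k) (iterate s z k') (pr2 u')))
               (stay y' k)
     in jrec (\<lambda>w _. eq nat\<^sub>t y (cases (\<lambda>_. nat\<^sub>t) (\<lambda>_. zero) (\<lambda>n. n) w)) (rfl y) e))))))))"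

text \<open>
  \<open>run\<close>, \<open>eval_extent\<close> and \<open>eval\<close> (as \<open>evg\<close>) with the components of the machine as parameters, so that
  substituting \<open>step m\<close>, \<open>init m\<close> and \<open>q \<cdot> m\<close> gives the original terms without any conversion.
\<close>

definition run_from :: "expr \<Rightarrow> expr \<Rightarrow> expr \<Rightarrow> expr" where
  "run_from k s n = natrec (\<lambda>_. nat\<^sub>t +\<^sub>t nat\<^sub>t) (inl n)
     (\<lambda>_. cases (\<lambda>_. nat\<^sub>t +\<^sub>t nat\<^sub>t) (\<lambda>x. decode (s \<cdot> x)) (\<lambda>y. inr y)) k"

definition ext :: "expr \<Rightarrow> expr \<Rightarrow> expr" where
  "ext s n = sig nat\<^sub>t (\<lambda>y. trunc (sig nat\<^sub>t (\<lambda>k. eq (nat\<^sub>t +\<^sub>t nat\<^sub>t) (run_from k s n) (inr y))))"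

definition ext_prop_ty :: expr where
  "ext_prop_ty = pi (nat\<^sub>t \<rightarrow>\<^sub>t nat\<^sub>t) (\<lambda>s. pi nat\<^sub>t (\<lambda>n. isProp (ext s n)))"

text \<open>Equality of outputs is a proposition by \<open>N\<close>, so both truncations may be
  eliminated. \<open>f\<close> turns a step into a function of the object language, and iterating it
  normalises to \<open>run_from\<close>. Since \<open>f\<close> computes on right injections,
  reflexivity proves that halted states are fixed.\<close>

definition ext_prop :: expr where
  "ext_prop = lam nat_set_ty (\<lambda>N. lam halts_unique_ty (\<lambda>U. lam (nat\<^sub>t \<rightarrow>\<^sub>t nat\<^sub>t) (\<lambda>s. lam nat\<^sub>t (\<lambda>n.
     lam (ext s n) (\<lambda>u. lam (ext s n) (\<lambda>v.
     let f = lam (nat\<^sub>t +\<^sub>t nat\<^sub>t) (cases (\<lambda>_. nat\<^sub>t +\<^sub>t nat\<^sub>t) (\<lambda>x. decode (s \<cdot> x)) (\<lambda>y. inr y))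
     in subtype_eq nat\<^sub>t (\<lambda>y. trunc (halts f (inl n) y)) (\<lambda>_. treq) u v
          (trrec (eq nat\<^sub>t (pr1 u) (pr1 v)) (N \<cdot> pr1 u \<cdot> pr1 v)
             (lam (halts f (inl n) (pr1 u)) (\<lambda>a.
               trrec (eq nat\<^sub>t (pr1 u) (pr1 v)) (N \<cdot> pr1 u \<cdot> pr1 v)
                 (lam (halts f (inl n) (pr1 v)) (\<lambda>b.
                    U \<cdot> f \<cdot> lam nat\<^sub>t (\<lambda>y. rfl (inr y)) \<cdot> inl n \<cdot> pr1 u \<cdot> pr1 v \<cdot> a \<cdot> b))
                 (pr2 v)))
             (pr2 u))))))))"

section \<open>The constant zero function as a computable function\<close>

definition lift_eq_eta_ty :: expr where
  "lift_eq_eta_ty = pi univ (\<lambda>P. pi (isProp P) (\<lambda>h. pi (P \<rightarrow>\<^sub>t nat\<^sub>t) (\<lambda>f. pi P (\<lambda>p.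
     eq nat\<^sub>t (f \<cdot> p) zero \<rightarrow>\<^sub>t eq (lift nat\<^sub>t) (eta zero) (pair P (pair h f))))))"

text \<open>Proposition extensionality identifies the extent with \<open>unit\<close>, and path
  induction reduces to that case; \<open>h\<close>, \<open>f\<close>, \<open>p\<close> and
  \<open>r\<close> are generalised in the motive because their types depend on \<open>P\<close>. It
  remains to identify the two proofs of propositionality, by \<open>S\<close> and function
  extensionality, and the two value maps, which agree because every element of \<open>unit\<close>
  is identified with \<open>p\<close>.\<close>

definition lift_eq_eta :: expr where
  "lift_eq_eta = lam unit_set_ty (\<lambda>S. lam univ (\<lambda>P. lam (isProp P) (\<lambda>h. lam (P \<rightarrow>\<^sub>t nat\<^sub>t) (\<lambda>f. lam P (\<lambda>p.
     lam (eq nat\<^sub>t (f \<cdot> p) zero) (\<lambda>r.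
     jrec (\<lambda>P _. pi (isProp P) (\<lambda>h. pi (P \<rightarrow>\<^sub>t nat\<^sub>t) (\<lambda>f. pi P (\<lambda>p.
            eq nat\<^sub>t (f \<cdot> p) zero \<rightarrow>\<^sub>t eq (lift nat\<^sub>t) (eta zero) (pair P (pair h f))))))
       (lam (isProp unit) (\<lambda>h. lam (unit \<rightarrow>\<^sub>t nat\<^sub>t) (\<lambda>f. lam unit (\<lambda>p. lam (eq nat\<^sub>t (f \<cdot> p) zero) (\<lambda>r.
          jrec (\<lambda>h' _. eq (lift nat\<^sub>t) (eta zero) (pair unit (pair h' f)))
            (jrec (\<lambda>f' _. eq (lift nat\<^sub>t) (eta zero) (pair unit (pair unit_isProp f')))
              (rfl (eta zero))
              (funext (lam unit (\<lambda>_. zero)) f (lam unit (\<lambda>u.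
                 ttrans nat\<^sub>t zero (tsym nat\<^sub>t (f \<cdot> p) r) (tap nat\<^sub>t (\<lambda>u. f \<cdot> u) p (unit_isProp \<cdot> p \<cdot> u))))))
            (funext unit_isProp h (lam unit (\<lambda>a. funext (unit_isProp \<cdot> a) (h \<cdot> a) (lam unit (\<lambda>b.
               S \<cdot> a \<cdot> b \<cdot> (unit_isProp \<cdot> a \<cdot> b) \<cdot> (h \<cdot> a \<cdot> b)))))))))))
       (propext unit P unit_isProp h (lam unit (\<lambda>_. p)) (lam P (\<lambda>_. star)))
       \<cdot> h \<cdot> f \<cdot> p \<cdot> r))))))"

definition pfun :: expr where "pfun = (nat\<^sub>t \<rightarrow>\<^sub>t lift nat\<^sub>t)"

definition zero_fun :: expr where "zero_fun = lam nat\<^sub>t (\<lambda>x. eta zero)"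

definition evg :: "expr \<Rightarrow> expr \<Rightarrow> expr \<Rightarrow> expr" where
  "evg i s h = lam nat\<^sub>t (\<lambda>x. pair (ext s (i \<cdot> x)) (pair (h \<cdot> x) (lam (ext s (i \<cdot> x)) (\<lambda>e. pr1 e))))"

definition zero_path_ty :: expr where
  "zero_path_ty = pi (nat\<^sub>t \<rightarrow>\<^sub>t nat\<^sub>t) (\<lambda>i. pi (nat\<^sub>t \<rightarrow>\<^sub>t nat\<^sub>t) (\<lambda>s. pi (pi nat\<^sub>t (\<lambda>x. isProp (ext s (i \<cdot> x)))) (\<lambda>h.
     pi nat\<^sub>t (\<lambda>x. eq nat\<^sub>t (i \<cdot> x) zero) \<rightarrow>\<^sub>t eq nat\<^sub>t (s \<cdot> zero) (succ zero) \<rightarrow>\<^sub>t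
     eq pfun zero_fun (evg i s h))))"

text \<open>A single step halts: by the coding, \<open>succ zero\<close> decodes to
  \<open>inr zero\<close>, which is why the successor serves as step function. The redex around
  \<open>zero_fun\<close> is a type ascription, since a function whose body is a pair has no
  inferable type.\<close>

definition zero_path :: expr where
  "zero_path = lam lift_eq_eta_ty (\<lambda>E. lam (nat\<^sub>t \<rightarrow>\<^sub>t nat\<^sub>t) (\<lambda>i. lam (nat\<^sub>t \<rightarrow>\<^sub>t nat\<^sub>t) (\<lambda>s.
     lam (pi nat\<^sub>t (\<lambda>x. isProp (ext s (i \<cdot> x)))) (\<lambda>h. lam (pi nat\<^sub>t (\<lambda>x. eq nat\<^sub>t (i \<cdot> x) zero)) (\<lambda>a.
     lam (eq nat\<^sub>t (s \<cdot> zero) (succ zero)) (\<lambda>b.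
     funext (lam pfun (\<lambda>f. f) \<cdot> zero_fun) (evg i s h) (lam nat\<^sub>t (\<lambda>x.
       E \<cdot> ext s (i \<cdot> x) \<cdot> (h \<cdot> x) \<cdot> lam (ext s (i \<cdot> x)) (\<lambda>e. pr1 e) \<cdot>
         pair zero (trin (pair (succ zero)
           (ttrans (nat\<^sub>t +\<^sub>t nat\<^sub>t) (decode (s \<cdot> (i \<cdot> x)))
             (tap (nat\<^sub>t +\<^sub>t nat\<^sub>t) (\<lambda>n. decode (s \<cdot> n)) (i \<cdot> x) (a \<cdot> x))
             (tap (nat\<^sub>t +\<^sub>t nat\<^sub>t) decode (s \<cdot> zero) b)))) \<cdot> rfl zero))))))))"

section \<open>Decidability of equality from an embedding\<close>

definition isCompOf :: "expr \<Rightarrow> expr \<Rightarrow> expr \<Rightarrow> expr" where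
  "isCompOf M ev f = trunc (sig M (\<lambda>m. eq pfun f (ev \<cdot> m)))"

definition emb_dec :: "expr \<Rightarrow> expr \<Rightarrow> expr" where
  "emb_dec K z = (sig (K \<rightarrow>\<^sub>t nat\<^sub>t) (\<lambda>F. isEmbedding K nat\<^sub>t F)
      \<rightarrow>\<^sub>t pi K (\<lambda>f. pi K (\<lambda>g. decidable (eq K f g))) \<times>\<^sub>t pi K (\<lambda>f. decidable (eq pfun (pr1 f) z)))"

text \<open>Machines are replaced by an arbitrary small type \<open>M\<close> with a map
  \<open>ev\<close>: what matters about computability is that it means lying in the truncated image
  of a map, and that \<open>z\<close> lies there.\<close>

definition comp_dec_ty :: expr where
  "comp_dec_ty = pi univ (\<lambda>M. pi (M \<rightarrow>\<^sub>t pfun) (\<lambda>ev. pi pfun (\<lambda>z.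
     isCompOf M ev z \<rightarrow>\<^sub>t emb_dec (sig pfun (isCompOf M ev)) z)))"

text \<open>In \<open>dec\<close>, the two compared points of the fibre are \<open>f\<close> with
  the path found by \<open>D\<close>, and \<open>g\<close> with reflexivity; projecting their
  identification gives the equality of \<open>f\<close> and \<open>g\<close>. The identity function
  applied to \<open>pair z c\<close> is an ascription, which lets the pair be inferred.\<close>

definition comp_dec :: expr where
  "comp_dec = lam nat_dec_ty (\<lambda>D. lam univ (\<lambda>M. lam (M \<rightarrow>\<^sub>t pfun) (\<lambda>ev. lam pfun (\<lambda>z. lam (isCompOf M ev z) (\<lambda>c.
     let K = sig pfun (isCompOf M ev)
     in lam (sig (K \<rightarrow>\<^sub>t nat\<^sub>t) (\<lambda>F. isEmbedding K nat\<^sub>t F)) (\<lambda>E.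
     let dec = (\<lambda>f g. cases (\<lambda>_. decidable (eq K f g))
           (\<lambda>p. inl (jrec (\<lambda>w _. eq K f (pr1 w)) (rfl f)
              (pr2 E \<cdot> (pr1 E \<cdot> g) \<cdot> pair f p \<cdot> pair g (rfl (pr1 E \<cdot> g)))))
           (\<lambda>h. inr (lam (eq K f g) (\<lambda>e. h \<cdot> tap nat\<^sub>t (\<lambda>f. pr1 E \<cdot> f) f e)))
           (D \<cdot> (pr1 E \<cdot> f) \<cdot> (pr1 E \<cdot> g)));
         z' = lam K (\<lambda>x. x) \<cdot> pair z c
     in pair (lam K (\<lambda>f. lam K (\<lambda>g. dec f g)))
          (lam K (\<lambda>f. cases (\<lambda>_. decidable (eq pfun (pr1 f) z))
             (\<lambda>e. inl (tap pfun pr1 f e))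
             (\<lambda>h. inr (lam (eq pfun (pr1 f) z) (\<lambda>e. h \<cdot> subtype_eq pfun (isCompOf M ev) (\<lambda>_. treq) f z' e)))
             (dec f z')))))))))"

section \<open>A machine for the zero function\<close>

definition zero_machine_ty :: expr where
  "zero_machine_ty = sig machine (\<lambda>m. pi nat\<^sub>t (\<lambda>x. eq nat\<^sub>t (init m \<cdot> x) zero) \<times>\<^sub>t eq nat\<^sub>t (step m \<cdot> zero) (succ zero))"

text \<open>Both functions are initial, so stage \<open>zero\<close> with the matching summand of
  \<open>pr_initial\<close> is evidence enough. Reflexivity applies because composing them with
  \<open>head\<close> reduces to the functions listed there.\<close>

definition zero_machine :: expr where
  "zero_machine = pair
     (pair
       (pair (lam nat\<^sub>t (\<lambda>_. zero)) (trin (pair zero (inl (pair (succ zero)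
          (rfl (pair (succ zero) (lam (vec (succ zero)) (\<lambda>_. zero)))))))))
       (pair (lam nat\<^sub>t succ) (trin (pair zero (inr (inl
          (rfl (pair (succ zero) (lam (vec (succ zero)) (\<lambda>v. succ (head v)))))))))))
     (pair (lam nat\<^sub>t (\<lambda>x. rfl zero)) (rfl (succ zero)))"

section \<open>Instantiation at machines\<close>

text \<open>De Bruijn counterparts of the expressions above, which can be applied to open terms in any context.\<close>

definition Decode :: "tm \<Rightarrow> tm" where
  "Decode t = NatRec (Plus Nat Nat) (In1 Zero)
     (Case (Plus Nat Nat) (In2 (Var 0)) (In1 (Succ (Var 0))) (Var 0)) t"

definition Run :: "tm \<Rightarrow> tm \<Rightarrow> tm \<Rightarrow> tm" where
  "Run k s n = NatRec (Plus Nat Nat) (In1 n)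
     (Case (Plus Nat Nat) (Decode (App (wk (wk (wk s))) (Var 0))) (In2 (Var 0)) (Var 0)) k"

definition Ext :: "tm \<Rightarrow> tm \<Rightarrow> tm" where
  "Ext s n = Sig Nat (Trunc (Sig Nat (Eq (Plus Nat Nat) (Run (Var 0) (wk (wk s)) (wk (wk n))) (In2 (Var 1)))))"

definition Lift :: tm where
  "Lift = Sig Univ (Sig (IsProp (Var 0)) (Arr (Var 1) Nat))"

definition Evg :: "tm \<Rightarrow> tm \<Rightarrow> tm \<Rightarrow> tm" where
  "Evg i s h = Lam Nat (Pr (Ext (wk s) (App (wk i) (Var 0)))
     (Pr (App (wk h) (Var 0)) (Lam (Ext (wk s) (App (wk i) (Var 0))) (P1 (Var 0)))))"

section \<open>Substitution into the open forms and their typing\<close>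

lemma ups_0: "ups \<sigma> 0 = Var 0" "ups (ups \<sigma>) (Suc 0) = Var 1"
  by (simp_all add: ups_def)

lemma sub_Arr: "sub \<sigma> (Arr A B) = Arr (sub \<sigma> A) (sub \<sigma> B)"
  by (simp add: Arr_def sub_ups_wk)

lemma sub_IsProp: "sub \<sigma> (IsProp A) = IsProp (sub \<sigma> A)"
  by (simp add: IsProp_def sub_ups_wk ups_0)

lemma sub_Ext: "sub \<sigma> (Ext s n) = Ext (sub \<sigma> s) (sub \<sigma> n)"
  by (simp add: Ext_def Run_def Decode_def sub_ups_wk ups_0)

lemma ren_Ext: "ren r (Ext s n) = Ext (ren r s) (ren r n)"
  by (simp add: Ext_def Run_def Decode_def ren_upr_wk)

lemma sub_Evg: "sub \<sigma> (Evg i s h) = Evg (sub \<sigma> i) (sub \<sigma> s) (sub \<sigma> h)"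
  by (simp add: Evg_def sub_Ext sub_ups_wk ups_0)

lemma sub_Lift: "sub \<sigma> Lift = Lift" "ren r Lift = Lift"
  by (simp_all add: Lift_def sub_Arr sub_IsProp ren_Arr ren_IsProp ups_0)

lemmas raw_sub = sub_Arr sub_IsProp sub_Ext sub_Evg sub_Lift ren_Arr ren_IsProp ren_Ext

lemma App_Arr: "\<Gamma> \<turnstile> f \<Ztypecolon> Arr A B \<Longrightarrow> \<Gamma> \<turnstile> a \<Ztypecolon> A \<Longrightarrow> \<Gamma> \<turnstile> App f a \<Ztypecolon> B"
  using tm_App[of \<Gamma> f A "wk B" a] by (simp add: Arr_def inst_wk)

lemma small_Univ: "ctx \<Gamma> \<Longrightarrow> \<Gamma> \<turnstile> Plus Nat Nat \<Ztypecolon> Univ"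
  by (intro tm_Plus tm_Nat)

lemma ctx_Nat: "ctx \<Gamma> \<Longrightarrow> ctx (Nat # \<Gamma>)"
  by (intro ctx_cons small_types)

lemma ctx_Sum: "ctx \<Gamma> \<Longrightarrow> ctx (Plus Nat Nat # \<Gamma>)"
  by (intro ctx_cons ty_El small_Univ)

lemma NatRec_Sum:
  "ctx \<Gamma> \<Longrightarrow> \<Gamma> \<turnstile> z \<Ztypecolon> Plus Nat Nat \<Longrightarrow> Plus Nat Nat # Nat # \<Gamma> \<turnstile> s \<Ztypecolon> Plus Nat Nat \<Longrightarrow> \<Gamma> \<turnstile> n \<Ztypecolon> Nat \<Longrightarrow>
   \<Gamma> \<turnstile> NatRec (Plus Nat Nat) z s n \<Ztypecolon> Plus Nat Nat"
  using tm_NatRec[of \<Gamma> "Plus Nat Nat" z s n] by (simp add: ty_El small_Univ ctx_Nat)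

lemma Case_Sum:
  "ctx \<Gamma> \<Longrightarrow> Nat # \<Gamma> \<turnstile> l \<Ztypecolon> Plus Nat Nat \<Longrightarrow> Nat # \<Gamma> \<turnstile> r \<Ztypecolon> Plus Nat Nat \<Longrightarrow> \<Gamma> \<turnstile> s \<Ztypecolon> Plus Nat Nat \<Longrightarrow>
   \<Gamma> \<turnstile> Case (Plus Nat Nat) l r s \<Ztypecolon> Plus Nat Nat"
  using tm_Case[of Nat Nat \<Gamma> "Plus Nat Nat" l r s] by (simp add: ty_El small_Univ ctx_Sum)

lemma Var_small:
  "ctx \<Gamma> \<Longrightarrow> Nat # \<Gamma> \<turnstile> Var 0 \<Ztypecolon> Nat"
  "ctx \<Gamma> \<Longrightarrow> Plus Nat Nat # \<Gamma> \<turnstile> Var 0 \<Ztypecolon> Plus Nat Nat"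
  "ctx \<Gamma> \<Longrightarrow> Nat # Nat # \<Gamma> \<turnstile> Var 1 \<Ztypecolon> Nat"
  using Var_0[of Nat] Var_0[of "Plus Nat Nat"] tm_Var[of "Nat # Nat # \<Gamma>" 1] by (simp_all add: ctx_Nat ctx_Sum)

lemma Decode_ty: "ctx \<Gamma> \<Longrightarrow> \<Gamma> \<turnstile> t \<Ztypecolon> Nat \<Longrightarrow> \<Gamma> \<turnstile> Decode t \<Ztypecolon> Plus Nat Nat"
  unfolding Decode_def
  by (intro NatRec_Sum Case_Sum tm_In1 tm_In2 tm_Zero tm_Succ small_types Var_small ctx_Nat ctx_Sum)

lemma wk_Arr_Nat: "wk (Arr Nat Nat) = Arr Nat Nat"
  by (simp add: ren_Arr)

lemma Run_ty:
  assumes c: "ctx \<Gamma>" and s: "\<Gamma> \<turnstile> s \<Ztypecolon> Arr Nat Nat" and n: "\<Gamma> \<turnstile> n \<Ztypecolon> Nat" and k: "\<Gamma> \<turnstile> k \<Ztypecolon> Nat"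
  shows "\<Gamma> \<turnstile> Run k s n \<Ztypecolon> Plus Nat Nat"
proof -
  have "Nat # Plus Nat Nat # Nat # \<Gamma> \<turnstile> wk (wk (wk s)) \<Ztypecolon> Arr Nat Nat"
    using s c wk_tm[of _ _ _ "Arr Nat Nat"] by (simp add: wk_Arr_Nat ctx_Nat ctx_Sum)
  then show ?thesis unfolding Run_def using c n k
    by (intro NatRec_Sum Case_Sum Decode_ty App_Arr[of _ _ Nat] tm_In1 tm_In2 small_types Var_small ctx_Nat ctx_Sum)
qed

lemma Ext_ty:
  assumes c: "ctx \<Gamma>" and s: "\<Gamma> \<turnstile> s \<Ztypecolon> Arr Nat Nat" and n: "\<Gamma> \<turnstile> n \<Ztypecolon> Nat"
  shows "\<Gamma> \<turnstile> Ext s n \<Ztypecolon> Univ"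
proof -
  have "Nat # Nat # \<Gamma> \<turnstile> wk (wk s) \<Ztypecolon> Arr Nat Nat" "Nat # Nat # \<Gamma> \<turnstile> wk (wk n) \<Ztypecolon> Nat"
    using s n c wk_tm[of _ _ _ "Arr Nat Nat"] wk_tm[of _ _ _ Nat] by (simp_all add: wk_Arr_Nat ctx_Nat)
  then show ?thesis unfolding Ext_def using c
    by (intro tm_Sig tm_Trunc tm_Eq tm_Nat small_Univ Run_ty tm_In2 small_types Var_small ctx_Nat)
qed

lemma Arr_ty: "\<Gamma> \<turnstile> A type \<Longrightarrow> \<Gamma> \<turnstile> B type \<Longrightarrow> ctx \<Gamma> \<Longrightarrow> \<Gamma> \<turnstile> Arr A B type"
  unfolding Arr_def by (intro ty_Pi wk_type ctx_cons)

lemma IsProp_ty: "\<Gamma> \<turnstile> A type \<Longrightarrow> ctx \<Gamma> \<Longrightarrow> \<Gamma> \<turnstile> IsProp A type"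
proof -
  assume A: "\<Gamma> \<turnstile> A type" and "ctx \<Gamma>"
  then have c: "ctx (A # \<Gamma>)" by (intro ctx_cons)
  have A1: "A # \<Gamma> \<turnstile> wk A type" using wk_type[OF c A] .
  then have c2: "ctx (wk A # A # \<Gamma>)" by (rule ctx_cons[OF c])
  show ?thesis unfolding IsProp_def
    using A A1 wk_type[OF c2 A1] wk_tm[OF c2 Var_0[OF c]] Var_0[OF c2]
    by (intro ty_Pi ty_Eq) auto
qed

lemma Lift_body_ty: "ctx \<Gamma> \<Longrightarrow> Univ # \<Gamma> \<turnstile> Sig (IsProp (Var 0)) (Arr (Var 1) Nat) type"
proof -
  assume "ctx \<Gamma>"
  then have c: "ctx (Univ # \<Gamma>)" by (intro ctx_cons ty_Univ)
  have P: "Univ # \<Gamma> \<turnstile> Var 0 type" using Var_0[OF c] ty_El by simp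
  then have I: "Univ # \<Gamma> \<turnstile> IsProp (Var 0) type" using c by (rule IsProp_ty)
  then have c2: "ctx (IsProp (Var 0) # Univ # \<Gamma>)" by (rule ctx_cons[OF c])
  have "IsProp (Var 0) # Univ # \<Gamma> \<turnstile> Var 1 type" using wk_type[OF c2 P] by simp
  then show ?thesis using I c2 by (intro ty_Sig Arr_ty small_types)
qed

lemma Lift_ty: "ctx \<Gamma> \<Longrightarrow> \<Gamma> \<turnstile> Lift type"
  unfolding Lift_def by (intro ty_Sig ty_Univ Lift_body_ty)

lemma Evg_ty:
  assumes c: "ctx \<Gamma>" and i: "\<Gamma> \<turnstile> i \<Ztypecolon> Arr Nat Nat" and s: "\<Gamma> \<turnstile> s \<Ztypecolon> Arr Nat Nat"
    and h: "\<Gamma> \<turnstile> h \<Ztypecolon> Pi Nat (IsProp (Ext (wk s) (App (wk i) (Var 0))))"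
  shows "\<Gamma> \<turnstile> Evg i s h \<Ztypecolon> Arr Nat Lift"
proof -
  let ?E = "Ext (wk s) (App (wk i) (Var 0))"
  have c1: "ctx (Nat # \<Gamma>)" using c by (rule ctx_Nat)
  have w: "Nat # \<Gamma> \<turnstile> wk i \<Ztypecolon> Arr Nat Nat" "Nat # \<Gamma> \<turnstile> wk s \<Ztypecolon> Arr Nat Nat"
    using wk_tm[OF c1 i] wk_tm[OF c1 s] by (simp_all add: wk_Arr_Nat)
  have E: "Nat # \<Gamma> \<turnstile> ?E \<Ztypecolon> Univ" using c c1 w by (intro Ext_ty App_Arr[of _ _ Nat] Var_small)
  then have Et: "Nat # \<Gamma> \<turnstile> ?E type" by (rule ty_El)
  then have c2: "ctx (?E # Nat # \<Gamma>)" by (rule ctx_cons[OF c1])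
  have "Nat # \<Gamma> \<turnstile> App (wk h) (Var 0) \<Ztypecolon> IsProp ?E"
    using tm_App[OF wk_tm[OF c1 h, simplified] Var_small(1)[OF c]] by (simp add: raw_sub sub_ren sub_Var_ren)
  moreover have "?E # Nat # \<Gamma> \<turnstile> P1 (Var 0) \<Ztypecolon> Nat"
    using tm_P1[of _ "Var 0" Nat] Var_0[OF c2] by (simp add: raw_sub) (simp add: Ext_def)
  then have "Nat # \<Gamma> \<turnstile> Lam ?E (P1 (Var 0)) \<Ztypecolon> Arr ?E Nat"
    unfolding Arr_def using Et by (intro tm_Lam) auto
  moreover have "IsProp ?E # Nat # \<Gamma> \<turnstile> wk (Arr ?E Nat) type"
    using Et c1 by (intro wk_type Arr_ty small_types ctx_cons[OF c1] IsProp_ty)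
  ultimately have "Nat # \<Gamma> \<turnstile> Pr (App (wk h) (Var 0)) (Lam ?E (P1 (Var 0))) \<Ztypecolon> Sig (IsProp ?E) (wk (Arr ?E Nat))"
    using Et c1 by (intro tm_Pr IsProp_ty) (auto simp: inst_wk)
  then have "Nat # \<Gamma> \<turnstile> Pr ?E (Pr (App (wk h) (Var 0)) (Lam ?E (P1 (Var 0)))) \<Ztypecolon> Lift"
    unfolding Lift_def using E c1
    by (intro tm_Pr ty_Univ Lift_body_ty) (auto simp: raw_sub ups_def)
  then show ?thesis unfolding Evg_def Arr_def using c
    by (auto simp: raw_sub intro: tm_Lam small_types)
qed

lemmas expr_defs = bind_def closed_def univ_def pi_def arr_def lam_def app_def sig_def times_def pair_def pr1_def
  pr2_def plus_def inl_def inr_def cases_def empty_def unit_def star_def unitrec_def nat\<^sub>t_def zero_def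
  succ_def natrec_def eq_def rfl_def trunc_def isProp_def neg_def decidable_def fiber_def isEmbedding_def lift_def
  unit_isProp_def eta_def numeral_eq_Suc

lemma machine_closed: "machine d = machine 0" "ren r (machine 0) = machine 0"
  by (simp_all add: machine_def isPrimRec_def primrec_stage_def pr_rec_def pr_comp_def pr_initial_def nfun_def
      vcons_def tail_def head_def vec_def fin_def expr_defs ren_Arr)

text \<open>Exposes just the shape of the machine type, as far as the projections
  \<open>init\<close> and \<open>step\<close> require it; the predicates of primitive recursiveness
  stay hidden in \<open>Q\<close> and \<open>Q'\<close>.\<close>

lemma machine_parts: "\<exists>Q Q'. machine 0 = Sig (Sig (Arr Nat Nat) Q) (Sig (Arr Nat Nat) Q')"
  by (simp add: machine_def times_def sig_def bind_def arr_def nat\<^sub>t_def)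

lemma ext_prop_raw: "ext_prop_ty 0 = Pi (Arr Nat Nat) (Pi Nat (IsProp (Ext (Var 1) (Var 0))))"
  by (simp add: ext_prop_ty_def ext_def run_from_def decode_def Ext_def Run_def Decode_def expr_defs)

lemma eval_isProp_raw:
  "eval_isProp 0 = Pi (machine 0) (Pi Nat (IsProp (Ext (P1 (P2 (Var 1))) (App (P1 (P1 (Var 1))) (Var 0)))))"
  by (simp add: eval_isProp_def eval_extent_def run_def step'_def init_def step_def decode_def
      Ext_def Run_def Decode_def expr_defs)

lemma machine_proj:
  assumes "\<Gamma> \<turnstile> m \<Ztypecolon> machine 0"
  shows "\<Gamma> \<turnstile> P1 (P1 m) \<Ztypecolon> Arr Nat Nat" "\<Gamma> \<turnstile> P1 (P2 m) \<Ztypecolon> Arr Nat Nat"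
proof -
  obtain Q Q' where "machine 0 = Sig (Sig (Arr Nat Nat) Q) (Sig (Arr Nat Nat) Q')" using machine_parts by blast
  then have m: "\<Gamma> \<turnstile> m \<Ztypecolon> Sig (Sig (Arr Nat Nat) Q) (Sig (Arr Nat Nat) Q')" using assms by simp
  show "\<Gamma> \<turnstile> P1 (P1 m) \<Ztypecolon> Arr Nat Nat" using m by (blast intro: tm_P1)
  show "\<Gamma> \<turnstile> P1 (P2 m) \<Ztypecolon> Arr Nat Nat" using tm_P2[OF m] by (auto simp: sub_Arr intro: tm_P1)
qed

text \<open>
  Here and below \<open>M\<close> is the normal form of the type of machines, which is all that the checker shows to be well typed.
\<close>

lemma machine_var:
  assumes "[] \<turnstile> M \<Ztypecolon> Univ" "[] \<turnstile> M \<doteq> machine 0 \<Ztypecolon> Univ" "ctx \<Gamma>"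
  shows "ctx (M # \<Gamma>)" "M # \<Gamma> \<turnstile> Var 0 \<Ztypecolon> machine 0"
proof -
  show c: "ctx (M # \<Gamma>)" using assms(3) from_nil(3)[OF assms(3,1)] by (intro ctx_cons ty_El)
  show "M # \<Gamma> \<turnstile> Var 0 \<Ztypecolon> machine 0"
    using Var_0[OF c] tyeq_El[OF from_nil(4)[OF c assms(2)]] closed_ren[OF assms(1)] by (auto intro: tm_conv)
qed

text \<open>A run depends on the argument only through the initial state, so \<open>e\<close> is
  applied at the step function of the machine and at the value of its initialisation. The
  abstraction is over the well-typed \<open>M\<close>, and the resulting product is converted to the
  machine type at the end.\<close>

lemma eval_isProp_inhabited:
  assumes e: "[] \<turnstile> e \<Ztypecolon> ext_prop_ty 0" and M: "[] \<turnstile> M \<Ztypecolon> Univ" "[] \<turnstile> M \<doteq> machine 0 \<Ztypecolon> Univ"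
  shows "\<exists>q. [] \<turnstile> q \<Ztypecolon> eval_isProp 0"
proof -
  note m = machine_var[OF M ctx_nil]
  have c: "ctx [Nat, M]" using m(1) by (rule ctx_Nat)
  have "[Nat, M] \<turnstile> Var 1 \<Ztypecolon> machine 0" using wk_tm[OF c m(2)] by (simp add: machine_closed(2))
  note p = machine_proj[OF this]
  have a: "[Nat, M] \<turnstile> App (P1 (P1 (Var 1))) (Var 0) \<Ztypecolon> Nat" using p(1) Var_small(1)[OF m(1)] by (rule App_Arr)
  let ?B = "IsProp (Ext (P1 (P2 (Var 1))) (App (P1 (P1 (Var 1))) (Var 0)))"
  have "[Nat, M] \<turnstile> e \<Ztypecolon> Pi (Arr Nat Nat) (Pi Nat (IsProp (Ext (Var 1) (Var 0))))"
    using from_nil(3)[OF c e] by (simp add: ext_prop_raw)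
  from tm_App[OF this p(2)] have "[Nat, M] \<turnstile> App e (P1 (P2 (Var 1))) \<Ztypecolon> Pi Nat (IsProp (Ext (P1 (P2 (Var 2))) (Var 0)))"
    by (simp add: raw_sub ups_def numeral_2_eq_2)
  from tm_App[OF this a] have "[Nat, M] \<turnstile> App (App e (P1 (P2 (Var 1)))) (App (P1 (P1 (Var 1))) (Var 0)) \<Ztypecolon> ?B"
    by (simp add: raw_sub numeral_2_eq_2)
  then have 1: "[] \<turnstile> Lam M (Lam Nat (App (App e (P1 (P2 (Var 1)))) (App (P1 (P1 (Var 1))) (Var 0)))) \<Ztypecolon> Pi M (Pi Nat ?B)"
    using m(1) ty_El[OF M(1)] by (intro tm_Lam small_types)
  have "[M] \<turnstile> Pi Nat ?B type" using m(1) c p(2) a by (intro ty_Pi small_types IsProp_ty ty_El[OF Ext_ty])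
  then have "[] \<turnstile> Pi M (Pi Nat ?B) \<doteq> eval_isProp 0 type"
    unfolding eval_isProp_raw using ty_El[OF M(1)] tyeq_El[OF M(2)] by (intro tyeq_Pi tyeq_refl)
  with 1 show ?thesis by (blast intro: tm_conv)
qed

section \<open>The decidability statement in de Bruijn form and its instances\<close>

definition Pfun :: tm where "Pfun = Arr Nat Lift"

definition IsComp :: "tm \<Rightarrow> tm \<Rightarrow> tm \<Rightarrow> tm" where
  "IsComp M ev f = Trunc (Sig M (Eq Pfun (wk f) (App (wk ev) (Var 0))))"

definition Dec :: "tm \<Rightarrow> tm" where "Dec X = Plus X (Arr X Empty)"

definition EmbDec :: "tm \<Rightarrow> tm \<Rightarrow> tm" where
  "EmbDec K z =
     Arr (Sig (Arr K Nat) (Pi Nat (IsProp (Sig (wk (wk K)) (Eq Nat (App (Var 2) (Var 0)) (Var 1))))))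
       (Sig (Pi K (Pi (wk K) (Dec (Eq (wk (wk K)) (Var 1) (Var 0)))))
         (wk (Pi K (Dec (Eq Pfun (P1 (Var 0)) (wk z))))))"

lemma sub_Pfun: "sub \<sigma> Pfun = Pfun" "ren r Pfun = Pfun"
  by (simp_all add: Pfun_def raw_sub)

lemma Pfun_raw: "pfun d = Pfun"
  by (simp add: pfun_def Pfun_def Lift_def expr_defs)

lemma sub_IsComp: "sub \<sigma> (IsComp M ev f) = IsComp (sub \<sigma> M) (sub \<sigma> ev) (sub \<sigma> f)"
  "ren r (IsComp M ev f) = IsComp (ren r M) (ren r ev) (ren r f)"
  by (simp_all add: IsComp_def sub_Pfun sub_ups_wk ren_upr_wk ups_0)

lemma sub_EmbDec: "sub \<sigma> (EmbDec K z) = EmbDec (sub \<sigma> K) (sub \<sigma> z)"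
  by (simp add: EmbDec_def Dec_def sub_Pfun sub_ups_wk ren_upr_wk sub_Arr sub_IsProp ren_Arr ups_0 ups_def[of "ups (ups _)"]
      numeral_2_eq_2)

lemma comp_dec_raw:
  "comp_dec_ty 0 = Pi Univ (Pi (Arr (Var 0) Pfun) (Pi Pfun (Arr (IsComp (Var 2) (Var 1) (Var 0))
     (EmbDec (Sig Pfun (IsComp (Var 3) (Var 2) (Var 0))) (Var 0)))))"
  by (simp add: comp_dec_ty_def emb_dec_def isCompOf_def Pfun_raw IsComp_def EmbDec_def Dec_def sub_Pfun ren_Arr ren_IsProp
      pi_def arr_def sig_def bind_def times_def univ_def trunc_def eq_def app_def isEmbedding_def fiber_def
      isProp_def decidable_def neg_def plus_def empty_def pr1_def nat\<^sub>t_def numeral_eq_Suc)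

text \<open>Because the arguments are closed, they survive unchanged under the remaining binders
  while the product is instantiated one variable at a time.\<close>

lemma comp_dec_apply:
  assumes c: "[] \<turnstile> c \<Ztypecolon> comp_dec_ty 0" and M: "[] \<turnstile> M \<Ztypecolon> Univ" and ev: "[] \<turnstile> ev \<Ztypecolon> Arr M Pfun"
    and z: "[] \<turnstile> z \<Ztypecolon> Pfun" and d: "[] \<turnstile> d \<Ztypecolon> IsComp M ev z"
  shows "\<exists>t. [] \<turnstile> t \<Ztypecolon> EmbDec (Sig Pfun (IsComp M ev (Var 0))) z"
proof -
  note cl = closed_ren[OF M] closed_ren[OF ev] closed_ren[OF z] closed_sub[OF M] closed_sub[OF ev] closed_sub[OF z]
  note sb = raw_sub sub_Pfun sub_IsComp sub_EmbDec cl ups_def numeral_2_eq_2 numeral_3_eq_3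
  have "[] \<turnstile> App c M \<Ztypecolon> Pi (Arr M Pfun) (Pi Pfun (Arr (IsComp M (Var 1) (Var 0))
     (EmbDec (Sig Pfun (IsComp M (Var 2) (Var 0))) (Var 0))))"
    using tm_App[OF c[unfolded comp_dec_raw] M] by (simp add: sb)
  from tm_App[OF this ev] have "[] \<turnstile> App (App c M) ev \<Ztypecolon> Pi Pfun (Arr (IsComp M ev (Var 0))
     (EmbDec (Sig Pfun (IsComp M ev (Var 0))) (Var 0)))"
    by (simp add: sb)
  from tm_App[OF this z] have "[] \<turnstile> App (App (App c M) ev) z \<Ztypecolon> Arr (IsComp M ev z)
     (EmbDec (Sig Pfun (IsComp M ev (Var 0))) z)"
    by (simp add: sb)
  from App_Arr[OF this d] show ?thesis by blast
qed

lemma zero_fun_closed: "zero_fun d = zero_fun 0" "sub \<sigma> (zero_fun 0) = zero_fun 0" "ren r (zero_fun 0) = zero_fun 0"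
  by (simp_all add: zero_fun_def expr_defs ups_def)

lemma zero_path_raw:
  "zero_path_ty 0 = Pi (Arr Nat Nat) (Pi (Arr Nat Nat) (Pi (Pi Nat (IsProp (Ext (Var 1) (App (Var 2) (Var 0)))))
     (Arr (Pi Nat (Eq Nat (App (Var 3) (Var 0)) Zero)) (Arr (Eq Nat (App (Var 1) Zero) (Succ Zero))
       (Eq Pfun (zero_fun 0) (Evg (Var 2) (Var 1) (Var 0)))))))"
  by (simp add: zero_path_ty_def evg_def Evg_def ext_def run_from_def decode_def Ext_def Run_def Decode_def
      Pfun_raw zero_fun_closed(1)[of "Suc _"] expr_defs)

lemma zero_path_apply:
  assumes p: "[] \<turnstile> p \<Ztypecolon> zero_path_ty 0" and i: "[] \<turnstile> i \<Ztypecolon> Arr Nat Nat" and s: "[] \<turnstile> s \<Ztypecolon> Arr Nat Nat"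
    and h: "[] \<turnstile> h \<Ztypecolon> Pi Nat (IsProp (Ext s (App i (Var 0))))"
    and a: "[] \<turnstile> a \<Ztypecolon> Pi Nat (Eq Nat (App i (Var 0)) Zero)" and b: "[] \<turnstile> b \<Ztypecolon> Eq Nat (App s Zero) (Succ Zero)"
  shows "\<exists>t. [] \<turnstile> t \<Ztypecolon> Eq Pfun (zero_fun 0) (Evg i s h)"
proof -
  note cl = closed_ren[OF i] closed_ren[OF s] closed_ren[OF h] closed_sub[OF i] closed_sub[OF s] closed_sub[OF h]
  note sb = raw_sub sub_Pfun cl ups_def numeral_2_eq_2 numeral_3_eq_3 zero_fun_closed(2)
  have "[] \<turnstile> App p i \<Ztypecolon> Pi (Arr Nat Nat) (Pi (Pi Nat (IsProp (Ext (Var 1) (App i (Var 0)))))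
     (Arr (Pi Nat (Eq Nat (App i (Var 0)) Zero)) (Arr (Eq Nat (App (Var 1) Zero) (Succ Zero))
       (Eq Pfun (zero_fun 0) (Evg i (Var 1) (Var 0))))))"
    using tm_App[OF p[unfolded zero_path_raw] i] by (simp add: sb)
  from tm_App[OF this s] have "[] \<turnstile> App (App p i) s \<Ztypecolon> Pi (Pi Nat (IsProp (Ext s (App i (Var 0)))))
     (Arr (Pi Nat (Eq Nat (App i (Var 0)) Zero)) (Arr (Eq Nat (App s Zero) (Succ Zero))
       (Eq Pfun (zero_fun 0) (Evg i s (Var 0)))))"
    by (simp add: sb)
  from tm_App[OF this h] have "[] \<turnstile> App (App (App p i) s) h \<Ztypecolon>
     Arr (Pi Nat (Eq Nat (App i (Var 0)) Zero)) (Arr (Eq Nat (App s Zero) (Succ Zero))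
       (Eq Pfun (zero_fun 0) (Evg i s h)))"
    by (simp add: sb)
  from App_Arr[OF App_Arr[OF this a] b] show ?thesis by blast
qed

lemma zero_machine_raw:
  "zero_machine_ty 0 = Sig (machine 0) (Sig (Pi Nat (Eq Nat (App (P1 (P1 (Var 1))) (Var 0)) Zero))
     (Eq Nat (App (P1 (P2 (Var 1))) Zero) (Succ Zero)))"
  by (simp add: zero_machine_ty_def init_def step_def expr_defs)

definition Ev :: "tm \<Rightarrow> tm" where
  "Ev q = Evg (P1 (P1 (Var 0))) (P1 (P2 (Var 0))) (App q (Var 0))"

text \<open>\<open>closed q\<close> ignores the depth, whereas \<open>Evg\<close> inside
  \<open>Ev\<close> weakens \<open>q\<close> under the binder of the evaluated function. The two
  agree because a typable closed term is invariant under renaming.\<close>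

lemma Comp_raw:
  assumes q: "[] \<turnstile> q \<Ztypecolon> A"
  shows "Comp (closed q) d = Sig Pfun (Trunc (Sig (machine 0) (Eq Pfun (Var 1) (Ev q))))"
  using closed_ren[OF q]
  by (simp add: Comp_def isComputable_def eval_def eval_extent_def run_def step'_def init_def step_def decode_def
      Ev_def Evg_def Ext_def Run_def Decode_def Pfun_def Lift_def machine_closed(1)[of "Suc _"] expr_defs)

lemma Comp_wk:
  assumes q: "[] \<turnstile> q \<Ztypecolon> A"
  shows "ren r (Comp (closed q) d) = Comp (closed q) d"
  using closed_ren[OF q]
  by (simp add: Comp_raw[OF q] sub_Pfun machine_closed(2) Ev_def Evg_def ren_Ext ren_upr_wk)

text \<open>Brings the goal into the shape that \<open>comp_dec_apply\<close> produces, up to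
  judgementally equal choices of the type of computable functions and of the zero function.\<close>

lemma target_raw:
  assumes q: "[] \<turnstile> q \<Ztypecolon> A"
  shows "embedding_implies_decidable (closed q) 0 = EmbDec (Comp (closed q) 0) (zero_fun 0)"
proof -
  have d: "Comp (closed q) (Suc d) = Comp (closed q) 0" for d using Comp_raw[OF q] by simp
  have L: "lift nat\<^sub>t d = Lift" for d by (simp add: Lift_def expr_defs)
  have z: "lam nat\<^sub>t (\<lambda>x. eta zero) (Suc d) = zero_fun 0" for d using zero_fun_closed(1)[of "Suc d"] by (simp add: zero_fun_def)
  show ?thesis
    by (simp add: embedding_implies_decidable_def EmbDec_def Dec_def Comp_wk[OF q] d z[unfolded nat\<^sub>t_def] L[unfolded nat\<^sub>t_def] zero_fun_closed(3) sub_Pfun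
        Pfun_def sub_Lift ren_Arr pi_def arr_def sig_def bind_def times_def eq_def app_def isEmbedding_def fiber_def
        isProp_def decidable_def neg_def plus_def empty_def pr1_def nat\<^sub>t_def numeral_eq_Suc)
qed

lemma Ev_ty:
  assumes q: "[] \<turnstile> q \<Ztypecolon> eval_isProp 0" and c: "ctx \<Gamma>" and m: "\<Gamma> \<turnstile> m \<Ztypecolon> machine 0"
  shows "\<Gamma> \<turnstile> App q m \<Ztypecolon> Pi Nat (IsProp (Ext (wk (P1 (P2 m))) (App (wk (P1 (P1 m))) (Var 0))))"
    "\<Gamma> \<turnstile> inst (Ev q) m \<Ztypecolon> Pfun"
proof -
  show h: "\<Gamma> \<turnstile> App q m \<Ztypecolon> Pi Nat (IsProp (Ext (wk (P1 (P2 m))) (App (wk (P1 (P1 m))) (Var 0))))"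
    using tm_App[OF from_nil(3)[OF c q, unfolded eval_isProp_raw] m] by (simp add: raw_sub ups_def)
  have "\<Gamma> \<turnstile> Evg (P1 (P1 m)) (P1 (P2 m)) (App q m) \<Ztypecolon> Arr Nat Lift"
    using machine_proj[OF m] h by (intro Evg_ty c) auto
  then show "\<Gamma> \<turnstile> inst (Ev q) m \<Ztypecolon> Pfun"
    by (simp add: Ev_def sub_Evg closed_sub[OF q] Pfun_def)
qed

lemma inst_Ev_Var: "[] \<turnstile> q \<Ztypecolon> A \<Longrightarrow> inst (Ev q) (Var 0) = Ev q"
  by (simp add: Ev_def sub_Evg closed_sub)

section \<open>Congruence of the decidability statement\<close>

lemma wk_tyeq: "ctx (C # \<Gamma>) \<Longrightarrow> \<Gamma> \<turnstile> A \<doteq> B type \<Longrightarrow> C # \<Gamma> \<turnstile> wk A \<doteq> wk B type"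
  using weaken(3) wkn_Suc by blast

lemma wk_tmeq: "ctx (C # \<Gamma>) \<Longrightarrow> \<Gamma> \<turnstile> t \<doteq> u \<Ztypecolon> A \<Longrightarrow> C # \<Gamma> \<turnstile> wk t \<doteq> wk u \<Ztypecolon> wk A"
  using weaken(5) wkn_Suc by blast

lemma Arr_cong:
  "ctx \<Gamma> \<Longrightarrow> \<Gamma> \<turnstile> A type \<Longrightarrow> \<Gamma> \<turnstile> A \<doteq> A' type \<Longrightarrow> \<Gamma> \<turnstile> B \<doteq> B' type \<Longrightarrow> \<Gamma> \<turnstile> Arr A B \<doteq> Arr A' B' type"
  unfolding Arr_def by (intro tyeq_Pi wk_tyeq ctx_cons)

lemma IsProp_cong:
  assumes c: "ctx \<Gamma>" and A: "\<Gamma> \<turnstile> A type" and e: "\<Gamma> \<turnstile> A \<doteq> A' type"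
  shows "\<Gamma> \<turnstile> IsProp A \<doteq> IsProp A' type"
proof -
  have c1: "ctx (A # \<Gamma>)" using ctx_cons[OF c A] .
  have A1: "A # \<Gamma> \<turnstile> wk A type" using wk_type[OF c1 A] .
  have c2: "ctx (wk A # A # \<Gamma>)" using ctx_cons[OF c1 A1] .
  have "wk A # A # \<Gamma> \<turnstile> Var 1 \<Ztypecolon> wk (wk A)" using wk_tm[OF c2 Var_0[OF c1]] by simp
  then show ?thesis unfolding IsProp_def
    using A A1 e wk_tyeq[OF c1 e] wk_tyeq[OF c2 wk_tyeq[OF c1 e]] Var_0[OF c2]
    by (intro tyeq_Pi tyeq_Eq tmeq_refl)
qed

lemma Dec_cong: "ctx \<Gamma> \<Longrightarrow> \<Gamma> \<turnstile> X type \<Longrightarrow> \<Gamma> \<turnstile> X \<doteq> X' type \<Longrightarrow> \<Gamma> \<turnstile> Dec X \<doteq> Dec X' type"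
  unfolding Dec_def by (intro tyeq_Plus Arr_cong tyeq_refl small_types)

lemma Dec_ty: "ctx \<Gamma> \<Longrightarrow> \<Gamma> \<turnstile> X type \<Longrightarrow> \<Gamma> \<turnstile> Dec X type"
  unfolding Dec_def by (intro ty_Plus Arr_ty small_types)

text \<open>Bridges the instance of \<open>comp_dec_ty\<close>, which contains normal forms and a
  beta redex, and the goal. The proof follows the structure of \<open>EmbDec\<close> through the
  congruence rules; the equation for \<open>K\<close> makes \<open>P1 (Var 0)\<close> an element of
  \<open>Pfun\<close>.\<close>

lemma EmbDec_cong:
  assumes K: "[] \<turnstile> K type" "[] \<turnstile> K \<doteq> K' type" "K = Sig Pfun B" and z: "[] \<turnstile> z \<Ztypecolon> Pfun" "[] \<turnstile> z \<doteq> z' \<Ztypecolon> Pfun"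
  shows "[] \<turnstile> EmbDec K z \<doteq> EmbDec K' z' type"
proof -
  have c1: "ctx [K]" using ctx_cons[OF ctx_nil K(1)] .
  have K1: "[K] \<turnstile> wk K type" "[K] \<turnstile> wk K \<doteq> wk K' type" using wk_type[OF c1 K(1)] wk_tyeq[OF c1 K(2)] .
  have c2: "ctx [wk K, K]" using ctx_cons[OF c1 K1(1)] .
  have K2: "[wk K, K] \<turnstile> wk (wk K) type" "[wk K, K] \<turnstile> wk (wk K) \<doteq> wk (wk K') type"
    using wk_type[OF c2 K1(1)] wk_tyeq[OF c2 K1(2)] .
  have v: "[wk K, K] \<turnstile> Var 0 \<Ztypecolon> wk (wk K)" "[wk K, K] \<turnstile> Var 1 \<Ztypecolon> wk (wk K)"
    using Var_0[OF c2] wk_tm[OF c2 Var_0[OF c1]] by simp_all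
  let ?X = "Pi K (Pi (wk K) (Dec (Eq (wk (wk K)) (Var 1) (Var 0))))"
  let ?X' = "Pi K' (Pi (wk K') (Dec (Eq (wk (wk K')) (Var 1) (Var 0))))"
  have X: "[] \<turnstile> ?X type" "[] \<turnstile> ?X \<doteq> ?X' type"
    using K K1 K2 v c2 by (auto intro!: ty_Pi tyeq_Pi Dec_ty Dec_cong ty_Eq tyeq_Eq tmeq_refl)
  have P: "[K] \<turnstile> P1 (Var 0) \<Ztypecolon> Pfun"
    using tm_P1[of "[K]" "Var 0"] Var_0[OF c1] K(3) by (simp add: sub_Pfun)
  have Pt: "[K] \<turnstile> Pfun type" unfolding Pfun_def using c1 by (intro Arr_ty small_types Lift_ty)
  have zz: "[K] \<turnstile> wk z \<Ztypecolon> Pfun" "[K] \<turnstile> wk z \<doteq> wk z' \<Ztypecolon> Pfun"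
    using wk_tm[OF c1 z(1)] wk_tmeq[OF c1 z(2)] by (simp_all add: sub_Pfun)
  have Y: "[] \<turnstile> Pi K (Dec (Eq Pfun (P1 (Var 0)) (wk z))) \<doteq> Pi K' (Dec (Eq Pfun (P1 (Var 0)) (wk z'))) type"
    using K(1,2) P Pt zz c1 by (intro tyeq_Pi Dec_cong ty_Eq tyeq_Eq tmeq_refl tyeq_refl)
  have F: "[] \<turnstile> Arr K Nat type" "[] \<turnstile> Arr K Nat \<doteq> Arr K' Nat type"
    using K(1,2) ctx_nil by (auto intro: Arr_ty Arr_cong small_types tyeq_refl)
  have d1: "ctx [Arr K Nat]" using ctx_cons[OF ctx_nil F(1)] .
  have d2: "ctx [Nat, Arr K Nat]" using ctx_Nat[OF d1] .
  have G: "[Nat, Arr K Nat] \<turnstile> wk (wk K) type" "[Nat, Arr K Nat] \<turnstile> wk (wk K) \<doteq> wk (wk K') type"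
    using wk_type[OF d2 wk_type[OF d1 K(1)]] wk_tyeq[OF d2 wk_tyeq[OF d1 K(2)]] .
  have d3: "ctx [wk (wk K), Nat, Arr K Nat]" using ctx_cons[OF d2 G(1)] .
  have "[wk (wk K), Nat, Arr K Nat] \<turnstile> Var 2 \<Ztypecolon> Arr (wk (wk (wk K))) Nat"
    using wk_tm[OF d3 wk_tm[OF d2 Var_0[OF d1]]] by (simp add: ren_Arr numeral_2_eq_2)
  then have f: "[wk (wk K), Nat, Arr K Nat] \<turnstile> App (Var 2) (Var 0) \<Ztypecolon> Nat" using Var_0[OF d3] by (rule App_Arr)
  have y: "[wk (wk K), Nat, Arr K Nat] \<turnstile> Var 1 \<Ztypecolon> Nat" using wk_tm[OF d3 Var_0[OF d2]] by simp
  let ?S = "\<lambda>K. Sig (wk (wk K)) (Eq Nat (App (Var 2) (Var 0)) (Var 1))"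
  have S: "[Nat, Arr K Nat] \<turnstile> ?S K type" "[Nat, Arr K Nat] \<turnstile> ?S K \<doteq> ?S K' type"
    using G f y small_types(1)[OF d3] by (auto intro!: ty_Sig tyeq_Sig ty_Eq tyeq_Eq tmeq_refl tyeq_refl)
  have E: "[] \<turnstile> Sig (Arr K Nat) (Pi Nat (IsProp (?S K))) type"
    "[] \<turnstile> Sig (Arr K Nat) (Pi Nat (IsProp (?S K))) \<doteq> Sig (Arr K' Nat) (Pi Nat (IsProp (?S K'))) type"
    using F S d1 d2 by (auto intro!: ty_Sig tyeq_Sig ty_Pi tyeq_Pi IsProp_ty IsProp_cong small_types tyeq_refl)
  show ?thesis unfolding EmbDec_def
    by (rule Arr_cong[OF ctx_nil E tyeq_Sig[OF X wk_tyeq[OF ctx_cons[OF ctx_nil X(1)] Y]]])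
qed

lemma decidable_inhabited:
  assumes c: "[] \<turnstile> c \<Ztypecolon> comp_dec_ty 0" and p: "[] \<turnstile> p \<Ztypecolon> zero_path_ty 0" and w: "[] \<turnstile> w \<Ztypecolon> zero_machine_ty 0"
    and M: "[] \<turnstile> M \<Ztypecolon> Univ" "[] \<turnstile> M \<doteq> machine 0 \<Ztypecolon> Univ"
    and z: "[] \<turnstile> z \<Ztypecolon> Pfun" "[] \<turnstile> z \<doteq> zero_fun 0 \<Ztypecolon> Pfun"
    and q: "[] \<turnstile> q \<Ztypecolon> eval_isProp 0"
  shows "\<exists>t. [] \<turnstile> t \<Ztypecolon> embedding_implies_decidable (closed q) 0"
proof -
  let ?ev = "Lam M (Ev q)" and ?m = "P1 w"
  have Mt: "\<Gamma> \<turnstile> M type" if "ctx \<Gamma>" for \<Gamma> using from_nil(3)[OF that M(1)] by (rule ty_El)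
  have Pt: "\<Gamma> \<turnstile> Pfun type" if "ctx \<Gamma>" for \<Gamma> unfolding Pfun_def using that by (intro Arr_ty small_types Lift_ty)
  have Ev: "M # \<Gamma> \<turnstile> Ev q \<Ztypecolon> Pfun" if "ctx \<Gamma>" for \<Gamma>
    using Ev_ty(2)[OF q machine_var[OF M that]] inst_Ev_Var[OF q] by simp
  have ev: "\<Gamma> \<turnstile> ?ev \<Ztypecolon> Arr M Pfun" if "ctx \<Gamma>" for \<Gamma>
    unfolding Arr_def using Ev[OF that] Mt[OF that] by (intro tm_Lam) (auto simp: sub_Pfun)
  have beta: "\<Gamma> \<turnstile> App ?ev a \<doteq> inst (Ev q) a \<Ztypecolon> Pfun" if "ctx \<Gamma>" "\<Gamma> \<turnstile> a \<Ztypecolon> M" for \<Gamma> a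
    using beta_Pi[OF Mt[OF that(1)] Ev[OF that(1)] that(2)] by (simp add: sub_Pfun)
  note cl = closed_ren[OF M(1)] closed_ren[OF ev[OF ctx_nil]] closed_ren[OF z(1)] closed_ren[OF w] closed_ren[OF q]
  have m: "[] \<turnstile> ?m \<Ztypecolon> machine 0" and w2: "[] \<turnstile> P2 w \<Ztypecolon> Sig (Pi Nat (Eq Nat (App (P1 (P1 ?m)) (Var 0)) Zero))
     (Eq Nat (App (P1 (P2 ?m)) Zero) (Succ Zero))"
    using tm_P1[OF w[unfolded zero_machine_raw]] tm_P2[OF w[unfolded zero_machine_raw]] by (simp_all add: ups_def cl)
  have a: "[] \<turnstile> P1 (P2 w) \<Ztypecolon> Pi Nat (Eq Nat (App (P1 (P1 ?m)) (Var 0)) Zero)" using w2 by (rule tm_P1)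
  have b: "[] \<turnstile> P2 (P2 w) \<Ztypecolon> Eq Nat (App (P1 (P2 ?m)) Zero) (Succ Zero)"
    using tm_P2[OF w2] by (simp add: closed_sub[OF w])
  have "\<exists>t. [] \<turnstile> t \<Ztypecolon> Eq Pfun (zero_fun 0) (Evg (P1 (P1 ?m)) (P1 (P2 ?m)) (App q ?m))"
    using Ev_ty(1)[OF q ctx_nil m] by (intro zero_path_apply[OF p machine_proj[OF m] _ a b]) (simp add: cl)
  then obtain t where t: "[] \<turnstile> t \<Ztypecolon> Eq Pfun (zero_fun 0) (inst (Ev q) ?m)"
    by (auto simp: Ev_def sub_Evg closed_sub[OF q])
  have mM: "[] \<turnstile> ?m \<Ztypecolon> M" using m tyeq_El[OF M(2)] by (blast intro: tm_conv tyeq_sym)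
  \<comment> \<open>The path obtained so far concerns the raw zero function and evaluation at the
    machine, whereas the computability evidence must mention the normal form \<open>z\<close> and
    the abstraction \<open>?ev\<close> applied to the machine.\<close>
  have "[] \<turnstile> Eq Pfun (zero_fun 0) (inst (Ev q) ?m) \<doteq> Eq Pfun z (App ?ev ?m) type"
    using z(2) beta[OF ctx_nil mM] Pt[OF ctx_nil] by (intro tyeq_Eq tyeq_refl) (auto intro: tmeq_sym)
  with t have t': "[] \<turnstile> t \<Ztypecolon> Eq Pfun z (App ?ev ?m)" by (rule tm_conv)
  have cM: "ctx [M]" using machine_var(1)[OF M ctx_nil] .
  have v: "M # \<Gamma> \<turnstile> Var 0 \<Ztypecolon> M" if "ctx (M # \<Gamma>)" for \<Gamma> using Var_0[OF that] by (simp add: cl)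
  have "[M] \<turnstile> Eq Pfun z (App ?ev (Var 0)) type"
    using Pt[OF cM] from_nil(3)[OF cM z(1)] App_Arr[OF ev[OF cM] v[OF cM]] by (rule ty_Eq)
  then have "[] \<turnstile> Pr ?m t \<Ztypecolon> Sig M (Eq Pfun z (App ?ev (Var 0)))"
    using Mt[OF ctx_nil] mM t' closed_sub[OF z(1)] closed_sub[OF ev[OF ctx_nil]]
    by (intro tm_Pr) (auto simp: sub_Pfun)
  then have "[] \<turnstile> TrIn (Pr ?m t) \<Ztypecolon> IsComp M ?ev z" unfolding IsComp_def cl by (rule tm_TrIn)
  from comp_dec_apply[OF c M(1) ev[OF ctx_nil] z(1) this]
  obtain r where r: "[] \<turnstile> r \<Ztypecolon> EmbDec (Sig Pfun (IsComp M ?ev (Var 0))) z" by blast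
  have cL: "ctx [Pfun]" using ctx_cons[OF ctx_nil Pt[OF ctx_nil]] .
  have cML: "ctx [M, Pfun]" using machine_var(1)[OF M cL] .
  have f: "[M, Pfun] \<turnstile> Var 1 \<Ztypecolon> Pfun" using wk_tm[OF cML Var_0[OF cL]] by (simp add: sub_Pfun)
  have C: "IsComp M ?ev (Var 0) = Trunc (Sig M (Eq Pfun (Var 1) (App ?ev (Var 0))))" by (simp only: IsComp_def cl) simp
  have "[M, Pfun] \<turnstile> Eq Pfun (Var 1) (App ?ev (Var 0)) type"
    using Pt[OF cML] f App_Arr[OF ev[OF cML] v[OF cML]] by (rule ty_Eq)
  then have Kt: "[] \<turnstile> Sig Pfun (IsComp M ?ev (Var 0)) type"
    unfolding C using Pt[OF ctx_nil] Mt[OF cL] by (intro ty_Sig ty_Trunc)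
  have "[M, Pfun] \<turnstile> App ?ev (Var 0) \<doteq> Ev q \<Ztypecolon> Pfun"
    using beta[OF cML v[OF cML]] inst_Ev_Var[OF q] by simp
  \<comment> \<open>Componentwise: \<open>M\<close> converts to the machine type, and the redex
    \<open>App ?ev (Var 0)\<close> to \<open>Ev q\<close>.\<close>
  then have "[] \<turnstile> Sig Pfun (IsComp M ?ev (Var 0)) \<doteq> Comp (closed q) 0 type"
    unfolding C Comp_raw[OF q] using Pt[OF ctx_nil] Pt[OF cML] Mt[OF cL] f tyeq_El[OF from_nil(4)[OF cL M(2)]]
    by (intro tyeq_Sig tyeq_Trunc tyeq_Eq tyeq_refl tmeq_refl)
  from EmbDec_cong[OF Kt this refl z] r show ?thesis
    unfolding target_raw[OF q] by (blast intro: tm_conv)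
qed

section \<open>The theorem\<close>

definition inhabited :: "expr \<Rightarrow> bool" where
  "inhabited T \<longleftrightarrow> (\<exists>t. [] \<turnstile> t \<Ztypecolon> T 0)"

lemma proves_inhabited: "proves k t T \<Longrightarrow> inhabited T"
  unfolding inhabited_def by (meson proves_sound)

lemma inhabited_mp: "inhabited (A \<rightarrow>\<^sub>t B) \<Longrightarrow> inhabited A \<Longrightarrow> inhabited B"
  by (auto simp: inhabited_def arr_def intro: App_Arr)

section \<open>Running the checker on the proof terms\<close>

lemma hedberg_inhabited: "inhabited hedberg_ty"
proof (rule proves_inhabited)
  \<comment> \<open>The fuel bounds the depth of nested calls of the checker and not their number,
    so a small constant suffices; the terms involving machines are run with 100.\<close>
  show "proves 50 hedberg hedberg_ty" by code_simp
qed

lemma nat_dec_inhabited: "inhabited nat_dec_ty"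
proof (rule proves_inhabited)
  show "proves 50 nat_dec nat_dec_ty" by code_simp
qed

lemma nat_set_inhabited: "inhabited nat_set_ty"
proof -
  have "proves 50 nat_set (hedberg_ty \<rightarrow>\<^sub>t nat_dec_ty \<rightarrow>\<^sub>t nat_set_ty)" by code_simp
  then show ?thesis
    using proves_inhabited inhabited_mp hedberg_inhabited nat_dec_inhabited by blast
qed

lemma unit_set_inhabited: "inhabited unit_set_ty"
proof -
  have "proves 50 unit_set (hedberg_ty \<rightarrow>\<^sub>t unit_set_ty)" by code_simp
  then show ?thesis using proves_inhabited inhabited_mp hedberg_inhabited by blast
qed

lemma halts_unique_inhabited: "inhabited halts_unique_ty"
proof (rule proves_inhabited)
  show "proves 50 halts_unique halts_unique_ty" by code_simp
qed

lemma ext_prop_inhabited: "inhabited ext_prop_ty"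
proof -
  have "proves 50 ext_prop (nat_set_ty \<rightarrow>\<^sub>t halts_unique_ty \<rightarrow>\<^sub>t ext_prop_ty)" by code_simp
  then show ?thesis
    using proves_inhabited inhabited_mp nat_set_inhabited halts_unique_inhabited by blast
qed

lemma lift_eq_eta_inhabited: "inhabited lift_eq_eta_ty"
proof -
  have "proves 50 lift_eq_eta (unit_set_ty \<rightarrow>\<^sub>t lift_eq_eta_ty)" by code_simp
  then show ?thesis using proves_inhabited inhabited_mp unit_set_inhabited by blast
qed

lemma zero_path_inhabited: "inhabited zero_path_ty"
proof -
  have "proves 50 zero_path (lift_eq_eta_ty \<rightarrow>\<^sub>t zero_path_ty)" by code_simp
  then show ?thesis using proves_inhabited inhabited_mp lift_eq_eta_inhabited by blast
qed

lemma comp_dec_inhabited: "inhabited comp_dec_ty"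
proof -
  have "proves 50 comp_dec (nat_dec_ty \<rightarrow>\<^sub>t comp_dec_ty)" by code_simp
  then show ?thesis using proves_inhabited inhabited_mp nat_dec_inhabited by blast
qed

lemma zero_machine_inhabited: "inhabited zero_machine_ty"
proof (rule proves_inhabited)
  show "proves 100 zero_machine zero_machine_ty" by code_simp
qed

text \<open>\<open>comp_dec_ty\<close> quantifies over \<open>univ\<close>, so the machine type must
  be available as a term of the universe; checking \<open>machine\<close> against
  \<open>univ\<close> provides its normal form as such a term.\<close>

lemma machine_normal_form: obtains M where "[] \<turnstile> M \<Ztypecolon> Univ" "[] \<turnstile> M \<doteq> machine 0 \<Ztypecolon> Univ"
proof -
  have "proves 100 machine univ" by code_simp
  from proves_sound[OF this] show ?thesis using that by (auto simp: univ_def)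
qed

lemma zero_fun_normal_form: obtains z where "[] \<turnstile> z \<Ztypecolon> Pfun" "[] \<turnstile> z \<doteq> zero_fun 0 \<Ztypecolon> Pfun"
proof -
  have "proves 50 zero_fun pfun" by code_simp
  from proves_sound[OF this] show ?thesis using that by (auto simp: Pfun_raw)
qed

theorem theorem8p6:
  shows "(\<exists>q. [] \<turnstile> q \<Ztypecolon> eval_isProp 0) \<and>
    (\<forall>q. [] \<turnstile> q \<Ztypecolon> eval_isProp 0 \<longrightarrow>
      (\<exists>t. [] \<turnstile> t \<Ztypecolon> embedding_implies_decidable (closed q) 0))"
proof -
  obtain M where M: "[] \<turnstile> M \<Ztypecolon> Univ" "[] \<turnstile> M \<doteq> machine 0 \<Ztypecolon> Univ" by (rule machine_normal_form)
  obtain z where z: "[] \<turnstile> z \<Ztypecolon> Pfun" "[] \<turnstile> z \<doteq> zero_fun 0 \<Ztypecolon> Pfun" by (rule zero_fun_normal_form)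
  obtain e c p w where "[] \<turnstile> e \<Ztypecolon> ext_prop_ty 0" "[] \<turnstile> c \<Ztypecolon> comp_dec_ty 0"
    "[] \<turnstile> p \<Ztypecolon> zero_path_ty 0" "[] \<turnstile> w \<Ztypecolon> zero_machine_ty 0"
    using ext_prop_inhabited comp_dec_inhabited zero_path_inhabited zero_machine_inhabited
    by (auto simp: inhabited_def)
  then show ?thesis
    using eval_isProp_inhabited[OF _ M] decidable_inhabited[OF _ _ _ M z] by blast
qed

end
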